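(* Let $N\ge 5$ and $k\ge 0$ be integers and $m=\lfloor N/2\rfloor$. Let $A_N,B_N$ be the matrices, $\mathfrak c_0,\dots,\mathfrak c_m$ the cusp representatives, $g(\mathfrak c_r)$ the associated integers, $\mathbf a^{(k)}$ the vector and $L_N(k)$ the set described in the context. Suppose $P_NV_NQ_N=\operatorname{diag}(d_1,\dots,d_m)$ (with $P_N,Q_N\in\operatorname{GL}_m(\mathbb Z)$) is the Smith normal form of $V_N=A_NB_N$. Then $L_N(k)$ is finite, and $$L_N(k)=\left\{A_N^{-1}\mathbf w(\mathbf v)\ \middle|\ \begin{array}{l} v_{\mathfrak c_r}\in\mathbb Z_{\ge0},\quad 0\le r\le m,\\[1mm] \sum_{r=0}^{m}|\mathrm{Orb}(\mathfrak c_r)|\,v_{\mathfrak c_r}=\frac{k}{24}\sum_{d\mid N}d\,\varphi(d)\,\varphi(N/d),\\[1mm] \bigl(P_N(\mathbf w(\mathbf v)-A_N\mathbf a^{(k)})\bigr)_r\equiv0\pmod{d_r},\quad 1\le r\le m\end{array}\right\},$$ where $\mathbf v=(v_{\mathfrak c_0},\dots,v_{\mathfrak c_{m-1}})^T$, $\mathbf g=(g(\mathfrak c_0),\dots,g(\mathfrak c_{m-1}))^T$ and $\mathbf w(\mathbf v)=\mathbf v-\frac{k}{12}\mathbf g$.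
   Context: Notation: $q=e^{2\pi i\tau}$, $\operatorname{Im}\tau>0$; $(x_1,\dots,x_s;q)_\infty=\prod_{i=1}^s\prod_{n\ge0}(1-x_iq^n)$; $\varphi$ is Euler's function; $m=\lfloor N/2\rfloor$. Products: for an even integer $a_0\ge0$ and $\mathbf a=(a_1,\dots,a_m)\in\mathbb Z^m$, $$f^{(N)}_{\mathbf a}(\tau)=q^{\frac N{24}S_1-\frac1{2N}S_2}(q^N;q^N)_\infty^{a_0}\prod_{j=1}^m(q^j,q^{N-j};q^N)_\infty^{a_j},\quad S_1=a_0+2\sum_{j=1}^m a_j,\quad S_2=\sum_{j=1}^m j(N-j)a_j.$$ For an integer $k\ge0$, $L_N(k)$ is the set of all $\mathbf a\in\mathbb Z^m$ such that, with $a_0=2k$, $f^{(N)}_{\mathbf a}\in M_k(\Gamma_1(N))$, the space of holomorphic modular forms of weight $k$ on $\Gamma_1(N)$. Cusps: the cusps of $X_1(N)$ are the $\Gamma_1(N)$-classes $[a/c]$, $\gcd(a,c)=1$, and $g([a/c])=\gcd(c,N)$. Every cusp can be written $[a/(gu)]$ with $g\mid N$, $u$ a unit mod $N/g$, $a\in(\mathbb Z/g\mathbb Z)^\times/\{\pm1\}$, $\gcd(a,gu)=1$. The group $\mathrm{Gal}(\mathbb Q(e^{2\pi i/N})/\mathbb Q)\cong(\mathbb Z/N\mathbb Z)^\times$ acts by $\sigma_x[a/(gu)]=[a/(xgu)]$; the orbits correspond to the pairs $(g,a)$ with $g\mid N$, $a\in(\mathbb Z/g\mathbb Z)^\times/\{\pm1\}$,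 and there are $m+1$ of them. Fix orbit representatives $\mathfrak c_0,\dots,\mathfrak c_m$ with $\mathfrak c_m=[1/N]=[i\infty]$; $\mathrm{Orb}(\mathfrak c_r)$ is the orbit of $\mathfrak c_r$. Matrix $A_N$: writing $\mathfrak c_r=[a/c]$, $g=g(\mathfrak c_r)$, $A_N$ is the $m\times m$ matrix with rows indexed by $0\le r\le m-1$, columns by $1\le j\le m$, and entries $\frac g2B_2(\langle ja/g\rangle)$, where $B_2(x)=x^2-x+\frac16$ and $\langle x\rangle=x-\lfloor x\rfloor$. This matrix is invertible. Matrix $B_N$: $B_5=\begin{pmatrix}16&-5\\-4&5\end{pmatrix}$. If $N\ge6$, put $M=N\gcd(2,N)$, let $r_N\in\{0,1,2\}$ with $r_N\equiv2M\pmod3$, $a_N=\frac{-M+5r_N}3$, $b_N=\frac{M-8r_N}3$, let $\mathbf e_1,\dots,\mathbf e_m$ be the standard basis of $\mathbb Z^m$, and let $j_1<\dots<j_r$ be the multiples of $3$ in $\{3,\dots,m\}$. The columns of $B_N$ are the $m$ vectors $16\mathbf e_1-4\mathbf e_2$; $\ a_N\mathbf e_1+b_N\mathbf e_2+r_N\mathbf e_3$; $\ \frac{j^2-4}3\mathbf e_1-\frac{j^2-1}3\mathbf e_2+\mathbf e_j$ for $3\le j\le m$, $3\nmid j$; $\ (j_1^2-4)\mathbf e_1-(j_1^2-1)\mathbf e_2+3\mathbf e_{j_1}$; and $\frac{j_t^2-j_1^2}3(\mathbf e_1-\mathbf e_2)-\mathbf e_{j_1}+\mathbf e_{j_t}$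 for $2\le t\le r$. ($V_N=A_NB_N$ is the class matrix, i.e. a presentation matrix of the $\mathbb Q$-rational cuspidal divisor class group of $X_1(N)$.) Vector $\mathbf a^{(k)}\in\mathbb Z^m$: $\mathbf a^{(k)}=(-3k,2k)^T$ if $N=5$, and $\mathbf a^{(k)}=(-3k,3k,-k,0,\dots,0)^T$ if $N\ge6$. *)

theory Defs
  imports
    "HOL-Complex_Analysis.Complex_Analysis"
    "HOL-Number_Theory.Number_Theory"
    "Jordan_Normal_Form.Gauss_Jordan_Elimination"
begin

section \<open>Holomorphic modular forms on \<open>\<Gamma>\<^sub>1(N)\<close>\<close>

text \<open>A quadruple \<open>(a, b, c, d)\<close> stands for the matrix with rows \<open>(a, b)\<close> and \<open>(c, d)\<close>.\<close>

definition SL2Z :: "(int \<times> int \<times> int \<times> int) set" where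
  "SL2Z = {(a, b, c, d). a * d - b * c = 1}"

definition Gamma1 :: "nat \<Rightarrow> (int \<times> int \<times> int \<times> int) set" where
  "Gamma1 N = {(a, b, c, d) \<in> SL2Z.
     [a = 1] (mod int N) \<and> [d = 1] (mod int N) \<and> [c = 0] (mod int N)}"

definition upper_half_plane :: "complex set" where
  "upper_half_plane = {\<tau>. Im \<tau> > 0}"

definition slash ::
  "nat \<Rightarrow> (complex \<Rightarrow> complex) \<Rightarrow> int \<times> int \<times> int \<times> int \<Rightarrow> complex \<Rightarrow> complex" where
  "slash k f = (\<lambda>(a, b, c, d) \<tau>.
     (of_int c * \<tau> + of_int d) powi (- int k) *
       f ((of_int a * \<tau> + of_int b) / (of_int c * \<tau> + of_int d)))"

text \<open>
  Holomorphy at the cusps: since \<open>\<Gamma>\<^sub>1(N)\<close> contains the principal congruence subgroup of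
  level \<open>N\<close>, every \<open>f|\<gamma>\<close> with \<open>\<gamma>\<close> in \<open>SL\<^sub>2(\<int>)\<close> is a function of
  \<open>exp (2\<pi>i\<tau>/N)\<close> on the punctured unit disc, and this function has to extend holomorphically
  to \<open>0\<close>. Values of \<open>f\<close> outside the upper half plane are not constrained.
\<close>

definition modular_forms :: "nat \<Rightarrow> nat \<Rightarrow> (complex \<Rightarrow> complex) set" where
  "modular_forms k N = {f.
     f holomorphic_on upper_half_plane \<and>
     (\<forall>\<gamma> \<in> Gamma1 N. \<forall>\<tau> \<in> upper_half_plane. slash k f \<gamma> \<tau> = f \<tau>) \<and>
     (\<forall>\<gamma> \<in> SL2Z. \<exists>h. h holomorphic_on ball 0 1 \<and>
        (\<forall>\<tau> \<in> upper_half_plane.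
           slash k f \<gamma> \<tau> = h (exp (2 * of_real pi * \<i> * \<tau> / of_nat N))))}"


section \<open>The products and the sets \<open>L\<^sub>N(k)\<close>\<close>

definition qpow :: "complex \<Rightarrow> rat \<Rightarrow> complex" where
  "qpow \<tau> e = exp (2 * of_real pi * \<i> * \<tau> * of_rat e)"

definition qpoch :: "complex \<Rightarrow> complex \<Rightarrow> complex" where
  "qpoch x q = (\<Prod>n. 1 - x * q ^ n)"

text \<open>
  Vectors and matrices are those of Jordan-Normal-Form, indexed from \<open>0\<close>; hence the
  coefficient \<open>a\<^sub>j\<close> of the text, \<open>1 \<le> j \<le> m\<close>, is entry \<open>j - 1\<close> of the vector.
\<close>

definition S1 :: "nat \<Rightarrow> nat \<Rightarrow> int Matrix.vec \<Rightarrow> int" where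
  "S1 N a0 a = int a0 + 2 * (\<Sum>j = 1..N div 2. vec_index a (j - 1))"

definition S2 :: "nat \<Rightarrow> int Matrix.vec \<Rightarrow> int" where
  "S2 N a = (\<Sum>j = 1..N div 2. int j * (int N - int j) * vec_index a (j - 1))"

definition eta_prod :: "nat \<Rightarrow> nat \<Rightarrow> int Matrix.vec \<Rightarrow> complex \<Rightarrow> complex" where
  "eta_prod N a0 a \<tau> =
     qpow \<tau> (of_nat N / 24 * of_int (S1 N a0 a) - 1 / (2 * of_nat N) * of_int (S2 N a)) *
     qpoch (qpow \<tau> (of_nat N)) (qpow \<tau> (of_nat N)) ^ a0 *
     (\<Prod>j = 1..N div 2.
        (qpoch (qpow \<tau> (of_nat j)) (qpow \<tau> (of_nat N)) *
         qpoch (qpow \<tau> (of_nat (N - j))) (qpow \<tau> (of_nat N))) powi vec_index a (j - 1))"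

definition L_set :: "nat \<Rightarrow> nat \<Rightarrow> int Matrix.vec set" where
  "L_set N k = {a \<in> carrier_vec (N div 2). eta_prod N (2 * k) a \<in> modular_forms k N}"


section \<open>Cusps of \<open>X\<^sub>1(N)\<close>\<close>

text \<open>
  A point of \<open>P\<^sup>1(\<rat>)\<close> is given by a coprime pair \<open>(a, c)\<close>, the pairs \<open>(a, c)\<close> and
  \<open>(-a, -c)\<close> being the same point. The cusp \<open>[a/c]\<close> is the set of all coprime pairs that
  represent a point of the \<open>\<Gamma>\<^sub>1(N)\<close>-orbit of \<open>a/c\<close>.
\<close>

definition cusp :: "nat \<Rightarrow> int \<times> int \<Rightarrow> (int \<times> int) set" where
  "cusp N = (\<lambda>(a, c). {(a', c'). \<exists>(\<alpha>, \<beta>, \<gamma>, \<delta>) \<in> Gamma1 N.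
     (a', c') = (\<alpha> * a + \<beta> * c, \<gamma> * a + \<delta> * c) \<or>
     (a', c') = (- (\<alpha> * a + \<beta> * c), - (\<gamma> * a + \<delta> * c))})"

definition cusps :: "nat \<Rightarrow> (int \<times> int) set set" where
  "cusps N = {cusp N (a, c) | a c. coprime a c}"

definition cusp_g :: "nat \<Rightarrow> int \<times> int \<Rightarrow> int" where
  "cusp_g N = (\<lambda>(a, c). gcd c (int N))"

text \<open>
  \<open>\<sigma>\<^sub>x [a/(gu)] = [a/(xgu)]\<close>: for \<open>c = gu\<close> with \<open>g = gcd c N\<close>, \<open>u\<close> is automatically a
  unit modulo \<open>N/g\<close>. The result does not depend on the representative \<open>(a, c)\<close>, so the union
  is a union of equal sets.
\<close>

definition galois_act :: "nat \<Rightarrow> int \<Rightarrow> (int \<times> int) set \<Rightarrow> (int \<times> int) set" where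
  "galois_act N x C = (\<Union>(a, c) \<in> {(a, c) \<in> C. coprime a (x * c)}. cusp N (a, x * c))"

definition Orb :: "nat \<Rightarrow> (int \<times> int) set \<Rightarrow> (int \<times> int) set set" where
  "Orb N C = {galois_act N x C | x. coprime x (int N)}"

text \<open>The cusp representatives, each written as \<open>[a/c]\<close> with a chosen coprime pair.\<close>

definition cusp_orbit_reps :: "nat \<Rightarrow> (nat \<Rightarrow> int \<times> int) \<Rightarrow> bool" where
  "cusp_orbit_reps N cr \<longleftrightarrow>
     (\<forall>r \<le> N div 2. coprime (fst (cr r)) (snd (cr r))) \<and>
     bij_betw (\<lambda>r. Orb N (cusp N (cr r))) {0..N div 2} (Orb N ` cusps N) \<and>
     cusp N (cr (N div 2)) = cusp N (1, int N)"


section \<open>Matrices and vectors\<close>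

definition B2 :: "rat \<Rightarrow> rat" where
  "B2 x = x\<^sup>2 - x + 1 / 6"

definition A_mat :: "nat \<Rightarrow> (nat \<Rightarrow> int \<times> int) \<Rightarrow> rat Matrix.mat" where
  "A_mat N cr = Matrix.mat (N div 2) (N div 2) (\<lambda>(r, j).
     let a = fst (cr r); g = cusp_g N (cr r)
     in of_int g / 2 * B2 (frac (of_int (int (Suc j) * a) / of_int g)))"

text \<open>The standard basis vector \<open>e\<^sub>j\<close>, \<open>1 \<le> j \<le> m\<close>.\<close>

definition e_vec :: "nat \<Rightarrow> nat \<Rightarrow> int Matrix.vec" where
  "e_vec N j = unit_vec (N div 2) (j - 1)"

text \<open>All integer divisions by \<open>3\<close> below are exact.\<close>

definition B_mat :: "nat \<Rightarrow> int Matrix.mat" where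
  "B_mat N = (if N = 5 then mat_of_rows_list 2 [[16, -5], [-4, 5]] else
     let m = N div 2;
         e = e_vec N;
         M = int (N * gcd 2 N);
         rN = (2 * M) mod 3;
         aN = (- M + 5 * rN) div 3;
         bN = (M - 8 * rN) div 3;
         js = filter (\<lambda>j. 3 dvd j) [3..<Suc m];
         j1 = hd js
     in mat_of_cols m
          ([16 \<cdot>\<^sub>v e 1 - 4 \<cdot>\<^sub>v e 2,
            aN \<cdot>\<^sub>v e 1 + bN \<cdot>\<^sub>v e 2 + rN \<cdot>\<^sub>v e 3] @
           map (\<lambda>j. (((int j)\<^sup>2 - 4) div 3) \<cdot>\<^sub>v e 1 - (((int j)\<^sup>2 - 1) div 3) \<cdot>\<^sub>v e 2 + e j)
             (filter (\<lambda>j. \<not> 3 dvd j) [3..<Suc m]) @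
           [((int j1)\<^sup>2 - 4) \<cdot>\<^sub>v e 1 - ((int j1)\<^sup>2 - 1) \<cdot>\<^sub>v e 2 + 3 \<cdot>\<^sub>v e j1] @
           map (\<lambda>j. (((int j)\<^sup>2 - (int j1)\<^sup>2) div 3) \<cdot>\<^sub>v (e 1 - e 2) - e j1 + e j) (tl js)))"

definition V_mat :: "nat \<Rightarrow> (nat \<Rightarrow> int \<times> int) \<Rightarrow> rat Matrix.mat" where
  "V_mat N cr = A_mat N cr * map_mat of_int (B_mat N)"

text \<open>
  \<open>P V Q = diag (d\<^sub>1, \<dots>, d\<^sub>m)\<close> is the Smith normal form of \<open>V\<close> over the integers; \<open>d\<^sub>r\<close> of the
  text is \<open>d (r - 1)\<close>.
\<close>

definition smith_normal_form ::
  "nat \<Rightarrow> int Matrix.mat \<Rightarrow> rat Matrix.mat \<Rightarrow> int Matrix.mat \<Rightarrow> (nat \<Rightarrow> int) \<Rightarrow> bool" where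
  "smith_normal_form m P V Q d \<longleftrightarrow>
     P \<in> carrier_mat m m \<and> invertible_mat P \<and>
     Q \<in> carrier_mat m m \<and> invertible_mat Q \<and>
     map_mat of_int P * V * map_mat of_int Q = mat_diag m (\<lambda>i. of_int (d i)) \<and>
     (\<forall>i < m. 0 \<le> d i) \<and>
     (\<forall>i. Suc i < m \<longrightarrow> d i dvd d (Suc i))"

definition a_vec :: "nat \<Rightarrow> nat \<Rightarrow> int Matrix.vec" where
  "a_vec N k = (if N = 5 then vec_of_list [-3 * int k, 2 * int k]
     else (-3 * int k) \<cdot>\<^sub>v e_vec N 1 + (3 * int k) \<cdot>\<^sub>v e_vec N 2 - int k \<cdot>\<^sub>v e_vec N 3)"

definition g_vec :: "nat \<Rightarrow> (nat \<Rightarrow> int \<times> int) \<Rightarrow> rat Matrix.vec" where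
  "g_vec N cr = Matrix.vec (N div 2) (\<lambda>r. of_int (cusp_g N (cr r)))"

definition w_vec :: "nat \<Rightarrow> nat \<Rightarrow> (nat \<Rightarrow> int \<times> int) \<Rightarrow> (nat \<Rightarrow> nat) \<Rightarrow> rat Matrix.vec" where
  "w_vec N k cr v =
     Matrix.vec (N div 2) (\<lambda>r. of_nat (v r)) - (of_nat k / 12) \<cdot>\<^sub>v g_vec N cr"

end

theory Submission
  imports Defs "Jordan_Normal_Form.Determinant"
begin

text \<open>
  The products are \<open>\<eta>(N\<tau>)\<^sup>2\<^sup>k\<close> times powers of the Siegel functions \<open>g(j/N, 0; N\<tau>)\<close>. All
  transformation formulas come from one fact: \<open>\<theta>\<^sub>1(z/\<tau>; -1/\<tau>)\<close> and \<open>exp(\<pi>iz\<^sup>2/\<tau>) \<theta>\<^sub>1(z; \<tau>)\<close>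
  have the same quasi-periods and zeros, so that by Liouville's theorem they agree up to a factor,
  which the half periods determine. Hence \<open>f\<close> is invariant under \<open>\<Gamma>\<^sub>1(N)\<close> iff
  \<open>\<Sum> a\<^sub>j \<equiv> -k (mod 12)\<close> and \<open>\<Sum> j\<^sup>2 a\<^sub>j \<equiv> 0 (mod N gcd(2,N))\<close>, which says that
  \<open>a - a\<^sup>(\<^sup>k\<^sup>)\<close> lies in the lattice spanned by the columns of \<open>B\<^sub>N\<close>, and \<open>f\<close> is holomorphic at
  the cusps iff its orders \<open>A\<^sub>N a + (k/12) g\<close> are nonnegative. The order at \<open>\<infinity>\<close> is found from
  the other ones, since the orders of each factor, weighted by the sizes of the Galois orbits, sum to \<open>0\<close>.
  That \<open>A\<^sub>N\<close> is invertible follows from the finite Fourier expansion of \<open>B\<^sub>2\<close>, whose first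
  coefficient dominates the others.
\<close>

section \<open>Infinite products\<close>

text \<open>The half periods fix the factor in the inversion formula only up to a cube root of
  unity, since their product yields its cube. The rest comes from letting \<tau> vary, where the
  factor is continuous with finitely many values and hence constant, and from inverting twice, which
  is z -> -z. Dividing theta by eta brings the weight to 0, so every matrix acts by a constant
  multiplier. Differentiating at z = 0 shows that the square of eta has the same multiplier, whose
  12th power is 1. Therefore k and the sum of the exponents enter through their sum modulo 12 only,
  and no Dedekind sums have to be computed. That the orders at the cusps are integers is a
  consequence of the two congruences and not a further condition; this is what allows them to be
  listed by natural numbers v. Cusps are counted through pairs of residues (c, a). Each cusp arises
  from exactly two pairs because N >= 5 separates the signs, and sums over orbits thereby become
  divisor sums. There the identity that the totients of the divisors of n sum to n evaluates the
  contribution of each factor of the product.\<close>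

lemma summable_qpoch:
  fixes x q :: complex
  assumes "norm q < 1"
  shows "summable (\<lambda>n. norm (x * q ^ n))"
  using assms by (auto simp: norm_mult norm_power intro!: summable_mult summable_geometric)

lemma convergent_prod_qpoch:
  fixes x q :: complex
  assumes "norm q < 1"
  shows "convergent_prod (\<lambda>n. 1 - x * q ^ n)"
  by (rule abs_convergent_prod_imp_convergent_prod, rule summable_imp_abs_convergent_prod)
     (use summable_qpoch[OF assms, of x] in simp)

lemma qpoch_LIMSEQ:
  assumes "norm q < 1"
  shows "(\<lambda>n. \<Prod>k<n. 1 - x * q ^ k) \<longlonglongrightarrow> qpoch x q"
  unfolding qpoch_def
  using convergent_prod_LIMSEQ[OF convergent_prod_qpoch[OF assms, of x]]
  by (subst LIMSEQ_lessThan_iff_atMost)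

lemma qpoch_rec:
  assumes "norm q < 1"
  shows "qpoch x q = (1 - x) * qpoch (q * x) q"
proof (rule LIMSEQ_unique)
  show "(\<lambda>n. \<Prod>k<Suc n. 1 - x * q ^ k) \<longlonglongrightarrow> qpoch x q"
    using qpoch_LIMSEQ[OF assms] by (rule LIMSEQ_Suc)
  have "(\<lambda>n. (1 - x) * (\<Prod>k<n. 1 - (q * x) * q ^ k)) \<longlonglongrightarrow> (1 - x) * qpoch (q * x) q"
    by (intro tendsto_intros qpoch_LIMSEQ assms)
  thus "(\<lambda>n. \<Prod>k<Suc n. 1 - x * q ^ k) \<longlonglongrightarrow> (1 - x) * qpoch (q * x) q"
    by (simp add: prod.lessThan_Suc_shift mult_ac del: prod.lessThan_Suc)
qed

lemma qpoch_eq_0_iff: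
  assumes "norm q < 1"
  shows "qpoch x q = 0 \<longleftrightarrow> (\<exists>n. x * q ^ n = 1)"
proof
  assume "\<exists>n. x * q ^ n = 1"
  then obtain n where n: "x * q ^ n = 1" ..
  have "eventually (\<lambda>m. (\<Prod>k<m. 1 - x * q ^ k) = 0) sequentially"
    using eventually_gt_at_top[of n] by eventually_elim (use n in auto)
  hence "(\<lambda>m. \<Prod>k<m. 1 - x * q ^ k) \<longlonglongrightarrow> 0" by (rule tendsto_eventually)
  thus "qpoch x q = 0" using qpoch_LIMSEQ[OF assms] LIMSEQ_unique by blast
next
  assume "qpoch x q = 0"
  thus "\<exists>n. x * q ^ n = 1"
    unfolding qpoch_def using prodinf_nonzero[OF convergent_prod_qpoch[OF assms, of x]] by force
qed

text \<open>A partial product of even length separates into the factors with even and with odd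
  powers of q; the limit is taken along the even lengths.\<close>

lemma qpoch_split:
  assumes "norm q < 1"
  shows "qpoch x q = qpoch x (q\<^sup>2) * qpoch (x * q) (q\<^sup>2)"
proof (rule LIMSEQ_unique)
  have q2: "norm (q\<^sup>2) < 1" using assms by (simp add: norm_power power_less_one_iff)
  have eq: "(\<Prod>k<2 * n. 1 - x * q ^ k) =
      (\<Prod>k<n. 1 - x * (q\<^sup>2) ^ k) * (\<Prod>k<n. 1 - (x * q) * (q\<^sup>2) ^ k)" for n
    by (induction n) (simp_all add: power_mult[symmetric] mult_ac)
  show "(\<lambda>n. \<Prod>k<2 * n. 1 - x * q ^ k) \<longlonglongrightarrow> qpoch x q"
    using LIMSEQ_subseq_LIMSEQ[OF qpoch_LIMSEQ[OF assms, of x], of "\<lambda>n. 2 * n"]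
    by (simp add: o_def strict_mono_def)
  show "(\<lambda>n. \<Prod>k<2 * n. 1 - x * q ^ k) \<longlonglongrightarrow> qpoch x (q\<^sup>2) * qpoch (x * q) (q\<^sup>2)"
    unfolding eq by (intro tendsto_intros qpoch_LIMSEQ q2)
qed

lemma qpoch_mult_minus:
  assumes "norm q < 1"
  shows "qpoch x q * qpoch (-x) q = qpoch (x\<^sup>2) (q\<^sup>2)"
proof (rule LIMSEQ_unique)
  have q2: "norm (q\<^sup>2) < 1" using assms by (simp add: norm_power power_less_one_iff)
  have eq: "(\<Prod>k<n. 1 - x * q ^ k) * (\<Prod>k<n. 1 - (-x) * q ^ k) =
     (\<Prod>k<n. 1 - x\<^sup>2 * (q\<^sup>2) ^ k)" for n
    by (simp add: prod.distrib[symmetric] power2_eq_square power_mult_distrib algebra_simps)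
  show "(\<lambda>n. (\<Prod>k<n. 1 - x * q ^ k) * (\<Prod>k<n. 1 - (-x) * q ^ k)) \<longlonglongrightarrow>
           qpoch x q * qpoch (-x) q"
    by (intro tendsto_intros qpoch_LIMSEQ assms)
  show "(\<lambda>n. (\<Prod>k<n. 1 - x * q ^ k) * (\<Prod>k<n. 1 - (-x) * q ^ k)) \<longlonglongrightarrow> qpoch (x\<^sup>2) (q\<^sup>2)"
    unfolding eq by (intro qpoch_LIMSEQ q2)
qed

text \<open>Euler's identity (-r; r)(r; r^2) = 1 for r = q^2, with (r; r^2) factored as (q; r)(-q;
  r). It makes the product of the theta values at the half periods elementary.\<close>

lemma euler_qpoch:
  assumes "norm q < 1"
  shows "qpoch (- (q\<^sup>2)) (q\<^sup>2) * qpoch q (q\<^sup>2) * qpoch (-q) (q\<^sup>2) = 1"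
proof -
  have q2: "norm (q\<^sup>2) < 1" using assms by (simp add: norm_power power_less_one_iff)
  define r where "r = q\<^sup>2"
  have r: "norm r < 1" "norm (r\<^sup>2) < 1"
    using q2 by (auto simp: r_def norm_power power_less_one_iff)
  have 1: "qpoch q r * qpoch (-q) r = qpoch r (r\<^sup>2)"
    using qpoch_mult_minus[OF r(1), of q] by (simp add: r_def)
  have 2: "qpoch r r * qpoch (-r) r = qpoch (r\<^sup>2) (r\<^sup>2)"
    using qpoch_mult_minus[OF r(1), of r] by simp
  have 3: "qpoch r r = qpoch r (r\<^sup>2) * qpoch (r\<^sup>2) (r\<^sup>2)"
    using qpoch_split[OF r(1), of r] by (simp add: power2_eq_square)
  have nz: "qpoch r r \<noteq> 0"
  proof
    assume "qpoch r r = 0"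
    then obtain n where "r ^ Suc n = 1" using qpoch_eq_0_iff[OF r(1)] by auto
    hence "norm r ^ Suc n = 1" by (metis norm_one norm_power)
    thus False using r(1) power_Suc_less_one[of "norm r" n] by (cases "r = 0") auto
  qed
  have "qpoch r r * (qpoch (-r) r * (qpoch q r * qpoch (-q) r)) = qpoch r r * 1"
    using 1 2 3 by (simp add: mult_ac)
  thus ?thesis using nz unfolding r_def[symmetric] by (simp add: mult_ac)
qed

text \<open>On a closed disc inside S the function \<open>\<phi>\<close> is bounded and the modulus
  of \<open>\<psi>\<close> attains a maximum below 1, so a geometric series dominates and the
  product converges uniformly. The base \<open>\<psi>\<close> may vary as well, since holomorphy is
  needed both in z and in \<tau>.\<close>

lemma holomorphic_on_qpoch:
  assumes S: "open S" and phi: "\<phi> holomorphic_on S" and psi: "\<psi> holomorphic_on S"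
    and lt: "\<And>t. t \<in> S \<Longrightarrow> norm (\<psi> t) < 1"
  shows "(\<lambda>t. qpoch (\<phi> t) (\<psi> t)) holomorphic_on S"
proof (rule holomorphic_uniform_sequence[OF S])
  show "(\<lambda>t. \<Prod>k<n. 1 - \<phi> t * \<psi> t ^ k) holomorphic_on S" for n
    by (intro holomorphic_intros phi psi)
next
  fix x assume x: "x \<in> S"
  then obtain d where d: "0 < d" "cball x d \<subseteq> S"
    using S open_contains_cball by blast
  have contphi: "continuous_on (cball x d) \<phi>" and contpsi: "continuous_on (cball x d) \<psi>"
    using phi psi d holomorphic_on_imp_continuous_on continuous_on_subset by blast+
  have "compact (\<phi> ` cball x d)" by (intro compact_continuous_image contphi) auto
  then obtain B where B: "\<And>t. t \<in> cball x d \<Longrightarrow> norm (\<phi> t) \<le> B"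
    using compact_imp_bounded bounded_iff by (metis (no_types, lifting) imageI)
  have "continuous_on (cball x d) (\<lambda>t. norm (\<psi> t))" by (intro continuous_intros contpsi)
  then obtain t0 where t0: "t0 \<in> cball x d" "\<And>t. t \<in> cball x d \<Longrightarrow> norm (\<psi> t) \<le> norm (\<psi> t0)"
    using continuous_attains_sup[of "cball x d" "\<lambda>t. norm (\<psi> t)"] d(1) by auto
  have r: "norm (\<psi> t0) < 1" using t0 d lt by auto
  have "uniformly_convergent_on (cball x d) (\<lambda>N t. \<Sum>n<N. norm ((1 - \<phi> t * \<psi> t ^ n) - 1))"
  proof (rule Weierstrass_m_test'_ev)
    show "\<forall>\<^sub>F n in sequentially. \<forall>t\<in>cball x d.
            norm (norm ((1 - \<phi> t * \<psi> t ^ n) - 1)) \<le> B * norm (\<psi> t0) ^ n"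
      using B t0 by (auto simp: norm_mult norm_power intro!: always_eventually mult_mono power_mono
          order_trans[OF norm_ge_zero B])
    show "summable (\<lambda>n. B * norm (\<psi> t0) ^ n)"
      using r by (intro summable_mult summable_geometric) auto
  qed
  hence "uniformly_convergent_on (cball x d) (\<lambda>N t. \<Prod>n<N. 1 - \<phi> t * \<psi> t ^ n)"
    by (intro uniformly_convergent_on_prod') (auto intro!: continuous_intros contphi contpsi)
  then obtain l where l: "uniform_limit (cball x d) (\<lambda>N t. \<Prod>n<N. 1 - \<phi> t * \<psi> t ^ n) l sequentially"
    by (auto simp: uniformly_convergent_on_def)
  have "l t = qpoch (\<phi> t) (\<psi> t)" if "t \<in> cball x d" for t
  proof -
    have "t \<in> S" using that d by blast
    thus ?thesis
      using tendsto_uniform_limitI[OF l that] qpoch_LIMSEQ[OF lt[of t], of "\<phi> t"] LIMSEQ_unique by blast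
  qed
  hence "uniform_limit (cball x d) (\<lambda>N t. \<Prod>n<N. 1 - \<phi> t * \<psi> t ^ n)
     (\<lambda>t. qpoch (\<phi> t) (\<psi> t)) sequentially"
    using l uniform_limit_cong'[of "cball x d"] by (metis (no_types, lifting))
  thus "\<exists>d>0. cball x d \<subseteq> S \<and> uniform_limit (cball x d) (\<lambda>N t. \<Prod>n<N. 1 - \<phi> t * \<psi> t ^ n)
     (\<lambda>t. qpoch (\<phi> t) (\<psi> t)) sequentially"
    using d by blast
qed

section \<open>The quotient of the Jacobi theta function by the eta function\<close>

abbreviation e2pi :: "complex \<Rightarrow> complex" where
  "e2pi z \<equiv> exp (2 * of_real pi * \<i> * z)"

text \<open>This is i times theta_1(z; \<tau>) / eta(\<tau>), with theta_1 normalised by theta_1'(0)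
  = 2 pi eta^3. The exponent \<open>\<tau> / 6\<close> is q^(1/12) = q^(1/8 - 1/24), the quotient of
  the leading powers of theta_1 and eta.\<close>

definition theta_quot :: "complex \<Rightarrow> complex \<Rightarrow> complex" where
  "theta_quot z \<tau> = - exp (of_real pi * \<i> * (\<tau> / 6 - z)) * qpoch (e2pi z) (e2pi \<tau>) * qpoch (e2pi (\<tau> - z)) (e2pi \<tau>)"

text \<open>Only even powers of eta occur in the products, so its square serves as the basic
  function; the multipliers are then 12th roots of unity.\<close>

definition eta_sq :: "complex \<Rightarrow> complex" where
  "eta_sq \<tau> = exp (of_real pi * \<i> * \<tau> / 6) * qpoch (e2pi \<tau>) (e2pi \<tau>) ^ 2"

lemma norm_e2pi_less_1: "Im \<tau> > 0 \<Longrightarrow> norm (e2pi \<tau>) < 1"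
  by simp

lemma e2pi_eq_1_iff: "e2pi z = 1 \<longleftrightarrow> z \<in> \<int>"
proof -
  have "e2pi z = 1 \<longleftrightarrow> (\<exists>n::int. z = of_int n)"
    unfolding exp_eq_1 by (auto simp: complex_eq_iff field_simps)
  thus ?thesis by (auto elim!: Ints_cases)
qed

lemma e2pi_of_int [simp]: "e2pi (of_int n) = 1"
  by (subst e2pi_eq_1_iff) auto

lemma e2pi_add: "e2pi (z + w) = e2pi z * e2pi w"
  by (simp add: distrib_left exp_add)

lemma e2pi_add_of_int [simp]: "e2pi (z + of_int n) = e2pi z"
  by (simp add: e2pi_add)

lemma e2pi_power: "e2pi z ^ n = e2pi (of_nat n * z)"
  by (simp add: exp_of_nat_mult[symmetric] mult_ac)

lemma exp_pi_i_of_int: "exp (of_real pi * \<i> * of_int n) = (if even n then 1 else -1)"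
proof -
  have "exp (of_real pi * \<i> * of_int n) = cis (pi * of_int n)"
    by (simp add: cis_conv_exp mult_ac)
  also have "\<dots> = (if even n then 1 else -1)"
    using cos_npi_int[of n] sin_npi_int[of n] by (auto simp: complex_eq_iff)
  finally show ?thesis .
qed

lemma theta_quot_add_1: "theta_quot (z + 1) \<tau> = - theta_quot z \<tau>"
proof -
  have 1: "e2pi (z + 1) = e2pi z" "e2pi (\<tau> - (z + 1)) = e2pi (\<tau> - z)"
    using e2pi_add_of_int[of z 1] e2pi_add_of_int[of "\<tau> - z" "-1"] by (simp_all add: algebra_simps)
  have "exp (of_real pi * \<i> * (\<tau> / 6 - (z + 1))) = 
     exp (of_real pi * \<i> * (\<tau> / 6 - z)) * exp (- (of_real pi * \<i>))"
    by (simp add: exp_add[symmetric] algebra_simps)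
  also have "exp (- (of_real pi * \<i>)) = -1" by (simp add: exp_minus)
  finally show ?thesis unfolding theta_quot_def 1 by simp
qed

text \<open>Peeling the factor of index 0 off one product on each side leaves the same two products,
  so that only elementary factors remain to be compared.\<close>

lemma theta_quot_minus:
  assumes "Im \<tau> > 0"
  shows "theta_quot (- z) \<tau> = - theta_quot z \<tau>"
proof -
  note q = norm_e2pi_less_1[OF assms]
  have a: "qpoch (e2pi (-z)) (e2pi \<tau>) = (1 - e2pi (-z)) * qpoch (e2pi (\<tau> - z)) (e2pi \<tau>)"
    by (subst qpoch_rec[OF q]) (simp add: exp_add[symmetric] algebra_simps)
  have b: "qpoch (e2pi z) (e2pi \<tau>) = (1 - e2pi z) * qpoch (e2pi (\<tau> + z)) (e2pi \<tau>)"
    by (subst qpoch_rec[OF q]) (simp add: e2pi_add[symmetric])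
  have c: "exp (of_real pi * \<i> * (\<tau> / 6 + z)) * (1 - e2pi (-z)) =
     - (exp (of_real pi * \<i> * (\<tau> / 6 - z)) * (1 - e2pi z))"
    by (simp add: ring_distribs exp_add[symmetric] exp_diff[symmetric])
       (simp add: algebra_simps)
  have "theta_quot (-z) \<tau> = - (exp (of_real pi * \<i> * (\<tau> / 6 + z)) * (1 - e2pi (-z))) * 
     qpoch (e2pi (\<tau> - z)) (e2pi \<tau>) * qpoch (e2pi (\<tau> + z)) (e2pi \<tau>)"
    unfolding theta_quot_def a by simp
  also have "\<dots> = - theta_quot z \<tau>" unfolding c theta_quot_def b by simp
  finally show ?thesis .
qed

lemma theta_quot_add_tau:
  assumes "Im \<tau> > 0"
  shows "theta_quot (z + \<tau>) \<tau> = - exp (- of_real pi * \<i> * (\<tau> + 2 * z)) * theta_quot z \<tau>"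
proof -
  have diff_add_cancel_right: "\<tau> - (z + \<tau>) = - z" by simp
  note q = norm_e2pi_less_1[OF assms]
  have a: "qpoch (e2pi (-z)) (e2pi \<tau>) = (1 - e2pi (-z)) * qpoch (e2pi (\<tau> - z)) (e2pi \<tau>)"
    by (subst qpoch_rec[OF q]) (simp add: exp_add[symmetric] algebra_simps)
  have b: "qpoch (e2pi z) (e2pi \<tau>) = (1 - e2pi z) * qpoch (e2pi (z + \<tau>)) (e2pi \<tau>)"
    by (subst qpoch_rec[OF q]) (simp add: e2pi_add[symmetric] add.commute)
  have c: "exp (of_real pi * \<i> * (\<tau> / 6 - (z + \<tau>))) * (1 - e2pi (-z)) =
     - (exp (- of_real pi * \<i> * (\<tau> + 2 * z)) * (exp (of_real pi * \<i> * (\<tau> / 6 - z)) * (1 - e2pi z)))"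
  proof -
    have "exp (of_real pi * \<i> * (\<tau> / 6 - (z + \<tau>))) =
        exp (- of_real pi * \<i> * (\<tau> + 2 * z)) * (exp (of_real pi * \<i> * (\<tau> / 6 - z)) * e2pi z)"
      unfolding exp_add[symmetric] by (rule arg_cong[of _ _ exp]) (simp add: field_simps)
    moreover have "exp (of_real pi * \<i> * (\<tau> / 6 - (z + \<tau>))) * e2pi (-z) =
        exp (- of_real pi * \<i> * (\<tau> + 2 * z)) * exp (of_real pi * \<i> * (\<tau> / 6 - z))"
      unfolding exp_add[symmetric] by (rule arg_cong[of _ _ exp]) (simp add: field_simps)
    ultimately show ?thesis by (simp only: right_diff_distrib mult_1_right) simp
  qed
  have "theta_quot (z + \<tau>) \<tau> = - (exp (of_real pi * \<i> * (\<tau> / 6 - (z + \<tau>))) * (1 - e2pi (-z))) * 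
     qpoch (e2pi (\<tau> - z)) (e2pi \<tau>) * qpoch (e2pi (z + \<tau>)) (e2pi \<tau>)"
    unfolding theta_quot_def diff_add_cancel_right a by simp
  also have "\<dots> = - exp (- of_real pi * \<i> * (\<tau> + 2 * z)) * theta_quot z \<tau>" unfolding c theta_quot_def b by simp
  finally show ?thesis .
qed

section \<open>Quasi-periodicity, zeros and the comparison by Liouville's theorem\<close>

text \<open>Stated for an arbitrary F because the comparison argument needs the same factor for
  \<open>theta_quot\<close> and for the function compared with it.\<close>

lemma quasi_periodic_lattice:
  fixes F :: "complex \<Rightarrow> complex" and r s :: int
  assumes F1: "\<And>z. F (z + 1) = - F z"
    and Ftau: "\<And>z. F (z + \<tau>) = - exp (- of_real pi * \<i> * (\<tau> + 2 * z)) * F z"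
  shows "F (z + of_int r + of_int s * \<tau>) =
     exp (of_real pi * \<i> * (of_int r + of_int s - of_int s ^ 2 * \<tau> - 2 * of_int s * z)) * F z"
proof -
  have r: "F (z + of_int r) = exp (of_real pi * \<i> * of_int r) * F z" for z
  proof (induction r rule: int_induct[where k = 0])
    case (step1 i)
    show ?case using F1[of "z + of_int i"] step1 
      by (simp add: add.assoc distrib_left exp_add)
  next
    case (step2 i)
    show ?case using F1[of "z + of_int (i - 1)"] step2
      by (simp add: add.assoc right_diff_distrib exp_diff)
  qed simp
  have s: "F (z + of_int s * \<tau>) =
     exp (of_real pi * \<i> * (of_int s - of_int s ^ 2 * \<tau> - 2 * of_int s * z)) * F z" for z
  proof (induction s rule: int_induct[where k = 0])
    case (step1 i)
    have "F (z + of_int (i + 1) * \<tau>) = - exp (- of_real pi * \<i> * (\<tau> + 2 * (z + of_int i * \<tau>))) *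
       (exp (of_real pi * \<i> * (of_int i - of_int i ^ 2 * \<tau> - 2 * of_int i * z)) * F z)"
      using Ftau[of "z + of_int i * \<tau>"] step1 by (simp add: algebra_simps)
    also have "\<dots> = exp (of_real pi * \<i>) * exp (- of_real pi * \<i> * (\<tau> + 2 * (z + of_int i * \<tau>))) *
       exp (of_real pi * \<i> * (of_int i - of_int i ^ 2 * \<tau> - 2 * of_int i * z)) * F z"
      by simp
    finally show ?case unfolding exp_add[symmetric]
      by (simp add: algebra_simps power2_eq_square)
  next
    case (step2 i)
    define E where "E = of_real pi * \<i> + - of_real pi * \<i> * (\<tau> + 2 * (z + of_int (i - 1) * \<tau>))"
    have "F (z + of_int i * \<tau>) = exp E * F (z + of_int (i - 1) * \<tau>)"
      using Ftau[of "z + of_int (i - 1) * \<tau>"] unfolding E_def exp_add by (simp add: algebra_simps)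
    hence "F (z + of_int (i - 1) * \<tau>) = exp (-E) * F (z + of_int i * \<tau>)"
      by (simp add: exp_minus)
    also have "exp (-E) * F (z + of_int i * \<tau>) = exp (-E + 
       of_real pi * \<i> * (of_int i - of_int i ^ 2 * \<tau> - 2 * of_int i * z)) * F z"
      unfolding step2(2) exp_add by simp
    also have "-E + of_real pi * \<i> * (of_int i - of_int i ^ 2 * \<tau> - 2 * of_int i * z) =
       of_real pi * \<i> * (of_int (i - 1) - of_int (i - 1) ^ 2 * \<tau> - 2 * of_int (i - 1) * z)"
      unfolding E_def by (simp add: algebra_simps power2_eq_square)
    finally show ?case .
  qed simp
  have "F (z + of_int r + of_int s * \<tau>) =
    exp (of_real pi * \<i> * (of_int s - of_int s ^ 2 * \<tau> - 2 * of_int s * (z + of_int r)) +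
     of_real pi * \<i> * of_int r) * F z"
    unfolding s r exp_add by simp
  \<comment> \<open>The cross term -2 r s is an even integer, so it contributes a full period of the
    exponential.\<close>
  also have "of_real pi * \<i> * (of_int s - of_int s ^ 2 * \<tau> - 2 * of_int s * (z + of_int r)) +
     of_real pi * \<i> * of_int r = 
     of_real pi * \<i> * (of_int r + of_int s - of_int s ^ 2 * \<tau> - 2 * of_int s * z) + 
     2 * of_real pi * \<i> * of_int (- (r * s))" by (simp add: algebra_simps)
  finally show ?thesis unfolding exp_add by (simp only: e2pi_of_int mult_1_right)
qed

lemmas theta_quot_add_lattice = quasi_periodic_lattice[of "\<lambda>z. theta_quot z \<tau>" \<tau> for \<tau>, OF theta_quot_add_1 theta_quot_add_tau]

lemma theta_quot_eq_0_iff: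
  assumes "Im \<tau> > 0"
  shows "theta_quot z \<tau> = 0 \<longleftrightarrow> (\<exists>r s :: int. z = of_int r + of_int s * \<tau>)"
proof
  note q = norm_e2pi_less_1[OF assms]
  assume "theta_quot z \<tau> = 0"
  hence "qpoch (e2pi z) (e2pi \<tau>) = 0 \<or> qpoch (e2pi (\<tau> - z)) (e2pi \<tau>) = 0" by (simp add: theta_quot_def)
  thus "\<exists>r s :: int. z = of_int r + of_int s * \<tau>"
  proof
    assume "qpoch (e2pi z) (e2pi \<tau>) = 0"
    then obtain n where "e2pi z * e2pi \<tau> ^ n = 1" by (auto simp: qpoch_eq_0_iff[OF q])
    hence "e2pi (z + of_nat n * \<tau>) = 1" by (simp only: e2pi_power e2pi_add)
    then obtain r :: int where "z + of_nat n * \<tau> = of_int r" by (auto simp: e2pi_eq_1_iff elim: Ints_cases)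
    hence "z = of_int r + of_int (- int n) * \<tau>" by (simp add: algebra_simps)
    thus ?thesis by blast
  next
    assume "qpoch (e2pi (\<tau> - z)) (e2pi \<tau>) = 0"
    then obtain n where "e2pi (\<tau> - z) * e2pi \<tau> ^ n = 1" by (auto simp: qpoch_eq_0_iff[OF q])
    hence "e2pi (\<tau> - z + of_nat n * \<tau>) = 1" by (simp only: e2pi_power e2pi_add)
    then obtain r :: int where "\<tau> - z + of_nat n * \<tau> = of_int r" by (auto simp: e2pi_eq_1_iff elim: Ints_cases)
    hence "z = of_int (-r) + of_int (1 + int n) * \<tau>" by (simp add: algebra_simps)
    thus ?thesis by blast
  qed
next
  note q = norm_e2pi_less_1[OF assms]
  assume "\<exists>r s :: int. z = of_int r + of_int s * \<tau>"
  then obtain r s :: int where z: "z = of_int r + of_int s * \<tau>" by blast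
  have "qpoch (e2pi 0) (e2pi \<tau>) = 0" unfolding qpoch_eq_0_iff[OF q] by (intro exI[of _ 0]) simp
  hence "theta_quot 0 \<tau> = 0" by (simp add: theta_quot_def)
  thus "theta_quot z \<tau> = 0" using theta_quot_add_lattice[OF assms, of 0 r s] z by simp
qed

lemma holomorphic_on_theta_quot:
  assumes "open S" "f holomorphic_on S" "g holomorphic_on S" "\<And>t. t \<in> S \<Longrightarrow> Im (g t) > 0"
  shows "(\<lambda>t. theta_quot (f t) (g t)) holomorphic_on S"
  unfolding theta_quot_def
  by (intro holomorphic_intros holomorphic_on_qpoch assms norm_e2pi_less_1) auto

lemma eta_sq_nonzero:
  assumes "Im \<tau> > 0"
  shows "eta_sq \<tau> \<noteq> 0"
proof
  note q = norm_e2pi_less_1[OF assms]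
  assume "eta_sq \<tau> = 0"
  hence "qpoch (e2pi \<tau>) (e2pi \<tau>) = 0" by (simp add: eta_sq_def)
  then obtain n where "e2pi \<tau> * e2pi \<tau> ^ n = 1" using qpoch_eq_0_iff[OF q] by blast
  hence "e2pi (\<tau> + of_nat n * \<tau>) = 1" by (simp only: e2pi_power e2pi_add)
  hence "norm (e2pi (\<tau> + of_nat n * \<tau>)) = 1" by (simp only: norm_one)
  moreover have "Im (\<tau> + of_nat n * \<tau>) > 0" using assms by (simp add: add_pos_nonneg)
  ultimately show False using norm_e2pi_less_1 by (metis less_irrefl)
qed

text \<open>Splitting off the factor 1 - e2pi z, which has a simple zero at 0, leaves a function H
  with H(0) = - \<open>eta_sq \<tau>\<close>.\<close>

lemma theta_quot_deriv_0:
  assumes "Im \<tau> > 0"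
  shows "((\<lambda>z. theta_quot z \<tau>) has_field_derivative (2 * of_real pi * \<i> * eta_sq \<tau>)) (at 0)"
proof -
  note q = norm_e2pi_less_1[OF assms]
  define H where "H = (\<lambda>z. - exp (of_real pi * \<i> * (\<tau> / 6 - z)) * qpoch (e2pi (\<tau> + z)) (e2pi \<tau>) * qpoch (e2pi (\<tau> - z)) (e2pi \<tau>))"
  have "H holomorphic_on UNIV" unfolding H_def
    by (intro holomorphic_intros holomorphic_on_qpoch) (use q in auto)
  then obtain D where D: "(H has_field_derivative D) (at 0)"
    by (auto simp: holomorphic_on_open field_differentiable_def)
  have eq: "theta_quot z \<tau> = (1 - e2pi z) * H z" for z
  proof -
    have "qpoch (e2pi z) (e2pi \<tau>) = (1 - e2pi z) * qpoch (e2pi (\<tau> + z)) (e2pi \<tau>)"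
      by (subst qpoch_rec[OF q]) (simp add: e2pi_add[symmetric])
    thus ?thesis by (simp add: theta_quot_def H_def)
  qed
  have "((\<lambda>z. (1 - e2pi z) * H z) has_field_derivative (2 * of_real pi * \<i> * eta_sq \<tau>)) (at 0)"
    by (rule derivative_eq_intros refl D | simp)+ (simp add: H_def eta_sq_def power2_eq_square)
  thus ?thesis unfolding eq .
qed

text \<open>The zeros of \<open>theta_quot\<close> are simple and F vanishes at all of them, so the
  quotient is entire. The quasi-periodicity factors cancel in it, which makes it doubly periodic,
  hence bounded, hence constant.\<close>

lemma quasi_periodic_eq_const_theta_quot:
  assumes tau: "Im \<tau> > 0" and F: "F holomorphic_on UNIV" and F0: "F 0 = 0"
    and F1: "\<And>z. F (z + 1) = - F z"
    and Ftau: "\<And>z. F (z + \<tau>) = - exp (- of_real pi * \<i> * (\<tau> + 2 * z)) * F z"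
  shows "\<exists>C. \<forall>z. F z = C * theta_quot z \<tau>"
proof -
  define G where "G = (\<lambda>z. theta_quot z \<tau>)"
  have G: "G holomorphic_on UNIV" unfolding G_def
    by (rule holomorphic_on_theta_quot) (use tau in \<open>auto intro!: holomorphic_intros\<close>)
  define E :: "int \<Rightarrow> int \<Rightarrow> complex \<Rightarrow> complex" where "E = (\<lambda>r s z.
     exp (of_real pi * \<i> * (of_int r + of_int s - of_int s ^ 2 * \<tau> - 2 * of_int s * z)))"
  have Fl: "F (z + of_int r + of_int s * \<tau>) = E r s z * F z" for z r s
    unfolding E_def by (rule quasi_periodic_lattice[OF F1 Ftau])
  have Gl: "G (z + of_int r + of_int s * \<tau>) = E r s z * G z" for z r s
    unfolding E_def G_def by (rule theta_quot_add_lattice[OF tau])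
  have zero: "F z = 0 \<and> deriv G z \<noteq> 0" if Gz: "G z = 0" for z
  proof -
    obtain r s :: int where z: "z = of_int r + of_int s * \<tau>"
      using iffD1[OF theta_quot_eq_0_iff[OF tau, of z]] Gz unfolding G_def by blast
    have "F z = 0" using Fl[of 0 r s] F0 z by simp
    \<comment> \<open>Near the lattice point z the function G is the translate of its germ at 0
      times a nonvanishing factor, so the zero at z is simple too.\<close>
    moreover have "((\<lambda>w. E r s (w - z) * G (w - z)) has_field_derivative 
        E r s 0 * (2 * of_real pi * \<i> * eta_sq \<tau>)) (at z)"
    proof -
      have "(G has_field_derivative (2 * of_real pi * \<i> * eta_sq \<tau>)) (at (z - z))"
        using theta_quot_deriv_0[OF tau] unfolding G_def by simp
      hence G': "((\<lambda>w. G (w - z)) has_field_derivative (2 * of_real pi * \<i> * eta_sq \<tau>) * 1) (at z)"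
        by (rule DERIV_chain2) (auto intro!: derivative_eq_intros)
      have "(\<lambda>w. E r s (w - z)) holomorphic_on UNIV" unfolding E_def by (intro holomorphic_intros)
      then obtain D where D: "((\<lambda>w. E r s (w - z)) has_field_derivative D) (at z)"
        by (auto simp: holomorphic_on_open)
      have "G 0 = 0" unfolding G_def using theta_quot_eq_0_iff[OF tau, of 0] by (auto intro!: exI[of _ 0])
      thus ?thesis by - (rule derivative_eq_intros D G' refl | simp)+
    qed
    moreover have "E r s (w - z) * G (w - z) = G w" for w
      using Gl[of "w - z" r s] by (simp add: z)
    ultimately have "(G has_field_derivative E r s 0 * (2 * of_real pi * \<i> * eta_sq \<tau>)) (at z)" by simp
    hence "deriv G z = E r s 0 * (2 * of_real pi * \<i> * eta_sq \<tau>)" by (rule DERIV_imp_deriv)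
    thus ?thesis using \<open>F z = 0\<close> eta_sq_nonzero[OF tau] by (simp add: E_def)
  qed
  \<comment> \<open>At a zero of G the value is the limit given by l'Hopital's rule, so R is
    continuous and its singularities are removable.\<close>
  define R where "R = (\<lambda>z. if G z = 0 then deriv F z / deriv G z else F z / G z)"
  have F': "(F has_field_derivative deriv F z) (at z)" for z
    by (rule holomorphic_derivI[OF F]) auto
  have G': "(G has_field_derivative deriv G z) (at z)" for z
    by (rule holomorphic_derivI[OF G]) auto
  have ev: "eventually (\<lambda>w. G w \<noteq> 0) (at z)" for z
  proof (cases "G z = 0")
    case True
    have "((\<lambda>w. (G w - G z) / (w - z)) \<longlongrightarrow> deriv G z) (at z)"
      using G'[of z] by (simp add: has_field_derivative_iff)
    hence "eventually (\<lambda>w. (G w - G z) / (w - z) \<noteq> 0) (at z)"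
      by (rule tendsto_imp_eventually_ne) (use zero[OF True] in auto)
    thus ?thesis by eventually_elim (use True in auto)
  next
    case False
    thus ?thesis using G'[of z] DERIV_isCont isContD tendsto_imp_eventually_ne by metis
  qed
  have lim: "(R \<longlongrightarrow> R z) (at z)" for z
  proof -
    have "((\<lambda>w. F w / G w) \<longlongrightarrow> R z) (at z)"
    proof (cases "G z = 0")
      case True
      thus ?thesis using zero[OF True] lhopital_complex_simple[OF F' G', of z] by (simp add: R_def)
    next
      case False
      hence "isCont (\<lambda>w. F w / G w) z"
        using F'[of z] G'[of z] DERIV_isCont by (intro continuous_intros) auto
      thus ?thesis using False by (simp add: isCont_def R_def)
    qed
    moreover have "eventually (\<lambda>w. F w / G w = R w) (at z)"
      using ev[of z] by eventually_elim (simp add: R_def)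
    ultimately show ?thesis by (rule Lim_transform_eventually)
  qed
  have Rdiff: "\<exists>e>0. R holomorphic_on ball z e" for z
  proof -
    obtain e where e: "e > 0" "\<And>w. w \<in> ball z e - {z} \<Longrightarrow> G w \<noteq> 0"
      using ev[of z] unfolding eventually_at by (auto simp: dist_commute)
    have "(\<lambda>w. F w / G w) holomorphic_on (ball z e - {z})"
      by (intro holomorphic_intros holomorphic_on_subset[OF F] holomorphic_on_subset[OF G] e(2)) auto
    hence "R holomorphic_on (ball z e - {z})"
      by (rule holomorphic_transform) (use e(2) in \<open>auto simp: R_def\<close>)
    hence "R holomorphic_on ball z e"
      by (rule no_isolated_singularity'[rotated]) 
         (use lim tendsto_within_subset in \<open>auto intro: tendsto_within_subset[OF lim]\<close>)
    thus ?thesis using e(1) by blast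
  qed
  have R: "R holomorphic_on UNIV"
  proof -
    have "R field_differentiable at z" for z
    proof -
      obtain e where "e > 0" "R holomorphic_on ball z e" using Rdiff by blast
      thus ?thesis using holomorphic_on_imp_differentiable_at[of R "ball z e" z] by auto
    qed
    thus ?thesis by (auto simp: holomorphic_on_def field_differentiable_at_within)
  qed
  \<comment> \<open>The closed fundamental parallelogram; real coordinates with respect to 1 and
    \<tau> reduce every point to it.\<close>
  define K where "K = (\<lambda>(x, y). complex_of_real x + of_real y * \<tau>) ` ({0..1} \<times> {0..1})"
  have "compact K" unfolding K_def case_prod_beta
    by (intro compact_continuous_image continuous_intros compact_Times) auto
  moreover have "continuous_on K R"
    using R holomorphic_on_imp_continuous_on continuous_on_subset by blast
  ultimately have "bounded (R ` K)" by (intro compact_imp_bounded compact_continuous_image)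
  then obtain B where B: "\<And>z. z \<in> K \<Longrightarrow> norm (R z) \<le> B" by (auto simp: bounded_iff)
  have B': "norm (R z) \<le> B" if "G z \<noteq> 0" for z
  proof -
    define y where "y = Im z / Im \<tau>"
    define x where "x = Re z - y * Re \<tau>"
    define z0 where "z0 = complex_of_real (frac x) + of_real (frac y) * \<tau>"
    have "z = of_real x + of_real y * \<tau>"
      using tau by (simp add: complex_eq_iff x_def y_def)
    hence z: "z = z0 + of_int \<lfloor>x\<rfloor> + of_int \<lfloor>y\<rfloor> * \<tau>"
      by (simp add: z0_def frac_def algebra_simps complex_eq_iff)
    have "G z0 \<noteq> 0" using that Gl[of z0] by (auto simp: z)
    hence "R z = R z0" using that Gl[of z0 "\<lfloor>x\<rfloor>" "\<lfloor>y\<rfloor>"] Fl[of z0 "\<lfloor>x\<rfloor>" "\<lfloor>y\<rfloor>"]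
      unfolding z[symmetric] by (simp add: R_def)
    moreover have "z0 \<in> K" unfolding K_def z0_def
      by (rule image_eqI[of _ _ "(frac x, frac y)"]) (auto simp: frac_lt_1 less_imp_le)
    ultimately show ?thesis using B by simp
  qed
  \<comment> \<open>The zeros of G are isolated, so the bound extends to them by continuity of
    R.\<close>
  have "norm (R z) \<le> B" for z
  proof (rule tendsto_upperbound)
    show "((\<lambda>w. norm (R w)) \<longlongrightarrow> norm (R z)) (at z)" by (intro tendsto_intros lim)
    show "eventually (\<lambda>w. norm (R w) \<le> B) (at z)"
      using ev[of z] by eventually_elim (rule B')
  qed auto
  hence "bounded (range R)" by (auto simp: bounded_iff)
  from Liouville_theorem[OF R this] obtain C where C: "\<And>z. R z = C" by (auto simp: constant_on_def)
  have "F z = C * theta_quot z \<tau>" for z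
  proof (cases "G z = 0")
    case True
    thus ?thesis using zero[OF True] by (simp add: G_def)
  next
    case False
    thus ?thesis using C[of z] by (auto simp: R_def G_def)
  qed
  thus ?thesis by blast
qed

section \<open>The inversion \<tau> -> -1/\<tau>\<close>

text \<open>The analogue of theta_2 theta_3 theta_4 = 2 eta^3. With q1 = q^(1/2) the three values
  involve the squares of (-q; q), (q1; q) and (-q1; q), whose product is 1 by
  \<open>euler_qpoch\<close>.\<close>

lemma theta_quot_half_periods:
  assumes tau: "Im \<tau> > 0"
  shows "theta_quot (1/2) \<tau> * theta_quot (\<tau>/2) \<tau> * theta_quot ((1+\<tau>)/2) \<tau> = 2 * exp (- of_real pi * \<i> * \<tau> / 2)"
proof -
  define q1 where "q1 = e2pi (\<tau> / 2)"
  have q: "e2pi \<tau> = q1\<^sup>2" unfolding q1_def e2pi_power by simp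
  have nq1: "norm q1 < 1" unfolding q1_def using tau by (intro norm_e2pi_less_1) simp
  have nq: "norm (q1\<^sup>2) < 1" using norm_e2pi_less_1[OF tau] unfolding q .
  have eh: "e2pi (1/2) = -1" by simp
  have ehm: "exp (of_real pi * \<i> * (z - 1/2)) = -\<i> * exp (of_real pi * \<i> * z)" for z
  proof -
    have "exp (of_real pi * \<i> * (z - 1/2)) = exp (of_real pi * \<i> * z) * exp (- (of_real pi * \<i> / 2))"
      by (simp add: exp_add[symmetric] field_simps)
    also have "exp (- (of_real pi * \<i> / 2)) = -\<i>"
      using cis_pi_half by (simp add: cis_conv_exp exp_minus mult_ac)
    finally show ?thesis by simp
  qed
  have half: "e2pi (z + 1/2) = - e2pi z" "e2pi (z - 1/2) = - e2pi z" for z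
    by (simp_all add: distrib_left right_diff_distrib exp_add exp_diff)
  have e1: "e2pi (\<tau> - 1/2) = - q1\<^sup>2" unfolding half q ..
  have e2pi: "e2pi ((1+\<tau>)/2) = - q1" using half(1)[of "\<tau>/2"] by (simp add: q1_def add_divide_distrib add.commute)
  have e3: "e2pi (\<tau> - (1+\<tau>)/2) = - q1" using half(2)[of "\<tau>/2"] 
    by (simp add: q1_def field_simps)
  have e4: "e2pi (\<tau> - \<tau>/2) = q1" by (simp add: q1_def field_simps)
  have r: "qpoch (-1) (q1\<^sup>2) = 2 * qpoch (- (q1\<^sup>2)) (q1\<^sup>2)"
    by (subst qpoch_rec[OF nq]) simp
  have a: "theta_quot (1/2) \<tau> = 2 * \<i> * exp (of_real pi * \<i> * (\<tau> / 6)) * qpoch (- (q1\<^sup>2)) (q1\<^sup>2) ^ 2"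
    unfolding theta_quot_def eh e1 q r ehm by (simp add: power2_eq_square)
  have "\<tau> / 6 - \<tau> / 2 = - \<tau> / 3" by simp
  hence b: "theta_quot (\<tau>/2) \<tau> = - exp (of_real pi * \<i> * (- \<tau> / 3)) * qpoch q1 (q1\<^sup>2) ^ 2"
    unfolding theta_quot_def e4 q q1_def[symmetric] by (simp add: power2_eq_square)
  have "\<tau> / 6 - (1 + \<tau>) / 2 = - \<tau> / 3 - 1 / 2" by (simp add: field_simps)
  hence c: "theta_quot ((1+\<tau>)/2) \<tau> = \<i> * exp (of_real pi * \<i> * (- \<tau> / 3)) * qpoch (-q1) (q1\<^sup>2) ^ 2"
    unfolding theta_quot_def e2pi e3 q using ehm by (simp add: power2_eq_square)
  have alg: "(2 * \<i> * x * A\<^sup>2) * (- y * B\<^sup>2) * (\<i> * y * C\<^sup>2) = 2 * (x * y * y) * (A * B * C)\<^sup>2" for x y A B C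
    by (simp add: power2_eq_square mult_ac)
  have "theta_quot (1/2) \<tau> * theta_quot (\<tau>/2) \<tau> * theta_quot ((1+\<tau>)/2) \<tau> =
    2 * (exp (of_real pi * \<i> * (\<tau> / 6)) * exp (of_real pi * \<i> * (- \<tau> / 3)) * exp (of_real pi * \<i> * (- \<tau> / 3))) *
    (qpoch (- (q1\<^sup>2)) (q1\<^sup>2) * qpoch q1 (q1\<^sup>2) * qpoch (-q1) (q1\<^sup>2))\<^sup>2"
    unfolding a b c by (rule alg)
  also have "\<dots> = 2 * exp (- of_real pi * \<i> * \<tau> / 2)"
    unfolding euler_qpoch[OF nq1] exp_add[symmetric] by (simp add: field_simps)
  finally show ?thesis .
qed


lemma Im_minus_inverse: "Im \<tau> > 0 \<Longrightarrow> Im (- 1 / \<tau>) > 0"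
  by (auto simp: Im_divide intro!: divide_pos_pos add_nonneg_pos)

text \<open>The Gaussian factor restores the quasi-periods: adding 1 to z shifts z / \<tau> by
  -\<tau>', where \<tau>' = -1/\<tau>, and adding \<tau> shifts it by 1. Multiplying the resulting
  identity over the three half periods determines C^3.\<close>

lemma theta_quot_S_aux:
  assumes tau: "Im \<tau> > 0"
  shows "\<exists>C. C ^ 3 = \<i> \<and> (\<forall>z. theta_quot (z / \<tau>) (- 1 / \<tau>) = C * exp (of_real pi * \<i> * z\<^sup>2 / \<tau>) * theta_quot z \<tau>)"
proof -
  define \<tau>' where "\<tau>' = - 1 / \<tau>"
  have tau': "Im \<tau>' > 0" using Im_minus_inverse[OF tau] by (simp add: \<tau>'_def)
  have [simp]: "\<tau> \<noteq> 0" using tau by auto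
  define F where "F = (\<lambda>z. exp (- of_real pi * \<i> * z\<^sup>2 / \<tau>) * theta_quot (z / \<tau>) \<tau>')"
  have "\<exists>C. \<forall>z. F z = C * theta_quot z \<tau>"
  proof (rule quasi_periodic_eq_const_theta_quot[OF tau])
    show "F holomorphic_on UNIV" unfolding F_def
      by (intro holomorphic_intros holomorphic_on_theta_quot) (use tau' in auto)
    show "F 0 = 0" using theta_quot_eq_0_iff[OF tau', of 0] by (auto simp: F_def intro!: exI[of _ 0])
  next
    fix z
    have "theta_quot ((z + 1) / \<tau>) \<tau>' = theta_quot (z / \<tau> + of_int 0 + of_int (-1) * \<tau>') \<tau>'"
      by (simp add: \<tau>'_def add_divide_distrib)
    also have "\<dots> = exp (of_real pi * \<i> * (-1 - \<tau>' + 2 * (z / \<tau>))) * theta_quot (z / \<tau>) \<tau>'"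
      unfolding theta_quot_add_lattice[OF tau'] by simp
    finally have "F (z + 1) = exp (- of_real pi * \<i> * (z + 1)\<^sup>2 / \<tau> + of_real pi * \<i> * (-1 - \<tau>' + 2 * (z / \<tau>))) * theta_quot (z / \<tau>) \<tau>'"
      unfolding F_def exp_add by simp
    also have "- of_real pi * \<i> * (z + 1)\<^sup>2 / \<tau> + of_real pi * \<i> * (-1 - \<tau>' + 2 * (z / \<tau>)) =
      - of_real pi * \<i> * z\<^sup>2 / \<tau> - of_real pi * \<i>" by (simp add: field_simps power2_eq_square \<tau>'_def)
    finally show "F (z + 1) = - F z" unfolding F_def exp_diff by simp
  next
    fix z
    have "theta_quot ((z + \<tau>) / \<tau>) \<tau>' = - theta_quot (z / \<tau>) \<tau>'"
      unfolding theta_quot_add_1[symmetric] by (simp add: add_divide_distrib)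
    hence "F (z + \<tau>) = - exp (- of_real pi * \<i> * (z + \<tau>)\<^sup>2 / \<tau>) * theta_quot (z / \<tau>) \<tau>'"
      unfolding F_def by simp
    also have "- of_real pi * \<i> * (z + \<tau>)\<^sup>2 / \<tau> = - of_real pi * \<i> * (\<tau> + 2 * z) + - of_real pi * \<i> * z\<^sup>2 / \<tau>"
      by (simp add: field_simps power2_eq_square)
    finally show "F (z + \<tau>) = - exp (- of_real pi * \<i> * (\<tau> + 2 * z)) * F z"
      unfolding F_def exp_add by simp
  qed
  then obtain C where C: "\<And>z. F z = C * theta_quot z \<tau>" by blast
  have theta_quot: "theta_quot (z / \<tau>) \<tau>' = C * exp (of_real pi * \<i> * z\<^sup>2 / \<tau>) * theta_quot z \<tau>" for z
  proof -
    have "theta_quot (z / \<tau>) \<tau>' = exp (of_real pi * \<i> * z\<^sup>2 / \<tau>) * F z" by (simp add: F_def exp_minus)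
    thus ?thesis unfolding C by simp
  qed
  \<comment> \<open>Division by \<tau> permutes the three half periods up to sign and lattice
    translation, so both sides end in the same product.\<close>
  have h1: "- theta_quot (\<tau>' / 2) \<tau>' = C * exp (of_real pi * \<i> * (1/2)\<^sup>2 / \<tau>) * theta_quot (1/2) \<tau>"
    using theta_quot_minus[OF tau', of "\<tau>' / 2"] unfolding theta_quot[symmetric] by (simp add: \<tau>'_def field_simps)
  have h2: "theta_quot (1 / 2) \<tau>' = C * exp (of_real pi * \<i> * (\<tau>/2)\<^sup>2 / \<tau>) * theta_quot (\<tau>/2) \<tau>"
    unfolding theta_quot[symmetric] by (simp add: field_simps)
  have h3: "theta_quot ((1 + \<tau>') / 2) \<tau>' = C * exp (of_real pi * \<i> * ((1+\<tau>)/2)\<^sup>2 / \<tau>) * theta_quot ((1+\<tau>)/2) \<tau>"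
  proof -
    have "theta_quot ((1 + \<tau>') / 2) \<tau>' = theta_quot (- ((1 + \<tau>') / 2) + 1) \<tau>'"
      unfolding theta_quot_add_1 theta_quot_minus[OF tau'] by simp
    also have "- ((1 + \<tau>') / 2) + 1 = ((1+\<tau>)/2) / \<tau>" by (simp add: \<tau>'_def field_simps)
    finally show ?thesis unfolding theta_quot .
  qed
  define X where "X = exp (of_real pi * \<i> / (2 * \<tau>))"
  have alg: "(c * x * a) * (c * y * b) * (c * z * d) = c ^ 3 * (x * y * z) * (a * b * d)" for a b c d x y z :: complex
    by (simp add: power3_eq_cube)
  have "- (theta_quot (1/2) \<tau>' * theta_quot (\<tau>'/2) \<tau>' * theta_quot ((1+\<tau>')/2) \<tau>') = (- theta_quot (\<tau>' / 2) \<tau>') * theta_quot (1 / 2) \<tau>' * theta_quot ((1 + \<tau>') / 2) \<tau>'"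
    by simp
  also have "\<dots> = C ^ 3 * (exp (of_real pi * \<i> * (1/2)\<^sup>2 / \<tau>) * exp (of_real pi * \<i> * (\<tau>/2)\<^sup>2 / \<tau>) *
      exp (of_real pi * \<i> * ((1+\<tau>)/2)\<^sup>2 / \<tau>)) * (2 * exp (- of_real pi * \<i> * \<tau> / 2))"
    unfolding h1 h2 h3 alg theta_quot_half_periods[OF tau] ..
  also have "\<dots> = 2 * C ^ 3 * exp (of_real pi * \<i> * (1/2)\<^sup>2 / \<tau> + of_real pi * \<i> * (\<tau>/2)\<^sup>2 / \<tau> +
       of_real pi * \<i> * ((1+\<tau>)/2)\<^sup>2 / \<tau> + - of_real pi * \<i> * \<tau> / 2)"
    unfolding exp_add by simp
  also have "of_real pi * \<i> * (1/2)\<^sup>2 / \<tau> + of_real pi * \<i> * (\<tau>/2)\<^sup>2 / \<tau> +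
       of_real pi * \<i> * ((1+\<tau>)/2)\<^sup>2 / \<tau> + - of_real pi * \<i> * \<tau> / 2 = 
     of_real pi * \<i> / (2 * \<tau>) + of_real pi * \<i> / 2" by (simp add: field_simps power2_eq_square)
  also have "exp \<dots> = X * \<i>"
  proof -
    have "exp (of_real pi * \<i> / 2) = \<i>" using cis_pi_half by (simp add: cis_conv_exp mult.commute)
    thus ?thesis unfolding exp_add X_def by simp
  qed
  also have "theta_quot (1/2) \<tau>' * theta_quot (\<tau>'/2) \<tau>' * theta_quot ((1+\<tau>')/2) \<tau>' = 2 * X"
  proof -
    have "- of_real pi * \<i> * \<tau>' / 2 = of_real pi * \<i> / (2 * \<tau>)" by (simp add: \<tau>'_def)
    thus ?thesis unfolding theta_quot_half_periods[OF tau'] X_def by simp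
  qed
  finally have "- (2 * X) = 2 * C ^ 3 * (X * \<i>)" .
  moreover have "2 * (X * (C ^ 3 * \<i> + 1)) = 2 * C ^ 3 * (X * \<i>) - (- (2 * X))"
    by (simp add: algebra_simps)
  ultimately have "2 * (X * (C ^ 3 * \<i> + 1)) = 0" by (simp only: diff_self)
  moreover have "X \<noteq> 0" by (simp add: X_def)
  ultimately have "C ^ 3 * \<i> + 1 = 0" by simp
  moreover have "C ^ 3 = (C ^ 3 * \<i> + 1) * (- \<i>) + \<i>" by (simp add: algebra_simps)
  ultimately have "C ^ 3 = \<i>" by simp
  thus ?thesis using theta_quot unfolding \<tau>'_def by blast
qed

text \<open>A continuous function on a connected set with values among the cube roots of
  \<open>\<i>\<close> is constant. Together with c^3 = \<open>\<i>\<close>, the equation c^2 = -1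
  leaves only c = -\<open>\<i>\<close>.\<close>

lemma theta_quot_S:
  assumes tau: "Im \<tau> > 0"
  shows "theta_quot (z / \<tau>) (- 1 / \<tau>) = - \<i> * exp (of_real pi * \<i> * z\<^sup>2 / \<tau>) * theta_quot z \<tau>"
proof -
  define H where "H = {\<tau>. Im \<tau> > 0}"
  \<comment> \<open>Reading the factor off at z = 1/2, which is never a lattice point, exhibits it
    as a holomorphic function of \<tau>.\<close>
  define C where "C = (\<lambda>\<tau>. theta_quot (1 / 2 / \<tau>) (- 1 / \<tau>) / (exp (of_real pi * \<i> * (1/2)\<^sup>2 / \<tau>) * theta_quot (1/2) \<tau>))"
  have nz: "theta_quot (1/2) \<tau> \<noteq> 0" if Im: "Im \<tau> > 0" for \<tau>
  proof
    assume "theta_quot (1/2) \<tau> = 0"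
    then obtain r s :: int where rs: "1 / 2 = of_int r + of_int s * \<tau>" using iffD1[OF theta_quot_eq_0_iff[OF Im, of "1/2"]] by blast
    have "Im (1 / 2) = Im (of_int r + of_int s * \<tau>)" using rs by (rule arg_cong)
    hence "s = 0" using Im by simp
    hence "complex_of_int (2 * r) = of_int 1" using rs by (simp add: field_simps)
    thus False by (subst (asm) of_int_eq_iff) presburger
  qed
  have C: "C \<tau> ^ 3 = \<i>" "theta_quot (z / \<tau>) (- 1 / \<tau>) = C \<tau> * exp (of_real pi * \<i> * z\<^sup>2 / \<tau>) * theta_quot z \<tau>" if "Im \<tau> > 0" for \<tau> z
  proof -
    from theta_quot_S_aux[OF that] obtain c where c: "c ^ 3 = \<i>" 
        "\<And>z. theta_quot (z / \<tau>) (- 1 / \<tau>) = c * exp (of_real pi * \<i> * z\<^sup>2 / \<tau>) * theta_quot z \<tau>" by blast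
    have "c = C \<tau>" unfolding C_def c(2) using nz[OF that] by simp
    thus "C \<tau> ^ 3 = \<i>" "theta_quot (z / \<tau>) (- 1 / \<tau>) = C \<tau> * exp (of_real pi * \<i> * z\<^sup>2 / \<tau>) * theta_quot z \<tau>" using c by auto
  qed
  have openH: "open H" "convex H" unfolding H_def by (simp_all add: open_halfspace_Im_gt convex_halfspace_Im_gt)
  have "C holomorphic_on H" unfolding C_def
    by (intro holomorphic_intros holomorphic_on_theta_quot openH) (use nz Im_minus_inverse in \<open>auto simp: H_def\<close>)
  hence "continuous_on H C" by (rule holomorphic_on_imp_continuous_on)
  moreover have "finite (C ` H)"
  proof (rule finite_subset)
    show "C ` H \<subseteq> {c. c ^ 3 = \<i>}" using C by (auto simp: H_def)
    show "finite {c::complex. c ^ 3 = \<i>}" by (rule finite_nth_roots) simp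
  qed
  ultimately have "C constant_on H"
    by (intro continuous_finite_range_constant convex_connected openH)
  then obtain c where c: "\<And>\<tau>. Im \<tau> > 0 \<Longrightarrow> C \<tau> = c" by (auto simp: constant_on_def H_def)
  have "c ^ 3 = \<i>" using C(1)[OF tau] c[OF tau] by simp
  \<comment> \<open>Two inversions return \<tau> and send z to -z, so oddness of
    \<open>theta_quot\<close> gives the value.\<close>
  moreover have "c * c = - 1"
  proof -
    have t0: "\<tau> \<noteq> 0" using tau by auto
    define t' where "t' = -1 / \<tau>"
    have t': "Im t' > 0" using Im_minus_inverse[OF tau] by (simp add: t'_def)
    have "theta_quot ((1/2 / \<tau>) / t') (- 1 / t') = c * exp (of_real pi * \<i> * (1/2 / \<tau>)\<^sup>2 / t') * theta_quot (1/2/\<tau>) t'"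
      using C(2)[OF t', of "1/2 / \<tau>"] c[OF t'] by simp
    also have "theta_quot (1/2/\<tau>) t' = c * exp (of_real pi * \<i> * (1/2)\<^sup>2 / \<tau>) * theta_quot (1/2) \<tau>"
      using C(2)[OF tau, of "1/2"] c[OF tau] unfolding t'_def by simp
    also have "(1/2 / \<tau>) / t' = - (1/2)" using t0 by (simp add: t'_def)
    also have "- 1 / t' = \<tau>" using t0 by (simp add: t'_def)
    also have "of_real pi * \<i> * (1/2 / \<tau>)\<^sup>2 / t' = - (of_real pi * \<i> * (1/2)\<^sup>2 / \<tau>)" 
      using t0 by (simp add: t'_def power2_eq_square)
    finally have "- theta_quot (1/2) \<tau> = c * c * theta_quot (1/2) \<tau>"
      unfolding theta_quot_minus[OF tau] by (simp add: exp_minus)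
    moreover have "(c * c + 1) * theta_quot (1/2) \<tau> = c * c * theta_quot (1/2) \<tau> - (- theta_quot (1/2) \<tau>)"
      by (simp add: algebra_simps)
    ultimately have "(c * c + 1) * theta_quot (1/2) \<tau> = 0" by simp
    thus ?thesis using nz[OF tau] by (simp add: add_eq_0_iff2)
  qed
  ultimately have "c * - 1 = \<i>" by (metis power3_eq_cube mult.assoc)
  hence "c = - \<i>" by (simp add: minus_equation_iff[of c])
  thus ?thesis using C(2)[OF tau] c[OF tau] by simp
qed

section \<open>Modular transformations\<close>

text \<open>The transformation law of a Jacobi form of weight 0 and index 1/2 with multiplier
  \<open>\<epsilon>\<close>. It is a relation and not a formula for \<open>\<epsilon>\<close>: later
  only \<open>\<epsilon> ^ 12 = 1\<close> and the values at the matrices (1, b; 0, 1) and (1, 0; 1,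
  1) matter.\<close>

definition theta_mult :: "int \<times> int \<times> int \<times> int \<Rightarrow> complex \<Rightarrow> bool" where
  "theta_mult = (\<lambda>(a, b, c, d) \<epsilon>. \<forall>\<tau> z. Im \<tau> > 0 \<longrightarrow>
     theta_quot (z / (of_int c * \<tau> + of_int d)) ((of_int a * \<tau> + of_int b) / (of_int c * \<tau> + of_int d)) =
       \<epsilon> * exp (of_real pi * \<i> * of_int c * z\<^sup>2 / (of_int c * \<tau> + of_int d)) * theta_quot z \<tau>)"

lemma theta_multD:
  assumes "theta_mult (a, b, c, d) \<epsilon>" "Im \<tau> > 0"
  shows "theta_quot (z / (of_int c * \<tau> + of_int d)) ((of_int a * \<tau> + of_int b) / (of_int c * \<tau> + of_int d)) =
       \<epsilon> * exp (of_real pi * \<i> * of_int c * z\<^sup>2 / (of_int c * \<tau> + of_int d)) * theta_quot z \<tau>"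
  using assms by (simp add: theta_mult_def)

lemma moebius_denom_nonzero:
  fixes a b c d :: int
  assumes "a * d - b * c = 1" "Im \<tau> > 0"
  shows "of_int c * \<tau> + of_int d \<noteq> 0"
proof
  assume 0: "of_int c * \<tau> + of_int d = 0"
  have "Im (of_int c * \<tau> + of_int d) = 0" unfolding 0 by simp
  hence "c = 0" using assms(2) by simp
  thus False using 0 assms(1) by simp
qed

lemma Im_moebius:
  fixes a b c d :: int
  assumes "a * d - b * c = 1" "Im \<tau> > 0"
  shows "Im ((of_int a * \<tau> + of_int b) / (of_int c * \<tau> + of_int d)) > 0"
proof -
  let ?w = "of_int c * \<tau> + of_int d"
  have "?w \<noteq> 0" by (rule moebius_denom_nonzero[OF assms])
  hence "(Re ?w)\<^sup>2 + (Im ?w)\<^sup>2 > 0" by (metis complex_eq_0 sum_power2_gt_zero_iff complex_neq_0)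
  moreover have "real_of_int a * real_of_int d - real_of_int b * real_of_int c = 1"
    using assms(1) by (metis of_int_1 of_int_diff of_int_mult)
  hence "Im (of_int a * \<tau> + of_int b) * Re ?w - Re (of_int a * \<tau> + of_int b) * Im ?w = Im \<tau>"
  proof -
    have "Im (of_int a * \<tau> + of_int b) * Re ?w - Re (of_int a * \<tau> + of_int b) * Im ?w =
       (real_of_int a * real_of_int d - real_of_int b * real_of_int c) * Im \<tau>"
      by (simp add: algebra_simps)
    thus ?thesis using \<open>real_of_int a * _ - _ = 1\<close> by simp
  qed
  ultimately show ?thesis using assms(2) unfolding Im_divide by simp
qed

text \<open>The denominators multiply by the chain rule and the Gaussian exponents add up to that of
  the product matrix; the latter uses that the second determinant is 1.\<close>

lemma theta_mult_mult:
  fixes a b c d a' b' c' d' :: int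
  assumes theta_mult: "theta_mult (a, b, c, d) \<epsilon>" "theta_mult (a', b', c', d') \<epsilon>'"
    and det: "a * d - b * c = 1" "a' * d' - b' * c' = 1"
  shows "theta_mult (a * a' + b * c', a * b' + b * d', c * a' + d * c', c * b' + d * d') (\<epsilon> * \<epsilon>')"
  unfolding theta_mult_def prod.case
proof (intro allI impI)
  fix \<tau> z :: complex assume tau: "Im \<tau> > 0"
  define w where "w = of_int c' * \<tau> + of_int d'"
  define \<tau>' where "\<tau>' = (of_int a' * \<tau> + of_int b') / w"
  define v where "v = of_int c * \<tau>' + of_int d"
  define j where "j = of_int (c * a' + d * c') * \<tau> + of_int (c * b' + d * d')"
  have w: "w \<noteq> 0" unfolding w_def by (rule moebius_denom_nonzero[OF det(2) tau])
  have tau': "Im \<tau>' > 0" unfolding \<tau>'_def w_def by (rule Im_moebius[OF det(2) tau])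
  have v: "v \<noteq> 0" unfolding v_def by (rule moebius_denom_nonzero[OF det(1) tau'])
  have vw: "v * w = j" using w by (simp add: v_def \<tau>'_def j_def w_def field_simps)
  have num: "(of_int a * \<tau>' + of_int b) / v = 
      (of_int (a * a' + b * c') * \<tau> + of_int (a * b' + b * d')) / j"
  proof -
    have "(of_int a * \<tau>' + of_int b) * w = of_int (a * a' + b * c') * \<tau> + of_int (a * b' + b * d')"
      using w by (simp add: \<tau>'_def w_def field_simps)
    thus ?thesis unfolding vw[symmetric] using v w by (simp add: field_simps)
  qed
  have ex: "of_int c * (z / w)\<^sup>2 / v + of_int c' * z\<^sup>2 / w = of_int (c * a' + d * c') * z\<^sup>2 / j"
  proof -
    have 1: "complex_of_int a' * of_int d' - of_int b' * of_int c' = 1"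
      using det(2) by (metis of_int_1 of_int_diff of_int_mult)
    have "of_int c + of_int c' * j = of_int (c * a' + d * c') * w + 
       of_int c * (1 - (complex_of_int a' * of_int d' - of_int b' * of_int c'))"
      by (simp add: j_def w_def algebra_simps)
    hence "of_int c + of_int c' * j = of_int (c * a' + d * c') * w" using 1 by simp
    moreover have "of_int c * (z / w)\<^sup>2 / v + of_int c' * z\<^sup>2 / w = (of_int c + of_int c' * (v * w)) * z\<^sup>2 / (v * w) / w"
      using v w by (simp add: field_simps power2_eq_square)
    ultimately show ?thesis using w vw by simp
  qed
  have "theta_quot (z / j) ((of_int (a * a' + b * c') * \<tau> + of_int (a * b' + b * d')) / j) =
      theta_quot ((z / w) / v) ((of_int a * \<tau>' + of_int b) / v)"
    unfolding num vw[symmetric] by (simp add: mult.commute)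
  also have "\<dots> = \<epsilon> * exp (of_real pi * \<i> * of_int c * (z / w)\<^sup>2 / v) * theta_quot (z / w) \<tau>'"
    unfolding v_def by (rule theta_multD[OF theta_mult(1) tau'])
  also have "theta_quot (z / w) \<tau>' = \<epsilon>' * exp (of_real pi * \<i> * of_int c' * z\<^sup>2 / w) * theta_quot z \<tau>"
    unfolding w_def \<tau>'_def by (rule theta_multD[OF theta_mult(2) tau])
  also have "\<epsilon> * exp (of_real pi * \<i> * of_int c * (z / w)\<^sup>2 / v) * (\<epsilon>' * exp (of_real pi * \<i> * of_int c' * z\<^sup>2 / w) * theta_quot z \<tau>) =
     \<epsilon> * \<epsilon>' * exp (of_real pi * \<i> * (of_int c * (z / w)\<^sup>2 / v + of_int c' * z\<^sup>2 / w)) * theta_quot z \<tau>"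
    by (simp add: distrib_left exp_add mult_ac)
  also have "of_real pi * \<i> * (of_int c * (z / w)\<^sup>2 / v + of_int c' * z\<^sup>2 / w) = 
     of_real pi * \<i> * of_int (c * a' + d * c') * z\<^sup>2 / j" unfolding ex by simp
  finally show "theta_quot (z / (of_int (c * a' + d * c') * \<tau> + of_int (c * b' + d * d')))
     ((of_int (a * a' + b * c') * \<tau> + of_int (a * b' + b * d')) / (of_int (c * a' + d * c') * \<tau> + of_int (c * b' + d * d'))) =
    \<epsilon> * \<epsilon>' * exp (of_real pi * \<i> * of_int (c * a' + d * c') * z\<^sup>2 / (of_int (c * a' + d * c') * \<tau> + of_int (c * b' + d * d'))) * theta_quot z \<tau>"
    unfolding j_def .
qed

lemma theta_mult_T: "theta_mult (1, b, 0, 1) (exp (of_real pi * \<i> * of_int b / 6))"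
proof -
  have "theta_quot z (\<tau> + of_int b) = exp (of_real pi * \<i> * of_int b / 6) * theta_quot z \<tau>" for z \<tau>
  proof -
    have 1: "e2pi (\<tau> + of_int b) = e2pi \<tau>" "e2pi (\<tau> + of_int b - z) = e2pi (\<tau> - z)"
      using e2pi_add_of_int[of \<tau> b] e2pi_add_of_int[of "\<tau> - z" b] by (simp_all only: add_diff_eq diff_add_eq)
    have 2: "exp (of_real pi * \<i> * ((\<tau> + of_int b) / 6 - z)) = 
       exp (of_real pi * \<i> * of_int b / 6) * exp (of_real pi * \<i> * (\<tau> / 6 - z))"
      unfolding exp_add[symmetric] by (rule arg_cong[of _ _ exp]) (simp add: field_simps)
    show ?thesis unfolding theta_quot_def 1 2 by simp
  qed
  thus ?thesis by (simp add: theta_mult_def)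
qed

lemma theta_mult_minus_one: "theta_mult (-1, 0, 0, -1) (-1)"
  by (simp add: theta_mult_def theta_quot_minus)

lemma theta_mult_S: "theta_mult (0, -1, 1, 0) (-\<i>)"
  using theta_quot_S by (simp add: theta_mult_def)

lemma theta_mult_S_inverse: "theta_mult (0, 1, -1, 0) \<i>"
  using theta_mult_mult[OF theta_mult_minus_one theta_mult_S] by simp

text \<open>The matrix is S T^(-1) S^(-1), so the two values of the multiplier at S and its inverse
  cancel.\<close>

lemma theta_mult_lower: "theta_mult (1, 0, 1, 1) (exp (- of_real pi * \<i> / 6))"
proof -
  have "- \<i> * E * \<i> = E" for E by (simp add: complex_eq_iff)
  thus ?thesis using theta_mult_mult[OF theta_mult_mult[OF theta_mult_S theta_mult_T[of "-1"]] theta_mult_S_inverse] by simp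
qed

lemma exp_twelfth_power: "exp (of_real pi * \<i> * of_int b / 6) ^ 12 = 1"
proof -
  have "exp (of_real pi * \<i> * of_int b / 6) ^ 12 = e2pi (of_int b)"
    unfolding exp_of_nat_mult[symmetric] by (rule arg_cong[of _ _ exp]) simp
  thus ?thesis by (simp only: e2pi_of_int)
qed

text \<open>Euclid's algorithm on the lower row writes the matrix as a product of powers of S and T,
  whose multipliers are 12th roots of unity.\<close>

lemma theta_mult_exists:
  fixes a b c d :: int
  assumes "a * d - b * c = 1"
  shows "\<exists>\<epsilon>. \<epsilon> ^ 12 = 1 \<and> theta_mult (a, b, c, d) \<epsilon>"
  using assms
proof (induction "nat \<bar>c\<bar>" arbitrary: a b c d rule: less_induct)
  case less
  show ?case
  proof (cases "c = 0")
    case True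
    hence "a * d = 1" using less.prems by simp
    hence "a = 1 \<and> d = 1 \<or> a = -1 \<and> d = -1" by (auto simp: zmult_eq_1_iff)
    thus ?thesis
    proof
      assume "a = 1 \<and> d = 1"
      thus ?thesis using True theta_mult_T[of b] exp_twelfth_power[of b] by auto
    next
      assume ad: "a = -1 \<and> d = -1"
      have "theta_mult (-1, b, 0, -1) (-1 * exp (of_real pi * \<i> * of_int (-b) / 6))"
        using theta_mult_mult[OF theta_mult_minus_one theta_mult_T[of "-b"]] by simp
      moreover have "(-1 * exp (of_real pi * \<i> * of_int (-b) / 6)) ^ 12 = 1"
        using exp_twelfth_power[of "-b"] by (simp add: power_mult_distrib)
      ultimately show ?thesis using True ad by blast
    qed
  next
    case False
    \<comment> \<open>With this n the entry \<open>d1\<close> is \<open>d mod c\<close>, so moving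
      it to the lower left position decreases the modulus of that entry.\<close>
    define n where "n = - (d div c)"
    define b1 where "b1 = a * n + b"
    define d1 where "d1 = c * n + d"
    have "d1 = d mod c" by (simp add: d1_def n_def minus_mult_div_eq_mod[symmetric])
    hence "nat \<bar>d1\<bar> < nat \<bar>c\<bar>" using False abs_mod_less[of c d] by simp
    moreover have det1: "b1 * (-c) - (-a) * d1 = 1"
      using less.prems by (simp add: b1_def d1_def algebra_simps)
    ultimately obtain \<epsilon> where e: "\<epsilon> ^ 12 = 1" "theta_mult (b1, -a, d1, -c) \<epsilon>"
      using less.hyps by blast
    have X: "theta_mult (0, 1, -1, n) (\<i> * exp (of_real pi * \<i> * of_int (-n) / 6))"
      using theta_mult_mult[OF theta_mult_S_inverse theta_mult_T[of "-n"]] by simp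
    have i12: "\<i> ^ 12 = 1" by (simp add: numeral_eq_Suc)
    have "theta_mult (a, b, c, d) (\<epsilon> * (\<i> * exp (of_real pi * \<i> * of_int (-n) / 6)))"
      using theta_mult_mult[OF e(2) X det1] by (simp add: b1_def d1_def algebra_simps)
    moreover have "(\<epsilon> * (\<i> * exp (of_real pi * \<i> * of_int (-n) / 6))) ^ 12 = 1"
      using e(1) exp_twelfth_power[of "-n"] i12 by (simp only: power_mult_distrib mult_1)
    ultimately show ?thesis by blast
  qed
qed

text \<open>Differentiating the law of \<open>theta_quot\<close> at z = 0 gives 2 pi
  \<open>\<i>\<close> times \<open>eta_sq\<close> on both sides; the chain rule for z / (c \<tau> +
  d) supplies the weight 1. The multiplier is the same \<open>\<epsilon>\<close>.\<close>

lemma eta_sq_modular: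
  fixes a b c d :: int
  assumes theta_mult: "theta_mult (a, b, c, d) \<epsilon>" and det: "a * d - b * c = 1" and tau: "Im \<tau> > 0"
  shows "eta_sq ((of_int a * \<tau> + of_int b) / (of_int c * \<tau> + of_int d)) = \<epsilon> * (of_int c * \<tau> + of_int d) * eta_sq \<tau>"
proof -
  define j where "j = of_int c * \<tau> + of_int d"
  define \<tau>' where "\<tau>' = (of_int a * \<tau> + of_int b) / j"
  have j: "j \<noteq> 0" unfolding j_def by (rule moebius_denom_nonzero[OF det tau])
  have tau': "Im \<tau>' > 0" unfolding j_def \<tau>'_def by (rule Im_moebius[OF det tau])
  have th0: "theta_quot 0 \<tau> = 0" if "Im \<tau> > 0" for \<tau> using theta_quot_minus[OF that, of 0] by simp
  have A: "((\<lambda>z. theta_quot z \<tau>') has_field_derivative 2 * of_real pi * \<i> * eta_sq \<tau>') (at (0 / j))"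
    using theta_quot_deriv_0[OF tau'] by simp
  have B: "((\<lambda>z. z / j) has_field_derivative 1 / j) (at 0)"
    using j by (auto intro!: derivative_eq_intros)
  note DERIV_chain2[OF A B]
  moreover have "((\<lambda>z. \<epsilon> * exp (of_real pi * \<i> * of_int c * z\<^sup>2 / j) * theta_quot z \<tau>) has_field_derivative \<epsilon> * (2 * of_real pi * \<i> * eta_sq \<tau>)) (at 0)"
    using th0[OF tau] j by (auto intro!: derivative_eq_intros theta_quot_deriv_0[OF tau])
  moreover have "(\<lambda>z. theta_quot (z / j) \<tau>') = (\<lambda>z. \<epsilon> * exp (of_real pi * \<i> * of_int c * z\<^sup>2 / j) * theta_quot z \<tau>)"
    using theta_multD[OF theta_mult tau] unfolding j_def \<tau>'_def by blast
  ultimately have "(2 * of_real pi * \<i> * eta_sq \<tau>') * (1 / j) = \<epsilon> * (2 * of_real pi * \<i> * eta_sq \<tau>)"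
    using DERIV_unique by metis
  hence "eta_sq \<tau>' = \<epsilon> * j * eta_sq \<tau>" using j by (simp add: field_simps)
  thus ?thesis unfolding \<tau>'_def j_def .
qed

section \<open>Siegel functions and the factors of the products\<close>

text \<open>The Siegel function with characteristic (u, v), as the product expansion below confirms.
  The Gaussian factor is chosen so that matrices act on (u, v) linearly.\<close>

definition siegel_fn :: "complex \<Rightarrow> complex \<Rightarrow> complex \<Rightarrow> complex" where
  "siegel_fn u v \<tau> = exp (of_real pi * \<i> * u * (u * \<tau> + v)) * theta_quot (u * \<tau> + v) \<tau>"

text \<open>With j = c \<tau> + d the identity u + c z = u' j turns the Gaussian exponent of the
  theta law into that of the new characteristic, which is (u, v) times the matrix from the
  right.\<close>

lemma siegel_fn_modular:
  fixes a b c d :: int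
  assumes theta_mult: "theta_mult (a, b, c, d) \<epsilon>" and det: "a * d - b * c = 1" and tau: "Im \<tau> > 0"
  shows "siegel_fn u v ((of_int a * \<tau> + of_int b) / (of_int c * \<tau> + of_int d)) =
     \<epsilon> * siegel_fn (u * of_int a + v * of_int c) (u * of_int b + v * of_int d) \<tau>"
proof -
  define j where "j = of_int c * \<tau> + of_int d"
  define \<tau>' where "\<tau>' = (of_int a * \<tau> + of_int b) / j"
  define u' where "u' = u * of_int a + v * of_int c"
  define z where "z = u' * \<tau> + (u * of_int b + v * of_int d)"
  have j: "j \<noteq> 0" unfolding j_def by (rule moebius_denom_nonzero[OF det tau])
  have zj: "u * \<tau>' + v = z / j" using j by (simp add: \<tau>'_def z_def u'_def j_def field_simps)
  have "of_int a * of_int d - of_int b * of_int c = (1::complex)"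
    using det by (metis of_int_1 of_int_diff of_int_mult)
  moreover have "u + of_int c * z = u' * j + u * (1 - (of_int a * of_int d - of_int b * of_int c))"
    by (simp add: z_def u'_def j_def algebra_simps)
  ultimately have "u + of_int c * z = u' * j" by simp
  hence "(u + of_int c * z) * z / j = u' * z" using j by simp
  hence ex: "u * (z / j) + of_int c * z\<^sup>2 / j = u' * z"
    by (simp add: distrib_right add_divide_distrib power2_eq_square mult.assoc)
  have "siegel_fn u v \<tau>' = exp (of_real pi * \<i> * u * (z / j)) * theta_quot (z / j) \<tau>'" unfolding siegel_fn_def zj ..
  also have "theta_quot (z / j) \<tau>' = \<epsilon> * exp (of_real pi * \<i> * of_int c * z\<^sup>2 / j) * theta_quot z \<tau>"
    unfolding \<tau>'_def j_def by (rule theta_multD[OF theta_mult tau])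
  also have "exp (of_real pi * \<i> * u * (z / j)) * (\<epsilon> * exp (of_real pi * \<i> * of_int c * z\<^sup>2 / j) * theta_quot z \<tau>) =
     \<epsilon> * exp (of_real pi * \<i> * (u * (z / j) + of_int c * z\<^sup>2 / j)) * theta_quot z \<tau>"
    by (simp add: distrib_left exp_add mult_ac)
  also have "\<dots> = \<epsilon> * siegel_fn u' (u * of_int b + v * of_int d) \<tau>"
    unfolding ex by (simp add: siegel_fn_def z_def mult.assoc)
  finally show ?thesis unfolding \<tau>'_def j_def u'_def .
qed

lemma siegel_fn_shift:
  fixes r s :: int
  assumes "Im \<tau> > 0"
  shows "siegel_fn (u + of_int r) (v + of_int s) \<tau> =
     exp (of_real pi * \<i> * (of_int r + of_int s + of_int r * of_int s + u * of_int s - of_int r * v)) * siegel_fn u v \<tau>"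
proof -
  have eq: "(u + of_int r) * \<tau> + (v + of_int s) = (u * \<tau> + v) + of_int s + of_int r * \<tau>"
    by (simp add: algebra_simps)
  have "siegel_fn (u + of_int r) (v + of_int s) \<tau> = 
     exp (of_real pi * \<i> * (u + of_int r) * ((u + of_int r) * \<tau> + (v + of_int s)) + 
       of_real pi * \<i> * (of_int s + of_int r - of_int r ^ 2 * \<tau> - 2 * of_int r * (u * \<tau> + v))) * theta_quot (u * \<tau> + v) \<tau>"
    unfolding siegel_fn_def eq theta_quot_add_lattice[OF assms] exp_add by simp
  also have "of_real pi * \<i> * (u + of_int r) * ((u + of_int r) * \<tau> + (v + of_int s)) + 
       of_real pi * \<i> * (of_int s + of_int r - of_int r ^ 2 * \<tau> - 2 * of_int r * (u * \<tau> + v)) =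
     of_real pi * \<i> * (of_int r + of_int s + of_int r * of_int s + u * of_int s - of_int r * v) + 
     of_real pi * \<i> * u * (u * \<tau> + v)"
    by (simp add: algebra_simps power2_eq_square)
  finally show ?thesis by (simp add: siegel_fn_def exp_add)
qed

text \<open>Collecting the powers of q gives the exponent B_2(u) / 2. This is the origin of the
  Bernoulli polynomial in the orders at the cusps.\<close>

lemma siegel_fn_qpoch:
  "siegel_fn u v \<tau> = - exp (of_real pi * \<i> * (u * v - v)) * e2pi (\<tau> * ((u\<^sup>2 - u + 1 / 6) / 2)) *
     (qpoch (e2pi (u * \<tau> + v)) (e2pi \<tau>) * qpoch (e2pi (\<tau> - (u * \<tau> + v))) (e2pi \<tau>))"
proof -
  have "exp (of_real pi * \<i> * u * (u * \<tau> + v)) * exp (of_real pi * \<i> * (\<tau> / 6 - (u * \<tau> + v))) =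
     exp (of_real pi * \<i> * (u * v - v)) * e2pi (\<tau> * ((u\<^sup>2 - u + 1 / 6) / 2))"
    unfolding exp_add[symmetric] by (rule arg_cong[of _ _ exp]) (simp add: field_simps power2_eq_square)
  thus ?thesis unfolding siegel_fn_def theta_quot_def by (simp add: mult.assoc[symmetric])
qed

text \<open>The sign makes the leading coefficient 1, so that this is exactly q^(N B_2(j/N) / 2)
  times the two products with exponents j and N - j.\<close>

definition gen_eta :: "nat \<Rightarrow> nat \<Rightarrow> complex \<Rightarrow> complex" where
  "gen_eta N j \<tau> = - siegel_fn (of_nat j / of_nat N) 0 (of_nat N * \<tau>)"

text \<open>The exponents agree because N B_2(j/N) / 2 = N/12 - j (N - j) / (2 N), while the part of
  \<open>S1\<close> coming from a_0 = 2 k is the leading power of eta(N \<tau>)^(2 k).\<close>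

lemma eta_prod_eq:
  assumes N: "N > 0"
  shows "eta_prod N (2 * k) a \<tau> = eta_sq (of_nat N * \<tau>) ^ k * (\<Prod>j = 1..N div 2. gen_eta N j \<tau> powi vec_index a (j - 1))"
proof -
  define x where "x = (\<lambda>j. vec_index a (j - 1))"
  define m where "m = N div 2"
  define Q where "Q = (\<lambda>j. qpoch (e2pi (of_nat j * \<tau>)) (e2pi (of_nat N * \<tau>)) * qpoch (e2pi (of_nat (N - j) * \<tau>)) (e2pi (of_nat N * \<tau>)))"
  define ex where "ex = (\<lambda>j. \<tau> * (of_nat N * (((of_nat j / of_nat N)\<^sup>2 - of_nat j / of_nat N + 1 / 6) / 2)))"
  have E: "gen_eta N j \<tau> = e2pi (ex j) * Q j" if "j \<in> {1..m}" for j
  proof -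
    have 1: "of_nat j / of_nat N * (of_nat N * \<tau>) = of_nat j * \<tau>" using N by simp
    have "j \<le> N" using that by (auto simp: m_def)
    hence 2: "of_nat N * \<tau> - of_nat j * \<tau> = of_nat (N - j) * \<tau>" by (simp add: of_nat_diff algebra_simps)
    show ?thesis unfolding gen_eta_def siegel_fn_qpoch Q_def ex_def using 1 2 by (simp add: mult_ac)
  qed
  have qp: "qpow \<tau> (of_nat j) = e2pi (of_nat j * \<tau>)" for j
    by (simp add: qpow_def mult_ac)
  define pre where "pre = qpow \<tau> (of_nat N / 24 * of_int (S1 N (2 * k) a) - 1 / (2 * of_nat N) * of_int (S2 N a))"
  have pre: "pre = exp (of_real pi * \<i> * (of_nat N * \<tau>) / 6) ^ k * (\<Prod>j = 1..m. e2pi (ex j) powi x j)"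
  proof -
    have "(\<Prod>j = 1..m. e2pi (ex j) powi x j) = exp (\<Sum>j = 1..m. of_int (x j) * (2 * of_real pi * \<i> * ex j))"
      by (simp only: exp_power_int exp_sum finite_atLeastAtMost)
    moreover have "exp (of_real pi * \<i> * (of_nat N * \<tau>) / 6) ^ k = exp (of_nat k * (of_real pi * \<i> * (of_nat N * \<tau>) / 6))"
      by (simp only: exp_of_nat_mult)
    moreover have "2 * of_real pi * \<i> * \<tau> * of_rat (of_nat N / 24 * of_int (S1 N (2 * k) a) - 1 / (2 * of_nat N) * of_int (S2 N a)) = 
       of_nat k * (of_real pi * \<i> * (of_nat N * \<tau>) / 6) + (\<Sum>j = 1..m. of_int (x j) * (2 * of_real pi * \<i> * ex j))"
    proof -
      have "(\<Sum>j = 1..m. of_int (x j) * (2 * of_real pi * \<i> * ex j)) = 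
         (\<Sum>j = 1..m. 2 * of_real pi * \<i> * \<tau> * (of_nat N / 12 * of_int (x j) - 1 / (2 * of_nat N) * (of_nat j * (of_nat N - of_nat j) * of_int (x j))))"
        using N by (intro sum.cong refl) (simp add: ex_def field_simps power2_eq_square)
      also have "\<dots> = 2 * of_real pi * \<i> * \<tau> * (of_nat N / 12 * (\<Sum>j = 1..m. of_int (x j)) - 1 / (2 * of_nat N) * (\<Sum>j = 1..m. of_nat j * (of_nat N - of_nat j) * of_int (x j)))"
        unfolding sum_distrib_left sum_subtractf[symmetric] ..
      finally have ex_sum: "(\<Sum>j = 1..m. of_int (x j) * (2 * of_real pi * \<i> * ex j)) = \<dots>" .
      define A where "A = (\<Sum>j = 1..m. complex_of_int (x j))"
      define B where "B = (\<Sum>j = 1..m. of_nat j * (of_nat N - of_nat j) * complex_of_int (x j))"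
      have rat: "of_rat (of_nat N / 24 * of_int (S1 N (2 * k) a) - 1 / (2 * of_nat N) * of_int (S2 N a)) =
        of_nat N / 24 * of_int (S1 N (2 * k) a) - 1 / (2 * of_nat N) * (of_int (S2 N a) :: complex)"
        by (simp add: of_rat_diff of_rat_mult of_rat_divide)
      have "of_int (S1 N (2 * k) a) = 2 * of_nat k + 2 * A"
        by (simp add: S1_def A_def x_def m_def)
      moreover have "of_int (S2 N a) = B"
        by (simp add: S2_def B_def x_def m_def)
      ultimately show ?thesis unfolding ex_sum rat A_def[symmetric] B_def[symmetric]
        using N by (simp add: field_simps)
    qed
    ultimately show ?thesis unfolding pre_def qpow_def by (simp only: exp_add)
  qed
  have "eta_prod N (2 * k) a \<tau> = pre * qpoch (e2pi (of_nat N * \<tau>)) (e2pi (of_nat N * \<tau>)) ^ (2 * k) * (\<Prod>j = 1..m. Q j powi x j)"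
    unfolding eta_prod_def pre_def x_def m_def Q_def qp ..
  also have "\<dots> = eta_sq (of_nat N * \<tau>) ^ k * (\<Prod>j = 1..m. e2pi (ex j) powi x j * Q j powi x j)"
    unfolding pre eta_sq_def prod.distrib by (simp add: power_mult_distrib power_mult[symmetric] mult_ac)
  also have "(\<Prod>j = 1..m. e2pi (ex j) powi x j * Q j powi x j) = (\<Prod>j = 1..m. gen_eta N j \<tau> powi x j)"
    by (intro prod.cong refl) (simp add: E power_int_mult_distrib)
  finally show ?thesis by (simp only: x_def m_def)
qed

section \<open>Invariance under \<open>\<Gamma>\<^sub>1(N)\<close>\<close>

definition moment1 :: "nat \<Rightarrow> int Matrix.vec \<Rightarrow> int" where
  "moment1 N x = (\<Sum>j = 1..N div 2. int j * vec_index x (j - 1))"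

definition moment0 :: "nat \<Rightarrow> int Matrix.vec \<Rightarrow> int" where
  "moment0 N x = (\<Sum>j = 1..N div 2. vec_index x (j - 1))"

definition moment2 :: "nat \<Rightarrow> int Matrix.vec \<Rightarrow> int" where
  "moment2 N x = (\<Sum>j = 1..N div 2. (int j)\<^sup>2 * vec_index x (j - 1))"

text \<open>j^2 and j have the same parity. Only the parity of \<open>moment1\<close> influences the
  transformation factor, and this lemma expresses it by \<open>moment2\<close>.\<close>

lemma moment_parity: "even (moment1 N x) \<longleftrightarrow> even (moment2 N x)"
proof -
  have "moment2 N x - moment1 N x = (\<Sum>j = 1..N div 2. int j * (int j - 1) * vec_index x (j - 1))"
    unfolding moment1_def moment2_def sum_subtractf[symmetric]
    by (intro sum.cong refl) (simp add: power2_eq_square algebra_simps)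
  also have "even \<dots>" by (intro dvd_sum) auto
  finally show ?thesis by auto
qed

lemma gen_eta_nonzero:
  assumes tau: "Im \<tau> > 0" and j: "0 < j" "j < N"
  shows "gen_eta N j \<tau> \<noteq> 0"
proof
  assume "gen_eta N j \<tau> = 0"
  hence "theta_quot (of_nat j * \<tau>) (of_nat N * \<tau>) = 0" using j by (simp add: gen_eta_def siegel_fn_def)
  moreover have "Im (of_nat N * \<tau>) > 0" using tau j by simp
  ultimately obtain r s :: int where rs: "of_nat j * \<tau> = of_int r + of_int s * (of_nat N * \<tau>)"
    using theta_quot_eq_0_iff by blast
  have "Im (of_nat j * \<tau>) = Im (of_int r + of_int s * (of_nat N * \<tau>))" using rs by (rule arg_cong)
  hence "(real j - of_int s * real N) * Im \<tau> = 0" by (simp add: algebra_simps)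
  hence "real j = of_int s * real N" using tau by simp
  hence "real_of_int (int j) = real_of_int (s * int N)" by simp
  hence "int j = s * int N" by (subst (asm) of_int_eq_iff)
  hence "int N dvd int j" by simp
  thus False using j by (auto dest: dvd_imp_le)
qed

lemma eta_prod_nonzero:
  assumes tau: "Im \<tau> > 0" and N: "N > 0"
  shows "eta_prod N (2 * k) x \<tau> \<noteq> 0"
proof -
  have "Im (of_nat N * \<tau>) > 0" using tau N by simp
  thus ?thesis unfolding eta_prod_eq[OF N]
    using eta_sq_nonzero gen_eta_nonzero[OF tau] by (auto simp: prod_zero_iff)
qed

text \<open>Multiplication by N conjugates (p, b; N c', d) into (p, b N; c', d), which acts on N
  \<tau>. That matrix moves the characteristic (j/N, 0) to (j/N + j s, j b), an integral shift, so
  each factor is multiplied by a constant; the constants combine into the moments of x.\<close>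

lemma slash_Gamma1:
  fixes p b c' d s :: int
  assumes N: "N > 0" and det: "p * d - b * (int N * c') = 1" and p: "p = 1 + int N * s"
    and theta_mult: "theta_mult (p, b * int N, c', d) \<epsilon>" and tau: "Im \<tau> > 0"
  shows "slash k (eta_prod N (2 * k) x) (p, b, int N * c', d) \<tau> =
     \<epsilon> powi (int k + moment0 N x) *
     exp (of_real pi * \<i> * (of_int ((s + b) * moment1 N x + s * b * moment2 N x) + of_int (b * moment2 N x) / of_nat N)) *
     eta_prod N (2 * k) x \<tau>"
proof -
  define j0 where "j0 = of_int (int N * c') * \<tau> + of_int d"
  define \<tau>' where "\<tau>' = (of_int p * \<tau> + of_int b) / j0"
  have j0: "j0 \<noteq> 0" unfolding j0_def by (rule moebius_denom_nonzero[OF det tau])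
  have NT: "Im (of_nat N * \<tau>) > 0" using tau N by simp
  have det': "p * d - b * int N * c' = 1" using det by (simp add: mult.assoc)
  have e0: "\<epsilon> \<noteq> 0"
  proof
    assume "\<epsilon> = 0"
    hence "eta_sq ((of_int p * (of_nat N * \<tau>) + of_int (b * int N)) / (of_int c' * (of_nat N * \<tau>) + of_int d)) = 0"
      using eta_sq_modular[OF theta_mult det' NT] by simp
    thus False using eta_sq_nonzero[OF Im_moebius[OF det' NT]] by simp
  qed
  have arg: "(of_int p * (of_nat N * \<tau>) + of_int (b * int N)) / (of_int c' * (of_nat N * \<tau>) + of_int d) = of_nat N * \<tau>'"
    by (simp add: \<tau>'_def j0_def algebra_simps)
  have den: "of_int c' * (of_nat N * \<tau>) + of_int d = j0" by (simp add: j0_def mult_ac)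
  define ex where "ex = (\<lambda>j::nat. complex_of_int (int j * (s + b) + (int j)\<^sup>2 * (s * b)) + of_int ((int j)\<^sup>2 * b) / of_nat N)"
  have E: "gen_eta N j \<tau>' = \<epsilon> * exp (of_real pi * \<i> * ex j) * gen_eta N j \<tau>" for j
  proof -
    have "siegel_fn (of_nat j / of_nat N) 0 (of_nat N * \<tau>') = \<epsilon> * 
       siegel_fn (of_nat j / of_nat N * of_int p + 0 * of_int c') (of_nat j / of_nat N * of_int (b * int N) + 0 * of_int d) (of_nat N * \<tau>)"
      unfolding arg[symmetric] by (rule siegel_fn_modular[OF theta_mult det' NT])
    also have "of_nat j / of_nat N * of_int p + 0 * of_int c' = of_nat j / of_nat N + complex_of_int (int j * s)"
      using N by (simp add: p field_simps)
    also have "of_nat j / of_nat N * of_int (b * int N) + 0 * of_int d = 0 + complex_of_int (int j * b)"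
      using N by simp
    also have "siegel_fn (of_nat j / of_nat N + complex_of_int (int j * s)) (0 + complex_of_int (int j * b)) (of_nat N * \<tau>) =
       exp (of_real pi * \<i> * ex j) * siegel_fn (of_nat j / of_nat N) 0 (of_nat N * \<tau>)"
      unfolding siegel_fn_shift[OF NT] ex_def by (simp add: power2_eq_square algebra_simps)
    finally show ?thesis by (simp add: gen_eta_def)
  qed
  have exs: "(\<Sum>j = 1..N div 2. of_int (vec_index x (j - 1)) * (of_real pi * \<i> * ex j)) =
     of_real pi * \<i> * (of_int ((s + b) * moment1 N x + s * b * moment2 N x) + of_int (b * moment2 N x) / of_nat N)"
    unfolding moment1_def moment2_def ex_def
    by (simp add: sum_distrib_left sum.distrib sum_divide_distrib distrib_left algebra_simps)
  have "(\<Prod>j = 1..N div 2. gen_eta N j \<tau>' powi vec_index x (j - 1)) = 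
     (\<Prod>j = 1..N div 2. \<epsilon> powi vec_index x (j - 1)) * 
     (\<Prod>j = 1..N div 2. exp (of_real pi * \<i> * ex j) powi vec_index x (j - 1)) *
     (\<Prod>j = 1..N div 2. gen_eta N j \<tau> powi vec_index x (j - 1))"
    unfolding E prod.distrib[symmetric] by (simp add: power_int_mult_distrib)
  also have "(\<Prod>j = 1..N div 2. \<epsilon> powi vec_index x (j - 1)) = \<epsilon> powi moment0 N x"
  proof -
    have "(\<Prod>j = 1..m. \<epsilon> powi f j) = \<epsilon> powi (\<Sum>j = 1..m. f j)" for m :: nat and f :: "nat \<Rightarrow> int"
      using e0 by (induction m) (simp_all add: power_int_add)
    thus ?thesis unfolding moment0_def .
  qed
  also have "(\<Prod>j = 1..N div 2. exp (of_real pi * \<i> * ex j) powi vec_index x (j - 1)) =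
      exp (of_real pi * \<i> * (of_int ((s + b) * moment1 N x + s * b * moment2 N x) + of_int (b * moment2 N x) / of_nat N))"
    unfolding exs[symmetric] by (simp only: exp_power_int exp_sum finite_atLeastAtMost)
  finally have prod: "(\<Prod>j = 1..N div 2. gen_eta N j \<tau>' powi vec_index x (j - 1)) = \<epsilon> powi moment0 N x *
     exp (of_real pi * \<i> * (of_int ((s + b) * moment1 N x + s * b * moment2 N x) + of_int (b * moment2 N x) / of_nat N)) *
     (\<Prod>j = 1..N div 2. gen_eta N j \<tau> powi vec_index x (j - 1))" .
  have "eta_sq (of_nat N * \<tau>') = \<epsilon> * j0 * eta_sq (of_nat N * \<tau>)"
    using eta_sq_modular[OF theta_mult det' NT, unfolded arg] unfolding den .
  hence f: "eta_prod N (2 * k) x \<tau>' = (\<epsilon> * j0 * eta_sq (of_nat N * \<tau>)) ^ k * (\<epsilon> powi moment0 N x * exp (of_real pi * \<i> * (of_int ((s + b) * moment1 N x + s * b * moment2 N x) + of_int (b * moment2 N x) / of_nat N)) * (\<Prod>j = 1..N div 2. gen_eta N j \<tau> powi vec_index x (j - 1)))"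
    unfolding eta_prod_eq[OF N] prod by simp
  have "slash k (eta_prod N (2 * k) x) (p, b, int N * c', d) \<tau> = j0 powi (- int k) * eta_prod N (2 * k) x \<tau>'"
    unfolding slash_def \<tau>'_def j0_def by simp
  also have "\<dots> = (j0 powi (- int k) * j0 powi int k) * (\<epsilon> powi int k * \<epsilon> powi moment0 N x) * exp (of_real pi * \<i> * (of_int ((s + b) * moment1 N x + s * b * moment2 N x) + of_int (b * moment2 N x) / of_nat N)) * eta_prod N (2 * k) x \<tau>"
    unfolding f unfolding eta_prod_eq[OF N] by (simp add: power_mult_distrib mult_ac)
  finally show ?thesis using j0 e0 power_int_add[of \<epsilon> "int k" "moment0 N x"] by (simp add: power_int_minus)
qed

lemma exp_pi_i_eq_1_iff: "exp (of_real pi * \<i> * z) = 1 \<longleftrightarrow> (\<exists>n::int. z = 2 * of_int n)"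
proof -
  have "exp (of_real pi * \<i> * z) = e2pi (z / 2)" by (simp add: mult_ac)
  also have "\<dots> = 1 \<longleftrightarrow> z / 2 \<in> \<int>" by (rule e2pi_eq_1_iff)
  also have "\<dots> \<longleftrightarrow> (\<exists>n::int. z = 2 * of_int n)" by (auto elim!: Ints_cases simp: field_simps)
  finally show ?thesis .
qed

text \<open>Two unipotent matrices suffice for necessity, since the product has no zeros and its
  transformation factor must be 1. For sufficiency the 12th root of unity disappears and a question
  of parity remains.\<close>

lemma slash_Gamma1_invariant_iff:
  assumes N: "N > 0"
  shows "(\<forall>\<gamma> \<in> Gamma1 N. \<forall>\<tau> \<in> upper_half_plane. slash k (eta_prod N (2 * k) x) \<gamma> \<tau> = eta_prod N (2 * k) x \<tau>)
    \<longleftrightarrow> 12 dvd int k + moment0 N x \<and> int (N * gcd 2 N) dvd moment2 N x"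
  (is "?lhs \<longleftrightarrow> ?rhs")
proof
  assume L: ?lhs
  let ?K = "int k + moment0 N x"
  have nz: "eta_prod N (2 * k) x \<i> \<noteq> 0" by (rule eta_prod_nonzero) (use N in auto)
  have iu: "\<i> \<in> upper_half_plane" by (simp add: upper_half_plane_def)
  \<comment> \<open>Here the shifts of all characteristics vanish and the factor is a power of a
    primitive 12th root of unity.\<close>
  have "(1, 0, int N * 1, 1) \<in> Gamma1 N" by (simp add: Gamma1_def SL2Z_def cong_def)
  hence "slash k (eta_prod N (2 * k) x) (1, 0, int N * 1, 1) \<i> = eta_prod N (2 * k) x \<i>" using L iu by blast
  hence "exp (- of_real pi * \<i> / 6) powi ?K = 1"
    using slash_Gamma1[OF N, of 1 1 0 1 0 _ \<i> k x] theta_mult_lower nz by simp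
  moreover have "exp (- of_real pi * \<i> / 6) powi ?K = exp (of_real pi * \<i> * (- of_int ?K / 6))"
    unfolding exp_power_int by (rule arg_cong[of _ _ exp]) (simp only: times_divide_eq_right mult_minus_left mult_minus_right mult_ac)
  ultimately have "exp (of_real pi * \<i> * (- of_int ?K / 6)) = 1" by (simp only:)
  then obtain n :: int where n: "- of_int ?K / 6 = (2 * of_int n :: complex)" unfolding exp_pi_i_eq_1_iff by blast
  have "complex_of_int ?K = - 6 * (- of_int ?K / 6)" by simp
  also have "\<dots> = of_int (12 * (- n))" unfolding n by simp
  finally have "complex_of_int ?K = of_int (12 * (- n))" .
  hence K: "?K = 12 * (- n)" by (subst (asm) of_int_eq_iff)
  \<comment> \<open>The translation by 1 tests whether the q-expansion has integral
    exponents.\<close>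
  have "(1, 1, int N * 0, 1) \<in> Gamma1 N" by (simp add: Gamma1_def SL2Z_def cong_def)
  hence "slash k (eta_prod N (2 * k) x) (1, 1, int N * 0, 1) \<i> = eta_prod N (2 * k) x \<i>" using L iu by blast
  hence "exp (of_real pi * \<i> * of_int (1 * int N) / 6) powi ?K * 
     exp (of_real pi * \<i> * (of_int (moment1 N x) + of_int (moment2 N x) / of_nat N)) = 1"
    using slash_Gamma1[OF N, of 1 1 1 0 0 _ \<i> k x] theta_mult_T[of "1 * int N"] nz by simp
  moreover have "exp (of_real pi * \<i> * of_int (1 * int N) / 6) powi ?K = 1"
    unfolding K power_int_mult using exp_twelfth_power[of "1 * int N"] by simp
  ultimately have "exp (of_real pi * \<i> * (of_int (moment1 N x) + of_int (moment2 N x) / of_nat N)) = 1" by simp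
  then obtain l :: int where "of_int (moment1 N x) + of_int (moment2 N x) / of_nat N = (2 * of_int l :: complex)"
    unfolding exp_pi_i_eq_1_iff by blast
  hence "complex_of_int (moment2 N x) = of_int (int N * (2 * l - moment1 N x))" using N by (simp add: field_simps)
  hence moment2: "moment2 N x = int N * (2 * l - moment1 N x)" by (subst (asm) of_int_eq_iff)
  \<comment> \<open>For even N, \<open>moment2\<close> is even, hence \<open>moment1\<close> is
    even, and this provides the additional factor 2.\<close>
  have "int (N * gcd 2 N) dvd moment2 N x"
  proof (cases "even N")
    case True
    have "even (moment2 N x)" using moment2 True by simp
    hence "even (moment1 N x)" by (simp add: moment_parity)
    hence "int N * 2 dvd int N * (2 * l - moment1 N x)" by (intro mult_dvd_mono) auto
    thus ?thesis using True moment2 by (simp add: gcd_nat.absorb1)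
  next
    case False
    hence "gcd 2 N = 1" by (simp add: coprime_iff_gcd_eq_1[symmetric])
    thus ?thesis using moment2 by simp
  qed
  thus ?rhs using K by simp
next
  assume R: ?rhs
  show ?lhs
  proof (intro ballI)
    fix \<gamma> \<tau> assume g: "\<gamma> \<in> Gamma1 N" and tau: "\<tau> \<in> upper_half_plane"
    obtain p b c d where gam: "\<gamma> = (p, b, c, d)" by (cases \<gamma>)
    have det: "p * d - b * c = 1" and "[p = 1] (mod int N)" and "[c = 0] (mod int N)"
      using g by (auto simp: gam Gamma1_def SL2Z_def)
    then obtain s c' where s: "p = 1 + int N * s" and c: "c = int N * c'"
      by (metis cong_iff_lin cong_0_iff dvd_def cong_sym mult.commute)
    have det': "p * d - (b * int N) * c' = 1" using det c by (simp add: mult_ac)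
    obtain \<epsilon> where e: "\<epsilon> ^ 12 = 1" "theta_mult (p, b * int N, c', d) \<epsilon>" using theta_mult_exists[OF det'] by blast
    from R obtain l where l: "int k + moment0 N x = 12 * l" by auto
    from R obtain t0 where t0: "moment2 N x = int (N * gcd 2 N) * t0" by auto
    define t where "t = int (gcd 2 N) * t0"
    have t: "moment2 N x = int N * t" using t0 by (simp add: t_def)
    have e1: "\<epsilon> powi (int k + moment0 N x) = 1" unfolding l power_int_mult using e(1) by simp
    \<comment> \<open>For even N all three of \<open>moment1\<close>, \<open>moment2\<close> and t
      are even. For odd N they share one parity, and the determinant forces s to be even whenever b
      is.\<close>
    have ev: "even ((s + b) * moment1 N x + s * b * moment2 N x + b * t)"
    proof (cases "even N")
      case True
      hence "gcd 2 N = 2" by (simp add: gcd_nat.absorb1)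
      hence "even t" by (simp add: t_def)
      moreover have "even (moment2 N x)" using t True by simp
      ultimately show ?thesis by (simp add: moment_parity)
    next
      case False
      have tt: "even (moment1 N x) \<longleftrightarrow> even t" "even (moment2 N x) \<longleftrightarrow> even t" using moment_parity[of N x] t False by auto
      have "even b \<Longrightarrow> even s"
      proof -
        assume "even b"
        moreover have "p * d = 1 + b * c" using det by simp
        ultimately have "odd (p * d)" by simp
        thus "even s" using s False by auto
      qed
      thus ?thesis using tt by auto
    qed
    have "of_int (b * moment2 N x) / of_nat N = complex_of_int (b * t)" using N by (simp add: t)
    hence "of_int ((s + b) * moment1 N x + s * b * moment2 N x) + of_int (b * moment2 N x) / of_nat N = 
       complex_of_int ((s + b) * moment1 N x + s * b * moment2 N x + b * t)" by simp
    hence "exp (of_real pi * \<i> * (of_int ((s + b) * moment1 N x + s * b * moment2 N x) + of_int (b * moment2 N x) / of_nat N)) = 1"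
      using ev by (simp only: exp_pi_i_of_int if_True)
    thus "slash k (eta_prod N (2 * k) x) \<gamma> \<tau> = eta_prod N (2 * k) x \<tau>"
      using slash_Gamma1[OF N det[unfolded c] s e(2), of \<tau> k x] tau e1
      unfolding gam c by (simp add: upper_half_plane_def)
  qed
qed

section \<open>Expansions at the cusps\<close>

text \<open>The order at the cusp p in the local parameter exp(2 pi i g \<tau> / N) of a cusp of
  width N / g. The coefficients of x are the expressions defining the entries of A_N, here taken at
  arbitrary pairs and not only at the representatives.\<close>

definition cusp_ord :: "nat \<Rightarrow> nat \<Rightarrow> int Matrix.vec \<Rightarrow> int \<times> int \<Rightarrow> rat" where
  "cusp_ord N k x p = of_int (cusp_g N p) * of_nat k / 12 +
     (\<Sum>j = 1..N div 2. of_int (vec_index x (j - 1)) *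
        (of_int (cusp_g N p) / 2 * B2 (frac (of_int (int j * fst p) / of_int (cusp_g N p)))))"

text \<open>A vanishing factor would force |t|^(\<alpha> + \<beta> n) = 1, hence \<alpha> = n = 0.
  Then the factor is 1 - \<zeta>, which the last hypothesis excludes; it also covers the centre t =
  0.\<close>

lemma qpoch_unit_ball:
  assumes \<zeta>: "norm \<zeta> = 1" and \<xi>: "norm \<xi> = 1" and \<beta>: "\<beta> > 0" and \<alpha>: "\<alpha> > 0 \<or> \<zeta> \<noteq> 1"
  shows "(\<lambda>t. qpoch (\<zeta> * t ^ \<alpha>) (\<xi> * t ^ \<beta>)) holomorphic_on ball 0 1"
    and "\<forall>t \<in> ball 0 1. qpoch (\<zeta> * t ^ \<alpha>) (\<xi> * t ^ \<beta>) \<noteq> 0"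
proof -
  have lt: "norm (\<xi> * t ^ \<beta>) < 1" if "t \<in> ball 0 1" for t
    using that \<beta> \<xi> by (simp add: norm_mult norm_power power_less_one_iff)
  show "(\<lambda>t. qpoch (\<zeta> * t ^ \<alpha>) (\<xi> * t ^ \<beta>)) holomorphic_on ball 0 1"
    by (intro holomorphic_on_qpoch holomorphic_intros lt) auto
  show "\<forall>t \<in> ball 0 1. qpoch (\<zeta> * t ^ \<alpha>) (\<xi> * t ^ \<beta>) \<noteq> 0"
  proof
    fix t :: complex assume t: "t \<in> ball 0 1"
    show "qpoch (\<zeta> * t ^ \<alpha>) (\<xi> * t ^ \<beta>) \<noteq> 0"
      unfolding qpoch_eq_0_iff[OF lt[OF t]]
    proof
      assume "\<exists>n. \<zeta> * t ^ \<alpha> * (\<xi> * t ^ \<beta>) ^ n = 1"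
      then obtain n where n: "\<zeta> * t ^ \<alpha> * (\<xi> * t ^ \<beta>) ^ n = 1" ..
      hence "norm (\<zeta> * t ^ \<alpha> * (\<xi> * t ^ \<beta>) ^ n) = 1" by simp
      hence "norm t ^ (\<alpha> + \<beta> * n) = 1"
        using \<zeta> \<xi> by (simp add: norm_mult norm_power power_add power_mult)
      moreover have "norm t ^ (\<alpha> + \<beta> * n) < 1" if "\<alpha> + \<beta> * n > 0"
        using t that by (simp add: power_less_one_iff)
      ultimately have "\<alpha> + \<beta> * n = 0" by fastforce
      hence "\<alpha> = 0" "n = 0" using \<beta> by auto
      thus False using n \<alpha> by simp
    qed
  qed
qed

text \<open>Left multiplication by diag(N, 1) is factored as (N a, N b; c, d) = (N a / g, y; c / g,
  w) (g, B; 0, N / g) with the first factor in SL2(Z). The modular laws apply to that factor, and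
  the triangular one merely rescales and translates \<tau>.\<close>

lemma cusp_setup:
  fixes a b c d :: int
  assumes N: "N > 0" and det: "a * d - b * c = 1"
  defines "g \<equiv> gcd c (int N)"
  obtains y B :: int and \<epsilon> where "coprime y (int N div g)" "\<epsilon> \<noteq> 0"
    "\<And>\<tau>. Im \<tau> > 0 \<Longrightarrow> Im ((of_int g * \<tau> + of_int B) * of_int g / of_nat N) > 0"
    "\<And>\<tau>. Im \<tau> > 0 \<Longrightarrow> eta_sq (of_nat N * ((of_int a * \<tau> + of_int b) / (of_int c * \<tau> + of_int d))) =
        \<epsilon> * (of_int g / of_nat N) * (of_int c * \<tau> + of_int d) * eta_sq ((of_int g * \<tau> + of_int B) * of_int g / of_nat N)"
    "\<And>\<tau> j. Im \<tau> > 0 \<Longrightarrow> gen_eta N j ((of_int a * \<tau> + of_int b) / (of_int c * \<tau> + of_int d)) =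
        - \<epsilon> * siegel_fn (of_nat j * of_int a / of_int g) (of_nat j * of_int y / of_nat N) ((of_int g * \<tau> + of_int B) * of_int g / of_nat N)"
proof -
  define n1 where "n1 = int N div g"
  define c1 where "c1 = c div g"
  have g: "g > 0" using N by (simp add: g_def gcd_pos_int)
  have Ng: "int N = g * n1" and cg: "c = g * c1" by (simp_all add: n1_def c1_def g_def)
  have n1: "n1 > 0" using N g Ng by (metis of_nat_0_less_iff zero_less_mult_pos)
  have "coprime n1 c1" using g unfolding n1_def c1_def g_def 
    by (metis coprime_commute div_gcd_coprime less_irrefl gcd_eq_0_iff)
  moreover have "coprime a c"
  proof (rule coprimeI)
    fix r assume "r dvd a" "r dvd c"
    hence "r dvd a * d - b * c" by (intro dvd_diff) auto
    thus "is_unit r" using det by simp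
  qed
  hence "coprime a c1" using cg by simp
  ultimately have "coprime (n1 * a) c1" by simp
  then obtain w y0 where "w * (n1 * a) + y0 * c1 = 1" using bezout_int[of "n1 * a" c1] by auto
  define y where "y = - y0"
  have wy: "n1 * a * w - y * c1 = 1" using \<open>w * (n1 * a) + y0 * c1 = 1\<close> by (simp add: y_def algebra_simps)
  \<comment> \<open>Solves the two equations \<open>i1\<close> and \<open>i2\<close> below, which
    express the second column of the factorisation.\<close>
  define B where "B = w * int N * b - y * d"
  obtain \<epsilon> where e: "\<epsilon> ^ 12 = 1" "theta_mult (n1 * a, y, c1, w) \<epsilon>" using theta_mult_exists[OF wy] by blast
  have e0: "\<epsilon> \<noteq> 0" using e(1) by auto
  have cop: "coprime y (int N div g)"
  proof (rule coprimeI)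
    fix r assume "r dvd y" "r dvd int N div g"
    hence "r dvd n1 * a * w - y * c1" unfolding n1_def by (intro dvd_diff) auto
    thus "is_unit r" using wy by simp
  qed
  define T where "T = (\<lambda>\<tau>. (of_int g * \<tau> + of_int B) * of_int g / complex_of_nat N)"
  have gN: "complex_of_nat N = of_int g * of_int n1" using Ng by (metis of_int_mult of_int_of_nat_eq)
  have T: "T \<tau> = (of_int g * \<tau> + of_int B) / of_int n1" for \<tau> unfolding T_def gN using g by simp
  have ImT: "Im (T \<tau>) > 0" if "Im \<tau> > 0" for \<tau>
  proof -
    have "T \<tau> = complex_of_real (1 / of_int n1) * (of_int g * \<tau> + of_int B)" unfolding T by simp
    hence "Im (T \<tau>) = (1 / of_int n1) * (of_int g * Im \<tau>)" by simp
    thus ?thesis using that g n1 by simp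
  qed
  have i1: "c1 * B + w * n1 = d"
  proof -
    have "c1 * B + w * n1 = w * n1 * (b * (g * c1) + 1) - c1 * y * d" 
      unfolding B_def Ng by (simp add: algebra_simps)
    also have "b * (g * c1) + 1 = a * d" using det cg by simp
    also have "w * n1 * (a * d) - c1 * y * d = (n1 * a * w - y * c1) * d" by (simp add: algebra_simps)
    finally show ?thesis using wy by simp
  qed
  have i2: "a * B + y = g * b"
  proof -
    have "a * B + y = a * w * int N * b - y * (a * d - 1)" unfolding B_def by (simp add: algebra_simps)
    also have "a * d - 1 = b * (g * c1)" using det cg by simp
    also have "a * w * int N * b - y * (b * (g * c1)) = g * b * (n1 * a * w - y * c1)"
      unfolding Ng by (simp add: algebra_simps)
    finally show ?thesis using wy by simp
  qed
  have den: "of_int c1 * T \<tau> + of_int w = (of_int c * \<tau> + of_int d) / of_int n1" for \<tau>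
  proof -
    have "of_int c1 * T \<tau> + of_int w = (of_int (g * c1) * \<tau> + of_int (c1 * B + w * n1)) / of_int n1"
      using n1 unfolding T by (simp add: field_simps)
    thus ?thesis unfolding i1 cg[symmetric] .
  qed
  have num: "of_int (n1 * a) * T \<tau> + of_int y = of_int g * (of_int a * \<tau> + of_int b)" for \<tau>
  proof -
    have "of_int (n1 * a) * T \<tau> + of_int y = of_int g * of_int a * \<tau> + of_int (a * B + y)"
      using n1 unfolding T by (simp add: field_simps)
    thus ?thesis unfolding i2 by (simp add: algebra_simps)
  qed
  have arg: "(of_int (n1 * a) * T \<tau> + of_int y) / (of_int c1 * T \<tau> + of_int w) = 
     of_nat N * ((of_int a * \<tau> + of_int b) / (of_int c * \<tau> + of_int d))" for \<tau>
    unfolding num den gN by simp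
  show ?thesis
  proof (rule that[OF cop e0, of B])
    fix \<tau> assume tau: "Im \<tau> > 0"
    show "Im ((of_int g * \<tau> + of_int B) * of_int g / of_nat N) > 0" using ImT[OF tau] by (simp only: T_def)
    show "eta_sq (of_nat N * ((of_int a * \<tau> + of_int b) / (of_int c * \<tau> + of_int d))) =
        \<epsilon> * (of_int g / of_nat N) * (of_int c * \<tau> + of_int d) * eta_sq ((of_int g * \<tau> + of_int B) * of_int g / of_nat N)"
      using eta_sq_modular[OF e(2) wy ImT[OF tau]] g unfolding arg unfolding den unfolding T_def gN by simp
    fix j
    show "gen_eta N j ((of_int a * \<tau> + of_int b) / (of_int c * \<tau> + of_int d)) =
        - \<epsilon> * siegel_fn (of_nat j * of_int a / of_int g) (of_nat j * of_int y / of_nat N) ((of_int g * \<tau> + of_int B) * of_int g / of_nat N)"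
      using siegel_fn_modular[OF e(2) wy ImT[OF tau], of "of_nat j / of_nat N" 0] g n1 
      unfolding arg gen_eta_def unfolding T_def gN by (simp add: field_simps)
  qed
qed

lemma norm_e2pi_real: "z \<in> \<real> \<Longrightarrow> norm (e2pi z) = 1"
  by (auto elim!: Reals_cases)

text \<open>Replacing j a / g by its fractional part costs a constant and makes the exponents in
  both products nonnegative. With T = (g \<tau> + B) g / N, the number e2pi(T / g) is a root of
  unity times t^g for t = e2pi(\<tau> / N), so the exponents \<open>z1\<close>, \<open>z2\<close>,
  \<open>z3\<close> carry the factor g.\<close>

lemma siegel_fn_expansion:
  fixes g B a y :: int
  assumes N: "N > 0" and j: "0 < j" "j < N" and g: "g > 0" "g dvd int N"
    and cop: "coprime a g" "coprime y (int N div g)"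
  shows "\<exists>H. H holomorphic_on ball 0 1 \<and> (\<forall>t \<in> ball 0 1. H t \<noteq> 0) \<and>
     (\<forall>\<tau>. Im \<tau> > 0 \<longrightarrow> Im ((of_int g * \<tau> + of_int B) * of_int g / of_nat N) > 0 \<longrightarrow>
        siegel_fn (of_nat j * of_int a / of_int g) (of_nat j * of_int y / of_nat N) ((of_int g * \<tau> + of_int B) * of_int g / of_nat N) =
        e2pi (\<tau> / of_nat N * of_rat (of_int g * (of_int g / 2 * B2 (frac (of_int (int j * a) / of_int g))))) * H (e2pi (\<tau> / of_nat N)))"
proof -
  define y0 where "y0 = (int j * a) mod g"
  define n where "n = (int j * a) div g"
  define u0 where "u0 = complex_of_int y0 / of_int g"
  define v where "v = complex_of_nat j * of_int y / of_nat N"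
  define \<beta> where "\<beta> = u0\<^sup>2 - u0 + 1 / 6"
  have y0: "0 \<le> y0" "y0 < g" using g by (simp_all add: y0_def)
  have ja: "int j * a = n * g + y0" by (simp add: y0_def n_def)
  have "complex_of_nat j * of_int a = of_int n * of_int g + of_int y0"
    using ja by (metis of_int_add of_int_mult of_int_of_nat_eq)
  hence u: "of_nat j * of_int a / of_int g = u0 + of_int n" using g by (simp add: u0_def field_simps)
  have fr: "frac (of_int (int j * a) / of_int g) = (of_int y0 / of_int g :: rat)"
  proof -
    have "of_int (int j * a) / of_int g = (of_int n + of_int y0 / of_int g :: rat)"
      unfolding ja using g by (simp add: field_simps)
    moreover have "frac (of_int n + of_int y0 / of_int g :: rat) = of_int y0 / of_int g"
      using y0 g by (simp add: frac_unique_iff) 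
    ultimately show ?thesis by simp
  qed
  have \<beta>: "of_rat (B2 (frac (of_int (int j * a) / of_int g))) = \<beta>"
    unfolding fr \<beta>_def u0_def B2_def by (simp add: of_rat_add of_rat_diff of_rat_divide of_rat_power)
  define z1 where "z1 = nat y0 * nat g"
  define z2 where "z2 = nat (g - y0) * nat g"
  define z3 where "z3 = nat g * nat g"
  define \<zeta>1 where "\<zeta>1 = e2pi (of_int y0 * of_int B / of_nat N + v)"
  define \<zeta>2 where "\<zeta>2 = e2pi (of_int (g - y0) * of_int B / of_nat N - v)"
  define \<xi> where "\<xi> = e2pi (of_int g * of_int B / of_nat N)"
  define K where "K = - (exp (of_real pi * \<i> * (of_int n - of_int n * v)) * exp (of_real pi * \<i> * (u0 * v - v)) * 
      e2pi (of_int g * of_int B / of_nat N * (\<beta> / 2)))"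
  define H where "H = (\<lambda>t. K * (qpoch (\<zeta>1 * t ^ z1) (\<xi> * t ^ z3) * qpoch (\<zeta>2 * t ^ z2) (\<xi> * t ^ z3)))"
  have norms: "norm \<zeta>1 = 1" "norm \<zeta>2 = 1" "norm \<xi> = 1"
    unfolding \<zeta>1_def \<zeta>2_def \<xi>_def v_def
    by (intro norm_e2pi_real Reals_add Reals_diff Reals_mult Reals_divide Reals_of_int Reals_of_nat)+
  have z: "z2 > 0" "z3 > 0" using y0 g by (simp_all add: z2_def z3_def)
  have z1: "z1 > 0 \<or> \<zeta>1 \<noteq> 1"
  \<comment> \<open>For y0 = 0 the first product begins with 1 - \<open>\<zeta>1\<close>. If this
    were 0, then g would divide j and N / g would divide j / g, so N would divide j.\<close>
  proof (cases "y0 = 0")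
    case True
    have "\<zeta>1 \<noteq> 1"
    proof
      assume "\<zeta>1 = 1"
      hence "v \<in> \<int>" using True e2pi_eq_1_iff[of v] by (simp add: \<zeta>1_def)
      then obtain l :: int where "v = of_int l" by (auto elim: Ints_cases)
      hence "complex_of_int (int j * y) = of_int (l * int N)" using N by (simp add: v_def field_simps)
      hence jy: "int j * y = l * int N" by (subst (asm) of_int_eq_iff)
      have "g dvd int j * a" using True by (simp add: y0_def mod_eq_0_iff_dvd)
      hence "g dvd int j" using cop(1) by (metis coprime_commute coprime_dvd_mult_left_iff)
      then obtain j' where j': "int j = g * j'" by blast
      obtain n1 where n1: "int N = g * n1" using g(2) by blast
      have "n1 = int N div g" using n1 g by simp
      have "g * (j' * y) = g * (l * n1)" using jy j' n1 by (simp add: mult_ac)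
      hence "j' * y = l * n1" using g by simp
      hence "n1 dvd j' * y" by simp
      hence "n1 dvd j'" using cop(2) \<open>n1 = _\<close> by (metis coprime_commute coprime_dvd_mult_left_iff)
      hence "int N dvd int j" unfolding n1 j' by simp
      thus False using j by (auto dest: dvd_imp_le)
    qed
    thus ?thesis ..
  next
    case False
    thus ?thesis using y0 g by (simp add: z1_def)
  qed
  note q1 = qpoch_unit_ball[OF norms(1) norms(3) z(2) z1]
  have "z2 > 0 \<or> \<zeta>2 \<noteq> 1" using z by simp
  note q2 = qpoch_unit_ball[OF norms(2) norms(3) z(2) this]
  have Hh: "H holomorphic_on ball 0 1" unfolding H_def by (intro holomorphic_intros q1 q2)
  have Hn: "\<forall>t \<in> ball 0 1. H t \<noteq> 0" using q1(2) q2(2) by (simp add: H_def K_def)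
  have main: "siegel_fn (of_nat j * of_int a / of_int g) v T = 
        e2pi (\<tau> / of_nat N * of_rat (of_int g * (of_int g / 2 * B2 (frac (of_int (int j * a) / of_int g))))) * H (e2pi (\<tau> / of_nat N))"
    if "Im T > 0" and Tdef: "T = (of_int g * \<tau> + of_int B) * of_int g / of_nat N" for \<tau> T
  proof -
    have nz: "of_nat N \<noteq> (0::complex)" "of_int g \<noteq> (0::complex)" using N g by auto
    have g2: "of_nat z3 = (of_int g * of_int g :: complex)" "of_nat z1 = (of_int y0 * of_int g :: complex)"
      "of_nat z2 = (of_int (g - y0) * of_int g :: complex)"
      using y0 g by (simp_all add: z1_def z2_def z3_def)
    have T: "e2pi T = \<xi> * e2pi (\<tau> / of_nat N) ^ z3"
      unfolding \<xi>_def e2pi_power e2pi_add[symmetric] g2 Tdef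
      by (rule arg_cong[of _ _ e2pi]) (simp add: add_divide_distrib distrib_left distrib_right mult_ac)
    have uT: "u0 * T = of_int y0 * (of_int g * \<tau> + of_int B) / of_nat N"
      using nz by (simp add: u0_def Tdef)
    have moment1: "e2pi (u0 * T + v) = \<zeta>1 * e2pi (\<tau> / of_nat N) ^ z1"
      unfolding \<zeta>1_def e2pi_power e2pi_add[symmetric] g2 uT
      by (rule arg_cong[of _ _ e2pi]) (simp add: add_divide_distrib distrib_left distrib_right mult_ac)
    have moment2: "e2pi (T - (u0 * T + v)) = \<zeta>2 * e2pi (\<tau> / of_nat N) ^ z2"
      unfolding \<zeta>2_def e2pi_power e2pi_add[symmetric] g2 uT
      by (rule arg_cong[of _ _ e2pi]) (simp add: Tdef add_divide_distrib diff_divide_distrib distrib_left distrib_right left_diff_distrib right_diff_distrib mult_ac)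
    have T3: "e2pi (T * (\<beta> / 2)) = e2pi (of_int g * of_int B / of_nat N * (\<beta> / 2)) * 
       e2pi (\<tau> / of_nat N * (of_int g * (of_int g / 2 * \<beta>)))"
      unfolding e2pi_add[symmetric] Tdef
      by (rule arg_cong[of _ _ e2pi]) (simp add: add_divide_distrib distrib_left distrib_right mult_ac)
    have "of_rat (of_int g * (of_int g / 2 * B2 (frac (of_int (int j * a) / of_int g)))) = of_int g * (of_int g / 2 * \<beta>)"
      by (simp only: of_rat_mult of_rat_divide \<beta> of_rat_of_int_eq of_rat_numeral_eq)
    moreover have "siegel_fn (u0 + of_int n) v T = exp (of_real pi * \<i> * (of_int n - of_int n * v)) * siegel_fn u0 v T"
      using siegel_fn_shift[OF that(1), of u0 n v 0] by simp
    moreover have "siegel_fn u0 v T = - exp (of_real pi * \<i> * (u0 * v - v)) * (e2pi (of_int g * of_int B / of_nat N * (\<beta> / 2)) * 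
       e2pi (\<tau> / of_nat N * (of_int g * (of_int g / 2 * \<beta>)))) *
     (qpoch (\<zeta>1 * e2pi (\<tau> / of_nat N) ^ z1) (\<xi> * e2pi (\<tau> / of_nat N) ^ z3) * qpoch (\<zeta>2 * e2pi (\<tau> / of_nat N) ^ z2) (\<xi> * e2pi (\<tau> / of_nat N) ^ z3))"
      unfolding siegel_fn_qpoch \<beta>_def[symmetric] T moment1 moment2 T3 ..
    ultimately show ?thesis unfolding u H_def K_def by (simp only:) (simp add: mult_ac)
  qed
  show ?thesis using Hh Hn main unfolding v_def by blast
qed


text \<open>The power of c \<tau> + d produced by eta cancels the factor in \<open>slash\<close>.
  Without the congruences the exponent may be fractional, so the leading power is kept apart from
  the zero-free holomorphic part H.\<close>

lemma cusp_expansion: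
  fixes a b c d :: int
  assumes N: "N > 0" and det: "a * d - b * c = 1"
  shows "\<exists>H. H holomorphic_on ball 0 1 \<and> (\<forall>t \<in> ball 0 1. H t \<noteq> 0) \<and>
     (\<forall>\<tau>. Im \<tau> > 0 \<longrightarrow> slash k (eta_prod N (2 * k) x) (a, b, c, d) \<tau> =
        e2pi (\<tau> / of_nat N * of_rat (of_int (gcd c (int N)) * cusp_ord N k x (a, c))) * H (e2pi (\<tau> / of_nat N)))"
proof -
  define g where "g = gcd c (int N)"
  define M where "M = (\<lambda>\<tau>. (of_int a * \<tau> + of_int b) / (of_int c * \<tau> + complex_of_int d))"
  have g: "g > 0" "g dvd int N" "g dvd c" using N by (simp_all add: g_def gcd_pos_int)
  have cop: "coprime a g"
  proof (rule coprimeI)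
    fix r assume "r dvd a" "r dvd g"
    hence "r dvd a * d - b * c" using g(3) by (intro dvd_diff) (auto intro: dvd_trans)
    thus "is_unit r" using det by simp
  qed
  obtain y B :: int and \<epsilon> where y: "coprime y (int N div g)" and e: "\<epsilon> \<noteq> 0"
    and ImT: "\<And>\<tau>. Im \<tau> > 0 \<Longrightarrow> Im ((of_int g * \<tau> + of_int B) * of_int g / of_nat N) > 0"
    and et: "\<And>\<tau>. Im \<tau> > 0 \<Longrightarrow> eta_sq (of_nat N * M \<tau>) =
        \<epsilon> * (of_int g / of_nat N) * (of_int c * \<tau> + of_int d) * eta_sq ((of_int g * \<tau> + of_int B) * of_int g / of_nat N)"
    and gen_eta: "\<And>\<tau> j. Im \<tau> > 0 \<Longrightarrow> gen_eta N j (M \<tau>) =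
        - \<epsilon> * siegel_fn (of_nat j * of_int a / of_int g) (of_nat j * of_int y / of_nat N) ((of_int g * \<tau> + of_int B) * of_int g / of_nat N)"
    using cusp_setup[OF N det] unfolding g_def M_def by metis
  define T where "T = (\<lambda>\<tau>. (of_int g * \<tau> + of_int B) * of_int g / complex_of_nat N)"
  define r where "r = (\<lambda>j. of_int g * (of_int g / 2 * B2 (frac (of_int (int j * a) / of_int g))))"
  have "\<forall>j \<in> {1..N div 2}. \<exists>H. H holomorphic_on ball 0 1 \<and> (\<forall>t \<in> ball 0 1. H t \<noteq> 0) \<and>
     (\<forall>\<tau>. Im \<tau> > 0 \<longrightarrow> siegel_fn (of_nat j * of_int a / of_int g) (of_nat j * of_int y / of_nat N) (T \<tau>) =
        e2pi (\<tau> / of_nat N * of_rat (r j)) * H (e2pi (\<tau> / of_nat N)))"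
  proof
    fix j assume j: "j \<in> {1..N div 2}"
    hence "0 < j" "j < N" by auto
    from siegel_fn_expansion[OF N this g(1,2) cop y, of B] show "\<exists>H. H holomorphic_on ball 0 1 \<and> (\<forall>t \<in> ball 0 1. H t \<noteq> 0) \<and>
     (\<forall>\<tau>. Im \<tau> > 0 \<longrightarrow> siegel_fn (of_nat j * of_int a / of_int g) (of_nat j * of_int y / of_nat N) (T \<tau>) =
        e2pi (\<tau> / of_nat N * of_rat (r j)) * H (e2pi (\<tau> / of_nat N)))"
      unfolding T_def r_def using ImT by blast
  qed
  then obtain Hj where Hj: "\<And>j. j \<in> {1..N div 2} \<Longrightarrow> Hj j holomorphic_on ball 0 1"
      "\<And>j t. j \<in> {1..N div 2} \<Longrightarrow> t \<in> ball 0 1 \<Longrightarrow> Hj j t \<noteq> 0"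
      "\<And>j \<tau>. j \<in> {1..N div 2} \<Longrightarrow> Im \<tau> > 0 \<Longrightarrow> siegel_fn (of_nat j * of_int a / of_int g) (of_nat j * of_int y / of_nat N) (T \<tau>) =
        e2pi (\<tau> / of_nat N * of_rat (r j)) * Hj j (e2pi (\<tau> / of_nat N))"
    by metis
  define \<xi> where "\<xi> = e2pi (of_int g * of_int B / of_nat N)"
  define n where "n = nat g * nat g"
  define K where "K = \<epsilon> * (of_int g / of_nat N) * e2pi (of_int g * of_int B / of_nat N / 12)"
  define H0 where "H0 = (\<lambda>t. K * qpoch (\<xi> * t ^ n) (\<xi> * t ^ n) ^ 2)"
  have "norm \<xi> = 1" unfolding \<xi>_def
    by (intro norm_e2pi_real Reals_mult Reals_divide Reals_of_int Reals_of_nat)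
  moreover have n: "n > 0" using g by (simp add: n_def)
  ultimately have q: "(\<lambda>t. qpoch (\<xi> * t ^ n) (\<xi> * t ^ n)) holomorphic_on ball 0 1"
    "\<forall>t \<in> ball 0 1. qpoch (\<xi> * t ^ n) (\<xi> * t ^ n) \<noteq> 0"
    using qpoch_unit_ball[of \<xi> \<xi> n n] by blast+
  have H0: "H0 holomorphic_on ball 0 1" "\<forall>t \<in> ball 0 1. H0 t \<noteq> 0"
    using q e g N unfolding H0_def K_def by (auto intro!: holomorphic_intros)
  have eta_sq: "eta_sq (of_nat N * M \<tau>) = (of_int c * \<tau> + of_int d) * (e2pi (\<tau> / of_nat N * (of_int g * of_int g / 12)) * H0 (e2pi (\<tau> / of_nat N)))"
    if tau: "Im \<tau> > 0" for \<tau>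
  proof -
    have n': "of_nat n = (of_int g * of_int g :: complex)" using g by (simp add: n_def)
    have q1: "e2pi (T \<tau>) = \<xi> * e2pi (\<tau> / of_nat N) ^ n"
      unfolding \<xi>_def e2pi_power e2pi_add[symmetric] n' T_def
      by (rule arg_cong[of _ _ e2pi]) (simp add: add_divide_distrib distrib_left distrib_right mult_ac)
    have q2: "exp (of_real pi * \<i> * T \<tau> / 6) = e2pi (of_int g * of_int B / of_nat N / 12) * e2pi (\<tau> / of_nat N * (of_int g * of_int g / 12))"
      unfolding exp_add[symmetric] T_def
      by (rule arg_cong[of _ _ exp]) (simp add: add_divide_distrib distrib_left distrib_right mult_ac)
    have "eta_sq (of_nat N * M \<tau>) = \<epsilon> * (of_int g / of_nat N) * (of_int c * \<tau> + of_int d) * eta_sq (T \<tau>)"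
      using et[OF tau] unfolding T_def .
    also have "eta_sq (T \<tau>) = e2pi (of_int g * of_int B / of_nat N / 12) * e2pi (\<tau> / of_nat N * (of_int g * of_int g / 12)) *
        qpoch (\<xi> * e2pi (\<tau> / of_nat N) ^ n) (\<xi> * e2pi (\<tau> / of_nat N) ^ n) ^ 2"
      unfolding eta_sq_def q1 q2 ..
    finally show ?thesis unfolding H0_def K_def by (simp only: mult_ac)
  qed
  define H where "H = (\<lambda>t. H0 t ^ k * (\<Prod>j = 1..N div 2. (- \<epsilon> * Hj j t) powi vec_index x (j - 1)))"
  have Hh: "H holomorphic_on ball 0 1" unfolding H_def
    using Hj(2) e by (intro holomorphic_intros H0 Hj(1)) auto
  have Hn: "\<forall>t \<in> ball 0 1. H t \<noteq> 0" unfolding H_def using H0(2) Hj(2) e by (auto simp: prod_zero_iff)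
  have "slash k (eta_prod N (2 * k) x) (a, b, c, d) \<tau> =
        e2pi (\<tau> / of_nat N * of_rat (of_int (gcd c (int N)) * cusp_ord N k x (a, c))) * H (e2pi (\<tau> / of_nat N))"
    if tau: "Im \<tau> > 0" for \<tau>
  proof -
    define J where "J = of_int c * \<tau> + complex_of_int d"
    have J: "J \<noteq> 0" unfolding J_def by (rule moebius_denom_nonzero[OF det tau])
    define t where "t = e2pi (\<tau> / of_nat N)"
    have P: "(\<Prod>j = 1..N div 2. gen_eta N j (M \<tau>) powi vec_index x (j - 1)) = 
       (\<Prod>j = 1..N div 2. e2pi (\<tau> / of_nat N * of_rat (r j)) powi vec_index x (j - 1)) *
       (\<Prod>j = 1..N div 2. (- \<epsilon> * Hj j t) powi vec_index x (j - 1))"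
      unfolding prod.distrib[symmetric]
    proof (intro prod.cong refl)
      fix j assume j: "j \<in> {1..N div 2}"
      have "gen_eta N j (M \<tau>) = e2pi (\<tau> / of_nat N * of_rat (r j)) * (- \<epsilon> * Hj j t)"
        using gen_eta[OF tau, of j] Hj(3)[OF j tau] unfolding T_def t_def by simp
      thus "gen_eta N j (M \<tau>) powi vec_index x (j - 1) = 
         e2pi (\<tau> / of_nat N * of_rat (r j)) powi vec_index x (j - 1) * (- \<epsilon> * Hj j t) powi vec_index x (j - 1)"
        by (simp only: power_int_mult_distrib)
    qed
    have ordeq: "of_int (gcd c (int N)) * cusp_ord N k x (a, c) = of_nat k * (of_int g * of_int g / 12) + (\<Sum>j = 1..N div 2. of_int (vec_index x (j - 1)) * r j)"
      unfolding cusp_ord_def cusp_g_def prod.case fst_conv g_def[symmetric] r_def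
      by (simp add: distrib_left sum_distrib_left mult_ac)
    have ex: "\<tau> / of_nat N * of_rat (of_int (gcd c (int N)) * cusp_ord N k x (a, c)) = 
      of_nat k * (\<tau> / of_nat N * (of_int g * of_int g / 12)) + (\<Sum>j = 1..N div 2. of_int (vec_index x (j - 1)) * (\<tau> / of_nat N * of_rat (r j)))"
      unfolding ordeq by (simp add: of_rat_add of_rat_mult of_rat_divide of_rat_sum distrib_left sum_distrib_left mult_ac)
    have "e2pi (\<tau> / of_nat N * of_rat (of_int (gcd c (int N)) * cusp_ord N k x (a, c))) =
       e2pi (\<tau> / of_nat N * (of_int g * of_int g / 12)) ^ k * (\<Prod>j = 1..N div 2. e2pi (\<tau> / of_nat N * of_rat (r j)) powi vec_index x (j - 1))"
      unfolding ex e2pi_add e2pi_power exp_power_int sum_distrib_left exp_sum[OF finite_atLeastAtMost]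
      by (simp only: mult.left_commute)
    moreover have "slash k (eta_prod N (2 * k) x) (a, b, c, d) \<tau> = J powi (- int k) * eta_prod N (2 * k) x (M \<tau>)"
      unfolding slash_def M_def J_def by simp
    moreover have "J powi (- int k) * J ^ k = 1" using J by (simp add: power_int_minus)
    ultimately show ?thesis unfolding eta_prod_eq[OF N] eta_sq[OF tau] J_def[symmetric] P t_def[symmetric] H_def power_mult_distrib
      by simp
  qed
  thus ?thesis using Hh Hn by blast
qed

text \<open>Replacing z by z - g q changes z (z - g) by -2 g q z + g^2 q (q + 1), and q (q + 1) is
  even. The gain of a factor 2 over reduction modulo g is what integrality of the orders
  needs.\<close>

lemma mult_pred_mod_double:
  fixes z g :: int
  shows "2 * g dvd (z mod g) * (z mod g - g) - z * (z - g)"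
proof -
  define q where "q = z div g"
  have z: "z mod g = z - g * q" by (simp add: q_def minus_mult_div_eq_mod)
  have "(z mod g) * (z mod g - g) - z * (z - g) = 2 * g * (- q * z) + g * (g * (q * (q + 1)))"
    unfolding z by (simp add: algebra_simps)
  moreover have "2 * g dvd g * (g * (q * (q + 1)))"
  proof -
    have "2 dvd q * (q + 1)" by simp
    hence "g * 2 dvd g * (g * (q * (q + 1)))" by (intro mult_dvd_mono) auto
    thus ?thesis by (simp add: mult.commute)
  qed
  ultimately show ?thesis by (metis dvd_add dvd_triv_left)
qed

lemma frac_of_int_div_of_int:
  fixes z g :: int
  assumes "g > 0"
  shows "frac (of_int z / of_int g :: rat) = of_int (z mod g) / of_int g"
proof -
  have "(of_int z :: rat) = of_int (g * (z div g) + z mod g)" by simp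
  hence "(of_int z / of_int g :: rat) = of_int (z div g) + of_int (z mod g) / of_int g"
    using assms by (simp only: of_int_add of_int_mult) (simp add: field_simps)
  moreover have "frac (of_int (z div g) + of_int (z mod g) / of_int g :: rat) = of_int (z mod g) / of_int g"
    using assms by (simp add: frac_unique_iff)
  ultimately show ?thesis by simp
qed

text \<open>With y = j a mod g one has g/2 B_2(y/g) = y (y - g) / (2 g) + g / 12. The congruence
  modulo 12 deals with the terms g / 12; in the remaining ones y may be replaced by j a modulo 2 g,
  which yields a^2 \<open>moment2\<close> - g a \<open>moment1\<close>.\<close>

lemma cusp_ord_Ints:
  assumes N: "N > 0" and K: "12 dvd int k + moment0 N x" and moment2: "int (N * gcd 2 N) dvd moment2 N x"
  shows "cusp_ord N k x p \<in> \<int>"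
proof -
  define g where "g = cusp_g N p"
  define a where "a = fst p"
  have g: "g > 0" "g dvd int N" using N by (auto simp: g_def cusp_g_def gcd_pos_int split: prod.splits)
  define X where "X = (\<lambda>j. vec_index x (j - 1))"
  define y where "y = (\<lambda>j. (int j * a) mod g)"
  define Y where "Y = (\<Sum>j = 1..N div 2. X j * (y j * (y j - g)))"
  have "2 * g dvd Y - (\<Sum>j = 1..N div 2. X j * (int j * a * (int j * a - g)))"
    unfolding Y_def y_def sum_subtractf[symmetric] right_diff_distrib[symmetric, of "X _"]
    by (intro dvd_sum dvd_mult mult_pred_mod_double)
  moreover have "(\<Sum>j = 1..N div 2. X j * (int j * a * (int j * a - g))) = a\<^sup>2 * moment2 N x - g * a * moment1 N x"
    unfolding moment1_def moment2_def X_def sum_distrib_left sum_subtractf[symmetric]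
    by (intro sum.cong refl) (simp add: algebra_simps power2_eq_square)
  moreover have "2 * g dvd a\<^sup>2 * moment2 N x - g * a * moment1 N x"
  proof (cases "even N")
    case True
    hence "int N * 2 dvd moment2 N x" using moment2 by (simp add: gcd_nat.absorb1)
    moreover have "2 * g dvd int N * 2" using mult_dvd_mono[OF g(2), of 2 2] by (simp add: mult.commute)
    ultimately have 1: "2 * g dvd moment2 N x" by (rule dvd_trans[rotated])
    hence "even (moment2 N x)" by (metis dvd_mult_left)
    hence "even (moment1 N x)" by (simp add: moment_parity)
    hence "g * 2 dvd (g * a) * moment1 N x" by (intro mult_dvd_mono) auto
    thus ?thesis using 1 by (intro dvd_diff) (auto simp: mult.commute)
  next
    case False
    hence "gcd 2 N = 1" by (simp add: coprime_iff_gcd_eq_1[symmetric])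
    hence "g dvd moment2 N x" using moment2 g(2) by (auto intro: dvd_trans)
    hence 1: "g dvd a\<^sup>2 * moment2 N x - g * a * moment1 N x" by simp
    have "odd g" using False g(2) by (metis dvd_trans even_of_nat)
    hence 2: "2 dvd a\<^sup>2 * moment2 N x - g * a * moment1 N x" using moment_parity[of N x] by auto
    have "coprime 2 g" using \<open>odd g\<close> by simp
    thus ?thesis using 1 2 divides_mult by blast
  qed
  ultimately have "2 * g dvd (Y - (a\<^sup>2 * moment2 N x - g * a * moment1 N x)) + (a\<^sup>2 * moment2 N x - g * a * moment1 N x)"
    by (intro dvd_add) simp_all
  hence "2 * g dvd Y" by simp
  then obtain l where l: "Y = 2 * g * l" by blast
  obtain l' where l': "int k + moment0 N x = 12 * l'" using K by blast
  have "cusp_ord N k x p = of_int g * (of_nat k + of_int (moment0 N x)) / 12 + of_int Y / (2 * of_int g)"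
  proof -
    have y: "(int j * a) mod g = y j" for j by (simp add: y_def)
    have eq: "of_int (X j) * (of_int g / 2 * B2 (frac (of_int (int j * a) / of_int g))) =
       of_int g / 12 * of_int (X j) + of_int (X j * (y j * (y j - g))) / (2 * of_int g)" for j
      unfolding frac_of_int_div_of_int[OF g(1)] y B2_def using g(1)
      by (simp add: field_simps power2_eq_square)
    have "cusp_ord N k x p = of_int g * of_nat k / 12 + (\<Sum>j = 1..N div 2. of_int g / 12 * of_int (X j) + of_int (X j * (y j * (y j - g))) / (2 * of_int g))"
      unfolding cusp_ord_def g_def[symmetric] a_def[symmetric] using eq[unfolded X_def] unfolding X_def by (simp only:)
    also have "\<dots> = of_int g * of_nat k / 12 + (of_int g / 12 * of_int (moment0 N x) + of_int Y / (2 * of_int g))"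
      unfolding moment0_def Y_def X_def sum.distrib of_int_sum sum_distrib_left sum_divide_distrib ..
    finally show ?thesis by (simp add: field_simps)
  qed
  also have "(of_nat k + of_int (moment0 N x) :: rat) = of_int (12 * l')" unfolding l'[symmetric] by simp
  also have "of_int g * of_int (12 * l') / 12 + of_int Y / (2 * of_int g) = (of_int (g * l' + l) :: rat)"
    unfolding l using g(1) by simp
  finally show ?thesis by simp
qed

section \<open>Membership in L_N(k) in terms of congruences and orders\<close>

text \<open>On the imaginary axis a negative exponent would make the left side unbounded as t -> 0,
  whereas h / H tends to h(0) / H(0). Since r need not be an integer, no theory of poles
  applies.\<close>

lemma ord_nonneg_of_extension:
  fixes r :: real and N :: nat
  assumes N: "N > 0" and h: "h holomorphic_on ball 0 1"
    and H: "H holomorphic_on ball 0 1" "\<forall>t \<in> ball 0 1. H t \<noteq> 0"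
    and eq: "\<And>\<tau>. Im \<tau> > 0 \<Longrightarrow> e2pi (\<tau> / of_nat N * of_real r) * H (e2pi (\<tau> / of_nat N)) = h (e2pi (\<tau> / of_nat N))"
  shows "r \<ge> 0"
proof (rule ccontr)
  assume "\<not> r \<ge> 0"
  hence r: "- r > 0" by simp
  have ev: "exp (- s * r) = norm (h (of_real (exp (- s))) / H (of_real (exp (- s))))" if s: "s > 0" for s :: real
  proof -
    \<comment> \<open>Chosen so that e2pi(\<tau> / N) is the real number exp(-s).\<close>
    define \<tau> where "\<tau> = \<i> * of_nat N * of_real s / (2 * of_real pi)"
    have "\<tau> = \<i> * of_real (real N * s / (2 * pi))" by (simp add: \<tau>_def)
    hence tau: "Im \<tau> > 0" using N s by simp
    have "2 * of_real pi * \<i> * (\<tau> / of_nat N) = - of_real s" using N by (simp add: \<tau>_def field_simps)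
    hence t: "e2pi (\<tau> / of_nat N) = of_real (exp (- s))" by (simp add: exp_of_real[symmetric])
    have "2 * of_real pi * \<i> * (\<tau> / of_nat N * of_real r) = of_real (- s * r)" using N by (simp add: \<tau>_def field_simps)
    hence t': "e2pi (\<tau> / of_nat N * of_real r) = of_real (exp (- s * r))" by (simp only: exp_of_real)
    have "of_real (exp (- s)) \<in> ball (0 :: complex) 1" using s by simp
    hence "H (of_real (exp (- s))) \<noteq> 0" using H(2) by blast
    hence "complex_of_real (exp (- s * r)) = h (of_real (exp (- s))) / H (of_real (exp (- s)))"
      using eq[OF tau] unfolding t t' by (simp add: field_simps)
    thus ?thesis by (metis abs_exp_cancel norm_of_real)
  qed
  have "(\<lambda>t. h t / H t) holomorphic_on ball 0 1" using H h by (intro holomorphic_intros) auto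
  hence "isCont (\<lambda>t. h t / H t) 0"
    using holomorphic_on_imp_continuous_on continuous_on_eq_continuous_at[of "ball 0 1"] by force
  moreover have "((\<lambda>s. complex_of_real (exp (- s))) \<longlongrightarrow> 0) at_top"
    by (intro tendsto_of_real_iff[THEN iffD2, of _ 0, simplified] exp_at_bot[THEN filterlim_compose] filterlim_uminus_at_bot_at_top)
  ultimately have "((\<lambda>s. h (of_real (exp (- s))) / H (of_real (exp (- s)))) \<longlongrightarrow> h 0 / H 0) at_top"
    by (rule isCont_tendsto_compose)
  hence "((\<lambda>s. norm (h (of_real (exp (- s))) / H (of_real (exp (- s))))) \<longlongrightarrow> norm (h 0 / H 0)) at_top"
    by (rule tendsto_norm)
  moreover have "eventually (\<lambda>s. norm (h (of_real (exp (- s))) / H (of_real (exp (- s)))) = exp (- s * r)) at_top"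
    using eventually_gt_at_top[of 0] by eventually_elim (simp only: ev)
  ultimately have "((\<lambda>s. exp (- s * r)) \<longlongrightarrow> norm (h 0 / H 0)) at_top"
    by (rule Lim_transform_eventually)
  moreover have "filterlim (\<lambda>s. exp (- s * r)) at_top at_top"
  proof -
    have "filterlim (\<lambda>s. (- r) * s) at_top at_top"
      by (rule filterlim_tendsto_pos_mult_at_top[OF tendsto_const r filterlim_ident])
    hence "filterlim (\<lambda>s. exp ((- r) * s)) at_top at_top"
      by (rule filterlim_compose[OF exp_at_top])
    thus ?thesis by (simp add: mult.commute)
  qed
  ultimately show False
    using not_tendsto_and_filterlim_at_infinity[OF trivial_limit_at_top_linorder] filterlim_at_top_imp_at_infinity by blast
qed

text \<open>Every coprime pair is the first column of a matrix in SL2(Z), and the expansion at that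
  matrix depends on the pair through \<open>cusp_ord\<close> and a zero-free factor. For the
  converse the orders are integers by the congruences, so the leading power is a genuine monomial in
  t.\<close>

lemma L_set_iff:
  assumes N: "N > 0"
  shows "x \<in> L_set N k \<longleftrightarrow> x \<in> carrier_vec (N div 2) \<and>
     12 dvd int k + moment0 N x \<and> int (N * gcd 2 N) dvd moment2 N x \<and>
     (\<forall>p. coprime (fst p) (snd p) \<longrightarrow> cusp_ord N k x p \<ge> 0)"
proof -
  let ?f = "eta_prod N (2 * k) x"
  have arg: "2 * of_real pi * \<i> * \<tau> / of_nat N = 2 * of_real pi * \<i> * (\<tau> / of_nat N)" for \<tau> by simp
  have hol: "?f holomorphic_on upper_half_plane"
  proof -
    \<comment> \<open>The expansion at the identity matrix expresses the product itself through
      functions holomorphic on the half-plane.\<close>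
    obtain H where H: "H holomorphic_on ball 0 1"
      "\<And>\<tau>. Im \<tau> > 0 \<Longrightarrow> slash k ?f (1, 0, 0, 1) \<tau> =
        e2pi (\<tau> / of_nat N * of_rat (of_int (gcd 0 (int N)) * cusp_ord N k x (1, 0))) * H (e2pi (\<tau> / of_nat N))"
      using cusp_expansion[OF N, of 1 1 0 0 k x] by auto
    have "(\<lambda>\<tau>. e2pi (\<tau> / of_nat N * of_rat (of_int (gcd 0 (int N)) * cusp_ord N k x (1, 0))) * (H \<circ> (\<lambda>\<tau>. e2pi (\<tau> / of_nat N))) \<tau>)
       holomorphic_on upper_half_plane"
      by (intro holomorphic_intros holomorphic_on_compose_gen[OF _ H(1)])
         (use N in \<open>auto simp: upper_half_plane_def\<close>)
    thus ?thesis
      by (rule holomorphic_transform) (use H(2) in \<open>auto simp: upper_half_plane_def slash_def\<close>)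
  qed
  have nonneg: "cusp_ord N k x p \<ge> 0"
    if ext: "\<forall>\<gamma> \<in> SL2Z. \<exists>h. h holomorphic_on ball 0 1 \<and>
        (\<forall>\<tau> \<in> upper_half_plane. slash k ?f \<gamma> \<tau> = h (exp (2 * of_real pi * \<i> * \<tau> / of_nat N)))"
      and p: "coprime (fst p) (snd p)" for p
  proof -
    obtain a c where ac: "p = (a, c)" by (cases p)
    obtain u v where uv: "u * a + v * c = 1" using bezout_int[of a c] p ac by auto
    have det: "a * u - (- v) * c = 1" using uv by (simp add: algebra_simps)
    hence "(a, - v, c, u) \<in> SL2Z" by (simp add: SL2Z_def)
    then obtain h where h: "h holomorphic_on ball 0 1"
      "\<And>\<tau>. Im \<tau> > 0 \<Longrightarrow> slash k ?f (a, - v, c, u) \<tau> = h (e2pi (\<tau> / of_nat N))"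
      using ext unfolding upper_half_plane_def arg by blast
    obtain H where H: "H holomorphic_on ball 0 1" "\<forall>t \<in> ball 0 1. H t \<noteq> 0"
      "\<And>\<tau>. Im \<tau> > 0 \<Longrightarrow> slash k ?f (a, - v, c, u) \<tau> =
        e2pi (\<tau> / of_nat N * of_rat (of_int (gcd c (int N)) * cusp_ord N k x (a, c))) * H (e2pi (\<tau> / of_nat N))"
      using cusp_expansion[OF N det, of k x] by blast
    have "real_of_rat (of_int (gcd c (int N)) * cusp_ord N k x (a, c)) \<ge> 0"
    proof (rule ord_nonneg_of_extension[OF N h(1) H(1,2)])
      fix \<tau> assume tau: "Im \<tau> > 0"
      have "complex_of_real (real_of_rat q) = of_rat q" for q
        by (cases q) (simp add: of_rat_rat)
      thus "e2pi (\<tau> / of_nat N * of_real (real_of_rat (of_int (gcd c (int N)) * cusp_ord N k x (a, c)))) * H (e2pi (\<tau> / of_nat N)) = h (e2pi (\<tau> / of_nat N))"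
        using h(2)[OF tau] H(3)[OF tau] by simp
    qed
    hence "of_int (gcd c (int N)) * cusp_ord N k x (a, c) \<ge> 0" by (simp only: zero_le_of_rat_iff)
    moreover have "(of_int (gcd c (int N)) :: rat) > 0" using N by (simp add: gcd_pos_int)
    ultimately show ?thesis unfolding ac by (metis zero_le_mult_iff not_le)
  qed
  have ext: "\<exists>h. h holomorphic_on ball 0 1 \<and>
        (\<forall>\<tau> \<in> upper_half_plane. slash k ?f \<gamma> \<tau> = h (exp (2 * of_real pi * \<i> * \<tau> / of_nat N)))"
    if R: "12 dvd int k + moment0 N x" "int (N * gcd 2 N) dvd moment2 N x" 
      "\<And>p. coprime (fst p) (snd p) \<Longrightarrow> cusp_ord N k x p \<ge> 0" and gam: "\<gamma> \<in> SL2Z" for \<gamma>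
  proof -
    obtain a b c d where abcd: "\<gamma> = (a, b, c, d)" by (cases \<gamma>)
    have det: "a * d - b * c = 1" using gam by (simp add: abcd SL2Z_def)
    have cop: "coprime a c"
    proof (rule coprimeI)
      fix r assume "r dvd a" "r dvd c"
      hence "r dvd a * d - b * c" by (intro dvd_diff) auto
      thus "is_unit r" using det by simp
    qed
    obtain l where l: "cusp_ord N k x (a, c) = of_int l"
      using cusp_ord_Ints[OF N R(1,2), of "(a, c)"] by (auto elim: Ints_cases)
    have "l \<ge> 0" using R(3)[of "(a, c)"] cop l by simp
    define n where "n = nat (gcd c (int N) * l)"
    have n: "of_rat (of_int (gcd c (int N)) * cusp_ord N k x (a, c)) = complex_of_nat n"
      using \<open>l \<ge> 0\<close> by (simp add: l n_def of_rat_mult)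
    obtain H where H: "H holomorphic_on ball 0 1"
      "\<And>\<tau>. Im \<tau> > 0 \<Longrightarrow> slash k ?f (a, b, c, d) \<tau> =
        e2pi (\<tau> / of_nat N * of_nat n) * H (e2pi (\<tau> / of_nat N))"
      using cusp_expansion[OF N det, of k x] unfolding n by blast
    have "(\<lambda>t. t ^ n * H t) holomorphic_on ball 0 1" by (intro holomorphic_intros H)
    moreover have "slash k ?f \<gamma> \<tau> = e2pi (\<tau> / of_nat N) ^ n * H (e2pi (\<tau> / of_nat N))" if "Im \<tau> > 0" for \<tau>
      using H(2)[OF that] unfolding e2pi_power abcd by (simp only: mult.commute)
    ultimately show ?thesis unfolding upper_half_plane_def arg by blast
  qed
  have "(\<forall>\<gamma> \<in> SL2Z. \<exists>h. h holomorphic_on ball 0 1 \<and>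
        (\<forall>\<tau> \<in> upper_half_plane. slash k ?f \<gamma> \<tau> = h (exp (2 * of_real pi * \<i> * \<tau> / of_nat N)))) \<longleftrightarrow>
     (\<forall>p. coprime (fst p) (snd p) \<longrightarrow> cusp_ord N k x p \<ge> 0)" (is "?A \<longleftrightarrow> ?B")
    if R: "12 dvd int k + moment0 N x" "int (N * gcd 2 N) dvd moment2 N x"
  proof
    assume ?A
    thus ?B using nonneg by simp
  next
    assume ?B
    thus ?A by (intro ballI ext[OF R]) auto
  qed
  thus ?thesis
    unfolding L_set_def modular_forms_def mem_Collect_eq slash_Gamma1_invariant_iff[OF N]
    using hol by metis
qed

section \<open>Cusps and Galois orbits\<close>

text \<open>Let n be the product of the primes that divide M but not a. A prime divisor of M divides
  exactly one of a and c n, so it does not divide the sum.\<close>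

lemma coprime_add_mult_exists:
  fixes a c M :: int
  assumes "coprime a c" "M \<noteq> 0"
  shows "\<exists>n. coprime (a + c * n) M"
proof -
  define S where "S = {p. prime p \<and> p dvd M \<and> \<not> p dvd a}"
  have "finite S" by (rule finite_subset[OF _ finite_divisors_int[OF assms(2)]]) (auto simp: S_def)
  define n where "n = \<Prod>S"
  have "coprime (a + c * n) M"
  proof (rule ccontr)
    assume "\<not> coprime (a + c * n) M"
    hence "\<not> is_unit (gcd (a + c * n) M)" unfolding is_unit_gcd_iff coprime_iff_gcd_eq_1 .
    moreover have "gcd (a + c * n) M \<noteq> 0" using assms(2) by simp
    ultimately obtain p where "prime p" "p dvd gcd (a + c * n) M"
      using prime_divisor_exists by blast
    hence p: "prime p" "p dvd a + c * n" "p dvd M" by simp_all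
    show False
    proof (cases "p dvd a")
      case True
      hence "p dvd c * n" using p(2) by (simp add: dvd_add_right_iff)
      moreover have "\<not> p dvd c" using True assms(1) p(1) coprime_common_divisor[of a c p] not_prime_unit[of p] by blast
      ultimately have "p dvd n" using p(1) prime_dvd_mult_iff by blast
      then obtain r where "r \<in> S" "p dvd r"
        unfolding n_def using prime_dvd_prod_iff[OF \<open>finite S\<close> p(1), of "\<lambda>x. x"] by auto
      hence "prime r" unfolding S_def by blast
      hence "p = r" using p(1) \<open>p dvd r\<close> by (intro primes_dvd_imp_eq)
      thus False using True \<open>r \<in> S\<close> by (simp add: S_def)
    next
      case False
      hence "p \<in> S" using p by (simp add: S_def)
      hence "p dvd n" unfolding n_def using \<open>finite S\<close> by (rule dvd_prodI[rotated])
      hence "p dvd a" using p(2) by (simp add: dvd_add_left_iff)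
      thus False using False by simp
    qed
  qed
  thus ?thesis ..
qed

text \<open>The classical criterion for equivalence under Gamma_1(N): denominators agree modulo N
  and numerators modulo gcd(c, N), up to a common sign. It also makes sense for pairs that are not
  coprime, which is used for the index set of cusps.\<close>

definition cusp_rel :: "nat \<Rightarrow> int \<times> int \<Rightarrow> int \<times> int \<Rightarrow> bool" where
  "cusp_rel N p q \<longleftrightarrow> (\<exists>s \<in> {1, -1}. int N dvd snd q - s * snd p \<and> cusp_g N p dvd fst q - s * fst p)"

lemma cusp_g_pos: "N > 0 \<Longrightarrow> cusp_g N p > 0"
  by (cases p) (auto simp: cusp_g_def gcd_pos_int)

lemma cusp_g_dvd: "cusp_g N p dvd int N" "cusp_g N p dvd snd p"
  by (cases p, auto simp: cusp_g_def)+

lemma cusp_g_cong: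
  assumes "int N dvd snd q - s * snd p" "s \<in> {1, -1}"
  shows "cusp_g N q = cusp_g N p"
proof -
  obtain t where "snd q - s * snd p = int N * t" using assms(1) by blast
  hence t: "snd q = t * int N + s * snd p" by (simp add: algebra_simps)
  have "gcd (snd q) (int N) = gcd (s * snd p) (int N)"
    unfolding t by (subst (1 2) gcd.commute) (rule gcd_add_mult)
  also have "\<dots> = gcd (snd p) (int N)" using assms(2) by auto
  finally show ?thesis by (simp add: cusp_g_def case_prod_beta)
qed

lemma cusp_rel_g: "cusp_rel N p q \<Longrightarrow> cusp_g N q = cusp_g N p"
  unfolding cusp_rel_def using cusp_g_cong by blast

lemma cusp_rel_refl: "cusp_rel N p p"
  by (auto simp: cusp_rel_def intro!: bexI[of _ 1])

lemma cusp_rel_sym: "cusp_rel N p q \<Longrightarrow> cusp_rel N q p"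
proof -
  assume "cusp_rel N p q"
  then obtain s where s: "s \<in> {1, -1}" "int N dvd snd q - s * snd p" "cusp_g N p dvd fst q - s * fst p"
    unfolding cusp_rel_def by blast
  have g: "cusp_g N q = cusp_g N p" using s cusp_g_cong by blast
  have eq: "snd p - s * snd q = - s * (snd q - s * snd p)" "fst p - s * fst q = - s * (fst q - s * fst p)"
    using s(1) by (auto simp: algebra_simps)
  show ?thesis unfolding cusp_rel_def g
    by (rule bexI[of _ s]) (use s eq in \<open>auto intro: dvd_mult\<close>)
qed

lemma cusp_rel_trans:
  assumes "cusp_rel N p q" "cusp_rel N q r"
  shows "cusp_rel N p r"
proof -
  obtain s where s: "s \<in> {1, -1}" "int N dvd snd q - s * snd p" "cusp_g N p dvd fst q - s * fst p"
    using assms(1) unfolding cusp_rel_def by blast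
  obtain t where t: "t \<in> {1, -1}" "int N dvd snd r - t * snd q" "cusp_g N q dvd fst r - t * fst q"
    using assms(2) unfolding cusp_rel_def by blast
  have g: "cusp_g N q = cusp_g N p" using s cusp_g_cong by blast
  have eq: "snd r - t * s * snd p = (snd r - t * snd q) + t * (snd q - s * snd p)"
     "fst r - t * s * fst p = (fst r - t * fst q) + t * (fst q - s * fst p)" by (auto simp: algebra_simps)
  have "t * s \<in> {1, -1}" using s t by auto
  moreover have "int N dvd snd r - t * s * snd p" "cusp_g N p dvd fst r - t * s * fst p"
    unfolding eq using s t g by (auto intro!: dvd_add dvd_mult)
  ultimately show ?thesis unfolding cusp_rel_def by blast
qed

text \<open>Both columns are completed to matrices of determinant 1 that are congruent modulo N; the
  quotient of the two matrices is then congruent to the identity.\<close>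

lemma Gamma1_congruent_columns:
  fixes a c a' c' :: int
  assumes cop: "coprime a c" "coprime a' c'" and cong: "int N dvd a' - a" "int N dvd c' - c"
  shows "\<exists>(\<alpha>, \<beta>, \<gamma>, \<delta>) \<in> Gamma1 N. (a', c') = (\<alpha> * a + \<beta> * c, \<gamma> * a + \<delta> * c)"
proof -
  obtain d b0 where "d * a + b0 * c = 1" using bezout_int[of a c] cop(1) by auto
  then obtain b where det: "a * d - b * c = 1" by (intro that[of "- b0"]) (simp add: algebra_simps)
  obtain d1 b1 where "d1 * a' + b1 * c' = 1" using bezout_int[of a' c'] cop(2) by auto
  then obtain b' where det1: "a' * d1 - b' * c' = 1" by (intro that[of "- b1"]) (simp add: algebra_simps)
  \<comment> \<open>The upper right entry of M^(-1) M' for the two completions. Modulo N that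
    product is (1, t; 0, 1), so subtracting t times the first column of M' makes the second columns
    congruent.\<close>
  define t where "t = d * b' - b * d1"
  define b'' where "b'' = b' - t * a'"
  define d'' where "d'' = d1 - t * c'"
  have det2: "a' * d'' - b'' * c' = 1" using det1 by (simp add: b''_def d''_def algebra_simps)
  obtain A where A: "a' = a + int N * A" using cong(1) by (metis dvdE diff_eq_eq add.commute)
  obtain C where C: "c' = c + int N * C" using cong(2) by (metis dvdE diff_eq_eq add.commute)
  have k: "d * b'' - b * d'' = - (int N * t * (d * A - b * C))"
  proof -
    have "d * b'' - b * d'' = t - t * (d * a' - b * c')" by (simp add: b''_def d''_def t_def algebra_simps)
    also have "d * a' - b * c' = (a * d - b * c) + int N * (d * A - b * C)" unfolding A C by (simp add: algebra_simps)
    finally show ?thesis unfolding det by (simp add: algebra_simps)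
  qed
  have bb: "b'' = b + int N * (- a * t * (d * A - b * C) - b * (A * d'' - b'' * C))"
  proof -
    have "b'' - b = b'' * (a * d - b * c) - b * (a' * d'' - b'' * c')" unfolding det det2 by simp
    also have "\<dots> = a * (d * b'' - b * d'') - int N * b * (A * d'' - b'' * C)" unfolding A C by (simp add: algebra_simps)
    finally show ?thesis unfolding k by (simp add: algebra_simps)
  qed
  have dd: "d'' = d + int N * (- c * t * (d * A - b * C) - d * (A * d'' - b'' * C))"
  proof -
    have "d'' - d = d'' * (a * d - b * c) - d * (a' * d'' - b'' * c')" unfolding det det2 by simp
    also have "\<dots> = c * (d * b'' - b * d'') - int N * d * (A * d'' - b'' * C)" unfolding A C by (simp add: algebra_simps)
    finally show ?thesis unfolding k by (simp add: algebra_simps)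
  qed
  have eb: "int N dvd b'' - b" using bb by (metis add_diff_cancel_left' dvd_triv_left)
  have ed: "int N dvd d'' - d" using dd by (metis add_diff_cancel_left' dvd_triv_left)
  define \<alpha> where "\<alpha> = a' * d - b'' * c"
  define \<beta> where "\<beta> = b'' * a - a' * b"
  define \<gamma> where "\<gamma> = c' * d - d'' * c"
  define \<delta> where "\<delta> = d'' * a - c' * b"
  have "\<alpha> * \<delta> - \<beta> * \<gamma> = (a' * d'' - b'' * c') * (a * d - b * c)"
    by (simp add: \<alpha>_def \<beta>_def \<gamma>_def \<delta>_def algebra_simps)
  hence 1: "\<alpha> * \<delta> - \<beta> * \<gamma> = 1" by (simp add: det det2)
  have "\<alpha> - 1 = (a' - a) * d - (b'' - b) * c" using det by (simp add: \<alpha>_def algebra_simps)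
  hence 2: "int N dvd \<alpha> - 1" using cong eb by (simp add: dvd_diff)
  have "\<gamma> = (c' - c) * d - (d'' - d) * c" by (simp add: \<gamma>_def algebra_simps)
  hence 3: "int N dvd \<gamma>" using cong ed by (simp add: dvd_diff)
  have "\<delta> - 1 = (d'' - d) * a - (c' - c) * b" using det by (simp add: \<delta>_def algebra_simps)
  hence 4: "int N dvd \<delta> - 1" using cong ed by (simp add: dvd_diff)
  have "(\<alpha>, \<beta>, \<gamma>, \<delta>) \<in> Gamma1 N"
    using 1 2 3 4 by (simp add: Gamma1_def SL2Z_def cong_iff_dvd_diff)
  moreover have "\<alpha> * a + \<beta> * c = a' * (a * d - b * c)" "\<gamma> * a + \<delta> * c = c' * (a * d - b * c)"
    by (simp_all add: \<alpha>_def \<beta>_def \<gamma>_def \<delta>_def algebra_simps)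
  ultimately show ?thesis using det by (intro bexI[of _ "(\<alpha>, \<beta>, \<gamma>, \<delta>)"]) auto
qed

text \<open>Bezout for c and N provides an n such that a + n c is congruent to a' modulo N. The
  translation by n lies in Gamma_1(N) and reduces the claim to congruent columns.\<close>

lemma Gamma1_columns:
  fixes a c a' c' :: int
  assumes cop: "coprime a c" "coprime a' c'" and cong: "gcd c (int N) dvd a' - a" "int N dvd c' - c"
  shows "\<exists>(\<alpha>, \<beta>, \<gamma>, \<delta>) \<in> Gamma1 N. (a', c') = (\<alpha> * a + \<beta> * c, \<gamma> * a + \<delta> * c)"
proof -
  obtain x y where xy: "x * c + y * int N = gcd c (int N)" using bezout_int[of c "int N"] by auto
  obtain t where t: "a' - a = gcd c (int N) * t" using cong(1) by blast
  define n where "n = x * t"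
  have "gcd c (n * c + a) = gcd c a" by (rule gcd_add_mult)
  hence "coprime (a + n * c) c" using cop(1) by (simp add: coprime_iff_gcd_eq_1 gcd.commute add.commute)
  moreover have "a' - (a + n * c) = int N * (y * t)" using t xy[symmetric] by (simp add: n_def algebra_simps)
  hence "int N dvd a' - (a + n * c)" by simp
  ultimately obtain \<alpha> \<beta> \<gamma> \<delta> where m: "(\<alpha>, \<beta>, \<gamma>, \<delta>) \<in> Gamma1 N"
     "a' = \<alpha> * (a + n * c) + \<beta> * c" "c' = \<gamma> * (a + n * c) + \<delta> * c"
    using Gamma1_congruent_columns[OF _ cop(2) _ cong(2)] by blast
  have "int N dvd \<gamma>" "int N dvd \<delta> - 1" using m(1) by (auto simp: Gamma1_def cong_iff_dvd_diff)
  hence "int N dvd (\<delta> - 1) + \<gamma> * n" by (intro dvd_add) auto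
  hence "(\<alpha>, \<alpha> * n + \<beta>, \<gamma>, \<gamma> * n + \<delta>) \<in> Gamma1 N"
    using m(1) by (auto simp: Gamma1_def SL2Z_def cong_iff_dvd_diff algebra_simps)
  thus ?thesis using m(2,3) by (intro bexI[of _ "(\<alpha>, \<alpha> * n + \<beta>, \<gamma>, \<gamma> * n + \<delta>)"]) (auto simp: algebra_simps)
qed

lemma Gamma1_column_image:
  assumes "(\<alpha>, \<beta>, \<gamma>, \<delta>) \<in> Gamma1 N" "coprime a c" "a' = \<alpha> * a + \<beta> * c" "c' = \<gamma> * a + \<delta> * c"
  shows "coprime a' c' \<and> int N dvd c' - c \<and> gcd c (int N) dvd a' - a"
proof -
  have m: "\<alpha> * \<delta> - \<beta> * \<gamma> = 1" "int N dvd \<alpha> - 1" "int N dvd \<gamma>" "int N dvd \<delta> - 1"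
    using assms(1) by (auto simp: Gamma1_def SL2Z_def cong_iff_dvd_diff)
  have "coprime a' c'"
  proof (rule coprimeI)
    fix r assume r: "r dvd a'" "r dvd c'"
    have "\<delta> * a' - \<beta> * c' = (\<alpha> * \<delta> - \<beta> * \<gamma>) * a" "\<alpha> * c' - \<gamma> * a' = (\<alpha> * \<delta> - \<beta> * \<gamma>) * c"
      unfolding assms by (simp_all add: algebra_simps)
    hence "\<delta> * a' - \<beta> * c' = a" "\<alpha> * c' - \<gamma> * a' = c" using m by simp_all
    moreover have "r dvd \<delta> * a' - \<beta> * c'" "r dvd \<alpha> * c' - \<gamma> * a'" using r by simp_all
    ultimately show "is_unit r" using assms(2) coprime_common_divisor by metis
  qed
  moreover have "c' - c = \<gamma> * a + (\<delta> - 1) * c" unfolding assms by (simp add: algebra_simps)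
  hence "int N dvd c' - c" using m by simp
  moreover have "a' - a = (\<alpha> - 1) * a + \<beta> * c" unfolding assms by (simp add: algebra_simps)
  hence "gcd c (int N) dvd a' - a" using m(2) by (metis dvd_add dvd_mult dvd_mult2 dvd_trans gcd_dvd1 gcd_dvd2)
  ultimately show ?thesis by blast
qed

lemma mem_cusp_iff:
  assumes "coprime (fst p) (snd p)"
  shows "q \<in> cusp N p \<longleftrightarrow> coprime (fst q) (snd q) \<and> cusp_rel N p q"
proof -
  obtain a c where p: "p = (a, c)" by (cases p)
  obtain a' c' where q: "q = (a', c')" by (cases q)
  have cop: "coprime a c" using assms p by simp
  let ?P = "\<lambda>a' c'. \<exists>(\<alpha>, \<beta>, \<gamma>, \<delta>) \<in> Gamma1 N. (a', c') = (\<alpha> * a + \<beta> * c, \<gamma> * a + \<delta> * c)"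
  have P: "?P a' c' \<longleftrightarrow> coprime a' c' \<and> int N dvd c' - c \<and> gcd c (int N) dvd a' - a" for a' c'
  proof
    assume "?P a' c'"
    then obtain \<alpha> \<beta> \<gamma> \<delta> where m: "(\<alpha>, \<beta>, \<gamma>, \<delta>) \<in> Gamma1 N" 
      "a' = \<alpha> * a + \<beta> * c" "c' = \<gamma> * a + \<delta> * c" by blast
    show "coprime a' c' \<and> int N dvd c' - c \<and> gcd c (int N) dvd a' - a"
      by (rule Gamma1_column_image[OF m(1) cop m(2,3)])
  next
    assume "coprime a' c' \<and> int N dvd c' - c \<and> gcd c (int N) dvd a' - a"
    thus "?P a' c'" using Gamma1_columns[OF cop] by blast
  qed
  have neg: "((a', c') = (- x, - y)) = ((- a', - c') = (x, y))" for x y :: int by auto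
  have "q \<in> cusp N p \<longleftrightarrow> ?P a' c' \<or> ?P (- a') (- c')"
    unfolding p q cusp_def prod.case mem_Collect_eq neg by blast
  also have "\<dots> \<longleftrightarrow> coprime a' c' \<and> ((int N dvd c' - c \<and> gcd c (int N) dvd a' - a) \<or> (int N dvd - c' - c \<and> gcd c (int N) dvd - a' - a))"
    unfolding P by auto
  also have "- c' - c = - (c' + c)" by simp
  also have "- a' - a = - (a' + a)" by simp
  finally have "q \<in> cusp N p \<longleftrightarrow> coprime a' c' \<and> ((int N dvd c' - c \<and> gcd c (int N) dvd a' - a) \<or> (int N dvd c' + c \<and> gcd c (int N) dvd a' + a))"
    by (simp only: dvd_minus_iff)
  thus ?thesis by (auto simp: p q cusp_rel_def cusp_g_def)
qed

section \<open>Galois orbits\<close>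

text \<open>Units act on the denominator alone, so what survives of a cusp is g and the class of the
  numerator modulo g up to sign, that is, the pair labelling an orbit.\<close>

definition orb_rel :: "nat \<Rightarrow> int \<times> int \<Rightarrow> int \<times> int \<Rightarrow> bool" where
  "orb_rel N p q \<longleftrightarrow> cusp_g N q = cusp_g N p \<and> (\<exists>s \<in> {1, -1}. cusp_g N p dvd fst q - s * fst p)"

lemma cusp_rel_imp_orb_rel: "cusp_rel N p q \<Longrightarrow> orb_rel N p q"
  using cusp_rel_g unfolding orb_rel_def cusp_rel_def by blast

lemma orb_rel_sym: "orb_rel N p q \<Longrightarrow> orb_rel N q p"
proof -
  assume "orb_rel N p q"
  then obtain s where s: "s \<in> {1, -1}" "cusp_g N p dvd fst q - s * fst p" "cusp_g N q = cusp_g N p"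
    unfolding orb_rel_def by blast
  have "fst p - s * fst q = - s * (fst q - s * fst p)" using s(1) by (auto simp: algebra_simps)
  hence "cusp_g N p dvd fst p - s * fst q" using s by (simp only: dvd_mult)
  thus ?thesis unfolding orb_rel_def using s by auto
qed

lemma orb_rel_trans: 
  assumes "orb_rel N p q" "orb_rel N q r"
  shows "orb_rel N p r"
proof -
  obtain s where s: "s \<in> {1, -1}" "cusp_g N p dvd fst q - s * fst p" "cusp_g N q = cusp_g N p"
    using assms(1) unfolding orb_rel_def by blast
  obtain t where t: "t \<in> {1, -1}" "cusp_g N q dvd fst r - t * fst q" "cusp_g N r = cusp_g N q"
    using assms(2) unfolding orb_rel_def by blast
  have eq: "fst r - t * s * fst p = (fst r - t * fst q) + t * (fst q - s * fst p)" by (simp add: algebra_simps)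
  have "cusp_g N p dvd fst r - t * s * fst p"
    unfolding eq by (intro dvd_add[OF t(2)[unfolded s(3)]] dvd_mult s(2))
  moreover have "t * s \<in> {1, -1}" using s t by auto
  ultimately show ?thesis unfolding orb_rel_def using s t by metis
qed

lemma orb_rel_cong: "orb_rel N p p' \<Longrightarrow> orb_rel N p q \<longleftrightarrow> orb_rel N p' q"
  using orb_rel_trans[of N p' p q] orb_rel_trans[of N p p' q] orb_rel_sym[of N p p'] by blast

lemma cusp_eq_iff:
  assumes "coprime (fst p) (snd p)" "coprime (fst q) (snd q)"
  shows "cusp N p = cusp N q \<longleftrightarrow> cusp_rel N p q"
proof
  assume "cusp N p = cusp N q"
  thus "cusp_rel N p q" using mem_cusp_iff[OF assms(1)] mem_cusp_iff[OF assms(2)] assms cusp_rel_refl by blast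
next
  assume rel: "cusp_rel N p q"
  have "x \<in> cusp N p \<longleftrightarrow> x \<in> cusp N q" for x
    using rel mem_cusp_iff[OF assms(1)] mem_cusp_iff[OF assms(2)] cusp_rel_trans cusp_rel_sym by blast
  thus "cusp N p = cusp N q" by blast
qed

lemma cusp_g_mult_unit:
  assumes "coprime x (int N)"
  shows "cusp_g N (a, x * c) = cusp_g N (b, c)"
  unfolding cusp_g_def prod.case using assms by (intro gcd_mult_left_left_cancel) (simp add: coprime_commute)

text \<open>A representative of the cusp whose numerator is prime to x exists, so the union defining
  the action is nonempty; all its members coincide by \<open>cusp_eq_iff\<close>.\<close>

lemma galois_act_cusp:
  assumes p: "coprime (fst p) (snd p)" and x: "coprime x (int N)" and N: "N \<ge> 2"
  shows "\<exists>a. coprime a (x * snd p) \<and> cusp_g N p dvd a - fst p \<and> galois_act N x (cusp N p) = cusp N (a, x * snd p)"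
proof -
  have "x \<noteq> 0" using x N by auto
  obtain n where n: "coprime (fst p + snd p * n) x"
    using coprime_add_mult_exists[OF p \<open>x \<noteq> 0\<close>] by blast
  define a where "a = fst p + snd p * n"
  have an: "a = n * snd p + fst p" by (simp add: a_def)
  have "gcd (snd p) a = gcd (snd p) (fst p)" unfolding an by (rule gcd_add_mult)
  hence "coprime (snd p) a" using p by (simp only: coprime_iff_gcd_eq_1 gcd.commute[of "fst p"])
  hence "coprime a (snd p)" by (simp only: coprime_commute)
  hence ca: "coprime a (x * snd p)" using n by (simp add: a_def)
  have ga: "cusp_g N p dvd a - fst p" using cusp_g_dvd(2)[of N p] by (simp add: a_def)
  have "(a, snd p) \<in> cusp N p"
    unfolding mem_cusp_iff[OF p] cusp_rel_def fst_conv snd_conv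
    using \<open>coprime a (snd p)\<close> ga by (intro conjI bexI[of _ 1]) auto
  moreover have "cusp N (a', x * c') = cusp N (a, x * snd p)"
    if ac: "(a', c') \<in> cusp N p" "coprime a' (x * c')" for a' c'
  proof -
    obtain s where s: "s \<in> {1, -1}" "int N dvd c' - s * snd p" "cusp_g N p dvd a' - s * fst p"
      using ac(1) unfolding mem_cusp_iff[OF p] cusp_rel_def fst_conv snd_conv by blast
    have "cusp_rel N (a, x * snd p) (a', x * c')"
    proof -
      have eq1: "x * c' - s * (x * snd p) = x * (c' - s * snd p)" by (simp add: algebra_simps)
      have eq2: "a' - s * a = (a' - s * fst p) - s * (a - fst p)" by (simp add: algebra_simps)
      have "cusp_g N (a, x * snd p) = cusp_g N p" using cusp_g_mult_unit[OF x, of a "snd p" "fst p"] by simp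
      moreover have "int N dvd x * c' - s * (x * snd p)" unfolding eq1 by (rule dvd_mult[OF s(2)])
      moreover have "cusp_g N p dvd a' - s * a" unfolding eq2 by (rule dvd_diff[OF s(3) dvd_mult[OF ga]])
      ultimately have "int N dvd x * c' - s * (x * snd p)" "cusp_g N (a, x * snd p) dvd a' - s * a"
        by simp_all
      thus ?thesis unfolding cusp_rel_def using s(1) by auto
    qed
    hence "cusp N (a, x * snd p) = cusp N (a', x * c')"
      using cusp_eq_iff[of "(a, x * snd p)" "(a', x * c')"] ca ac(2) by simp
    thus ?thesis ..
  qed
  ultimately have "galois_act N x (cusp N p) = cusp N (a, x * snd p)"
    unfolding galois_act_def using ca by blast
  thus ?thesis using ca ga by blast
qed

lemma mem_Orb_iff:
  assumes p: "coprime (fst p) (snd p)" and N: "N \<ge> 2"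
  shows "D \<in> Orb N (cusp N p) \<longleftrightarrow> (\<exists>q. coprime (fst q) (snd q) \<and> D = cusp N q \<and> orb_rel N p q)"
proof
  assume "D \<in> Orb N (cusp N p)"
  then obtain x where x: "coprime x (int N)" "D = galois_act N x (cusp N p)" by (auto simp: Orb_def)
  obtain a where a: "coprime a (x * snd p)" "cusp_g N p dvd a - fst p" "D = cusp N (a, x * snd p)"
    using galois_act_cusp[OF p x(1) N] x(2) by auto
  have "orb_rel N p (a, x * snd p)"
    unfolding orb_rel_def using a(2) cusp_g_mult_unit[OF x(1), of a "snd p" "fst p"] by auto
  thus "\<exists>q. coprime (fst q) (snd q) \<and> D = cusp N q \<and> orb_rel N p q"
    using a by (intro exI[of _ "(a, x * snd p)"]) auto
next
  assume "\<exists>q. coprime (fst q) (snd q) \<and> D = cusp N q \<and> orb_rel N p q"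
  then obtain q where q: "coprime (fst q) (snd q)" "D = cusp N q" "orb_rel N p q" by blast
  obtain s where s: "s \<in> {1, -1}" "cusp_g N p dvd fst q - s * fst p" "cusp_g N q = cusp_g N p"
    using q(3) unfolding orb_rel_def by blast
  define g where "g = cusp_g N p"
  \<comment> \<open>The sign is moved into the denominator, where a unit can reach it.\<close>
  define c' where "c' = s * snd q"
  have g: "g > 0" using N by (simp add: g_def cusp_g_pos)
  obtain n1 where n1: "int N = g * n1" using cusp_g_dvd(1)[of N p] by (auto simp: g_def)
  obtain u where u: "snd p = g * u" using cusp_g_dvd(2)[of N p] by (auto simp: g_def)
  have "g dvd c'" unfolding c'_def g_def s(3)[symmetric] by (rule dvd_mult[OF cusp_g_dvd(2)])
  then obtain u' where u': "c' = g * u'" by blast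
  have "gcd (g * u) (g * n1) = g" unfolding u[symmetric] n1[symmetric] by (simp add: g_def cusp_g_def case_prod_beta)
  hence "coprime u n1" using g by (simp add: gcd_mult_left coprime_iff_gcd_eq_1)
  moreover have "gcd (g * u') (g * n1) = g"
  proof -
    have "gcd (g * u') (g * n1) = gcd (snd q) (int N)" unfolding u'[symmetric] n1[symmetric] c'_def using s(1) by auto
    thus ?thesis using s(3) unfolding g_def cusp_g_def by (simp add: case_prod_beta)
  qed
  hence "coprime u' n1" using g by (simp add: gcd_mult_left coprime_iff_gcd_eq_1)
  moreover obtain v w where vw: "v * u + w * n1 = 1" using bezout_int[of u n1] \<open>coprime u n1\<close> by auto
  have "coprime v n1"
  proof (rule coprimeI)
    fix r assume "r dvd v" "r dvd n1"
    hence "r dvd v * u + w * n1" by (intro dvd_add) auto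
    thus "is_unit r" using vw by simp
  qed
  ultimately have "coprime (u' * v) n1" by simp
  moreover have "int N \<noteq> 0" using N by simp
  ultimately obtain l where l: "coprime (u' * v + n1 * l) (int N)" using coprime_add_mult_exists by blast
  \<comment> \<open>Since v inverts u modulo n1 = N / g, this x sends the denominator of p to c'
    modulo N. The multiple of n1 makes x prime to N and not only to n1.\<close>
  define x where "x = u' * v + n1 * l"
  have "x * snd p - c' = g * (u' * (v * u + w * n1 - 1) + n1 * (l * u - u' * w))"
    unfolding x_def u u' by (simp add: algebra_simps)
  hence "x * snd p - c' = int N * (l * u - u' * w)" unfolding vw n1 by (simp add: algebra_simps)
  hence xc: "int N dvd x * snd p - s * snd q" unfolding c'_def by simp
  have xN: "coprime x (int N)" using l by (simp add: x_def)
  obtain a where a: "coprime a (x * snd p)" "cusp_g N p dvd a - fst p" 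
     "galois_act N x (cusp N p) = cusp N (a, x * snd p)"
    using galois_act_cusp[OF p xN N] by blast
  have eq: "a - s * fst q = (a - fst p) - s * (fst q - s * fst p)" using s(1) by (auto simp: algebra_simps)
  have "cusp_g N q dvd a - s * fst q" unfolding s(3) eq by (rule dvd_diff[OF a(2) dvd_mult[OF s(2)]])
  hence "cusp_rel N q (a, x * snd p)" unfolding cusp_rel_def using xc s(1) by auto
  hence "D = galois_act N x (cusp N p)" using cusp_eq_iff[of q "(a, x * snd p)"] q a by simp
  thus "D \<in> Orb N (cusp N p)" unfolding Orb_def using xN by blast
qed

section \<open>Counting cusps by pairs of residues\<close>

text \<open>Representatives of the admissible residues (c mod N, a mod gcd(c, N)) without the
  identification of opposite signs. Summing over them counts every cusp twice.\<close>

definition cusp_index :: "nat \<Rightarrow> (nat \<times> nat) set" where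
  "cusp_index N = (SIGMA c:{0<..N}. totatives (gcd c N))"

definition int_pair :: "nat \<times> nat \<Rightarrow> int \<times> int" where
  "int_pair x = (int (snd x), int (fst x))"

text \<open>The numerator is prime to gcd(c, N) but possibly not to c, so the pair itself need not
  represent a point; the cusp is described through \<open>cusp_rel\<close> instead.\<close>

definition index_cusp :: "nat \<Rightarrow> nat \<times> nat \<Rightarrow> (int \<times> int) set" where
  "index_cusp N x = {q. coprime (fst q) (snd q) \<and> cusp_rel N (int_pair x) q}"

lemma cusp_g_int_pair: "cusp_g N (int_pair x) = int (gcd (fst x) N)"
  by (simp add: cusp_g_def int_pair_def)

lemma finite_cusp_index: "finite (cusp_index N)"
  by (simp add: cusp_index_def)

lemma index_cusp_eq_iff:
  assumes "coprime (fst q) (snd q)"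
  shows "index_cusp N x = cusp N q \<longleftrightarrow> cusp_rel N (int_pair x) q"
proof
  assume "index_cusp N x = cusp N q"
  moreover have "q \<in> cusp N q" using mem_cusp_iff[OF assms] assms cusp_rel_refl by blast
  ultimately show "cusp_rel N (int_pair x) q" by (auto simp: index_cusp_def)
next
  assume "cusp_rel N (int_pair x) q"
  hence "y \<in> index_cusp N x \<longleftrightarrow> y \<in> cusp N q" for y unfolding index_cusp_def mem_Collect_eq
    using mem_cusp_iff[OF assms] cusp_rel_trans cusp_rel_sym by blast
  thus "index_cusp N x = cusp N q" by blast
qed

lemma cusp_index_lift:
  assumes "x \<in> cusp_index N" and N: "N > 0"
  obtains q where "coprime (fst q) (snd q)" "index_cusp N x = cusp N q" "cusp_rel N (int_pair x) q"
proof -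
  have x: "fst x > 0" "coprime (snd x) (gcd (fst x) N)"
    using assms by (auto simp: cusp_index_def in_totatives_iff)
  hence "coprime (int (snd x)) (int (gcd (fst x) N))" "int (fst x) \<noteq> 0" by auto
  then obtain n where n: "coprime (int (snd x) + int (gcd (fst x) N) * n) (int (fst x))"
    using coprime_add_mult_exists by blast
  define q where "q = (int (snd x) + int (gcd (fst x) N) * n, int (fst x))"
  have "cusp_rel N (int_pair x) q" unfolding cusp_rel_def cusp_g_int_pair by (auto simp: q_def int_pair_def)
  thus ?thesis using that[of q] index_cusp_eq_iff[of q N x] n by (simp add: q_def)
qed

text \<open>Residues are taken in {1, ..., M} rather than {0, ..., M - 1} to agree with the ranges
  of \<open>totatives\<close> and \<open>cusp_index\<close>.\<close>

definition pos_residue :: "nat \<Rightarrow> int \<Rightarrow> nat" where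
  "pos_residue M z = nat (int M - (- z) mod int M)"

lemma pos_residue: "M > 0 \<Longrightarrow> pos_residue M z \<in> {0<..M} \<and> int M dvd z - int (pos_residue M z)"
proof -
  assume M: "M > 0"
  hence b: "0 \<le> (- z) mod int M" "(- z) mod int M < int M" by simp_all
  have "int (pos_residue M z) = int M - (- z) mod int M" unfolding pos_residue_def using b by simp
  moreover have "int M dvd z - (int M - (- z) mod int M)"
  proof -
    have "z - (int M - (- z) mod int M) = int M * (-1 - (- z) div int M)"
      by (simp add: algebra_simps minus_mult_div_eq_mod[symmetric])
    thus ?thesis by simp
  qed
  ultimately show ?thesis using b by auto
qed

lemma pos_residue_unique:
  assumes "t \<in> {0<..M}" "int M dvd z - int t"
  shows "t = pos_residue M z"
proof -
  have M: "M > 0" using assms by auto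
  have "int M dvd (z - int t) - (z - int (pos_residue M z))" by (rule dvd_diff[OF assms(2) conjunct2[OF pos_residue[OF M]]])
  hence d: "int M dvd int (pos_residue M z) - int t" by simp
  have "\<bar>int (pos_residue M z) - int t\<bar> < int M" using pos_residue[OF M, of z] assms by auto
  hence "int (pos_residue M z) - int t = 0" using d by (metis dvd_imp_le_int not_le abs_of_nat)
  thus ?thesis by simp
qed

text \<open>The two preimages belong to the signs s = 1 and s = -1, with s times both coordinates of
  q reduced to standard residues.\<close>

lemma card_index_cusp_fibre:
  assumes q: "coprime (fst q) (snd q)" and N: "N \<ge> 5"
  shows "card {x \<in> cusp_index N. index_cusp N x = cusp N q} = 2"
proof -
  define g where "g = nat (cusp_g N q)"
  have g: "int g = cusp_g N q" "g > 0" using cusp_g_pos[of N q] N by (auto simp: g_def)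
  define e where "e = (\<lambda>s::int. (pos_residue N (s * snd q), pos_residue g (s * fst q)))"
  have N0: "N > 0" using N by simp
  have cg: "coprime (fst q) (int g)" using q cusp_g_dvd(2)[of N q] unfolding g(1)
    by (metis coprime_divisors dvd_refl)
  have mem: "e s \<in> cusp_index N \<and> index_cusp N (e s) = cusp N q" if s: "s \<in> {1, -1}" for s
  proof -
    have 1: "pos_residue N (s * snd q) \<in> {0<..N}" "int N dvd s * snd q - int (pos_residue N (s * snd q))" using pos_residue[OF N0] by auto
    have 2: "pos_residue g (s * fst q) \<in> {0<..g}" "int g dvd s * fst q - int (pos_residue g (s * fst q))" using pos_residue[OF g(2)] by auto
    have "snd q - s * int (pos_residue N (s * snd q)) = s * (s * snd q - int (pos_residue N (s * snd q)))" using s by (auto simp: algebra_simps)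
    hence 3: "int N dvd snd q - s * snd (int_pair (e s))" using 1 by (simp add: int_pair_def e_def)
    have ge: "cusp_g N (int_pair (e s)) = int g" using cusp_g_cong[OF 3 s] g by simp
    have "fst q - s * int (pos_residue g (s * fst q)) = s * (s * fst q - int (pos_residue g (s * fst q)))" using s by (auto simp: algebra_simps)
    hence 4: "cusp_g N (int_pair (e s)) dvd fst q - s * fst (int_pair (e s))" using 2 unfolding ge by (simp add: int_pair_def e_def)
    have rel: "cusp_rel N (int_pair (e s)) q" unfolding cusp_rel_def using 3 4 s by blast
    have gg: "gcd (pos_residue N (s * snd q)) N = g" using ge unfolding cusp_g_int_pair by (simp add: e_def)
    have "coprime (int (pos_residue g (s * fst q))) (int g)"
    proof (rule coprimeI)
      fix r assume r: "r dvd int (pos_residue g (s * fst q))" "r dvd int g"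
      hence "r dvd (s * fst q - int (pos_residue g (s * fst q))) + int (pos_residue g (s * fst q))" using 2 by (intro dvd_add) (auto intro: dvd_trans)
      hence "r dvd fst q" using s by auto
      thus "is_unit r" using r cg coprime_common_divisor by blast
    qed
    hence "pos_residue g (s * fst q) \<in> totatives g" using 2 by (auto simp: in_totatives_iff)
    hence "e s \<in> cusp_index N" unfolding cusp_index_def e_def using 1 gg by auto
    thus ?thesis using rel index_cusp_eq_iff[OF q] by blast
  qed
  have "{x \<in> cusp_index N. index_cusp N x = cusp N q} = {e 1, e (-1)}"
  proof
    show "{e 1, e (-1)} \<subseteq> {x \<in> cusp_index N. index_cusp N x = cusp N q}" using mem by auto
    show "{x \<in> cusp_index N. index_cusp N x = cusp N q} \<subseteq> {e 1, e (-1)}"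
    proof
      fix x assume x: "x \<in> {x \<in> cusp_index N. index_cusp N x = cusp N q}"
      hence rel: "cusp_rel N (int_pair x) q" using index_cusp_eq_iff[OF q, of N x] by blast
      hence "int g = int (gcd (fst x) N)" using cusp_rel_g[OF rel] g(1) cusp_g_int_pair[of N x] by linarith
      hence gx: "gcd (fst x) N = g" by (simp only: of_nat_eq_iff)
      obtain s where s: "s \<in> {1, -1}" "int N dvd snd q - s * int (fst x)" "int g dvd fst q - s * int (snd x)"
        using rel unfolding cusp_rel_def cusp_g_int_pair gx unfolding int_pair_def fst_conv snd_conv by blast
      have eqs: "s * snd q - int (fst x) = s * (snd q - s * int (fst x))" "s * fst q - int (snd x) = s * (fst q - s * int (snd x))"
        using s(1) by (auto simp: algebra_simps)
      have "int N dvd s * snd q - int (fst x)" "int g dvd s * fst q - int (snd x)"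
        unfolding eqs by (intro dvd_mult s)+
      moreover have "fst x \<in> {0<..N}" "snd x \<in> {0<..g}"
        using x gx totatives_subset[of g] by (auto simp: cusp_index_def)
      ultimately have "fst x = pos_residue N (s * snd q) \<and> snd x = pos_residue g (s * fst q)"
        by (intro conjI pos_residue_unique)
      hence "x = e s" unfolding e_def by (simp add: prod_eq_iff)
      thus "x \<in> {e 1, e (-1)}" using s(1) by auto
    qed
  qed
  \<comment> \<open>Equality would give N | 2 g and g | 2, hence N <= 4.\<close>
  moreover have "e 1 \<noteq> e (-1)"
  proof
    assume "e 1 = e (-1)"
    hence eq: "pos_residue N (1 * snd q) = pos_residue N ((-1) * snd q)" "pos_residue g (1 * fst q) = pos_residue g ((-1) * fst q)" by (simp_all only: e_def prod.inject)
    have "int N dvd (1 * snd q - int (pos_residue N (1 * snd q))) - ((-1) * snd q - int (pos_residue N ((-1) * snd q)))"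
      by (intro dvd_diff conjunct2[OF pos_residue[OF N0]])
    hence "int N dvd 2 * snd q" unfolding eq by simp
    moreover have "int N dvd 2 * int N" by simp
    ultimately have "int N dvd gcd (2 * snd q) (2 * int N)" by (rule gcd_greatest)
    hence Ng: "int N dvd 2 * int g" unfolding g(1) cusp_g_def by (simp add: gcd_mult_left case_prod_beta)
    have "int g dvd (1 * fst q - int (pos_residue g (1 * fst q))) - ((-1) * fst q - int (pos_residue g ((-1) * fst q)))"
      by (intro dvd_diff conjunct2[OF pos_residue[OF g(2)]])
    hence "int g dvd 2 * fst q" unfolding eq by simp
    hence "int g dvd 2" using cg by (metis coprime_commute coprime_dvd_mult_left_iff)
    hence "int g \<le> 2" by (rule zdvd_imp_le) simp
    moreover have "int N \<le> 2 * int g" using Ng g(2) by (intro zdvd_imp_le) auto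
    ultimately show False using N by simp
  qed
  ultimately show ?thesis by simp
qed

text \<open>The hypothesis on G makes its value constant on each Galois orbit. The part of the index
  set lying over an orbit has twice as many elements as the orbit, which explains the division by
  2.\<close>

lemma sum_over_orbits:
  fixes G :: "int \<Rightarrow> int \<Rightarrow> rat"
  assumes N: "N \<ge> 5" and reps: "cusp_orbit_reps N cr"
    and G: "\<And>g a a' s. s \<in> {1, -1} \<Longrightarrow> g dvd a' - s * a \<Longrightarrow> G g a' = G g a"
  shows "(\<Sum>r = 0..N div 2. of_nat (card (Orb N (cusp N (cr r)))) * G (cusp_g N (cr r)) (fst (cr r))) =
     (\<Sum>(c, a) \<in> cusp_index N. G (int (gcd c N)) (int a)) / 2"
proof -
  have N0: "N > 0" "N \<ge> 2" using N by simp_all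
  let ?O = "\<lambda>r. Orb N (cusp N (cr r))"
  have cop: "coprime (fst (cr r)) (snd (cr r))" if "r \<in> {0..N div 2}" for r
    using reps that by (auto simp: cusp_orbit_reps_def)
  have bij: "bij_betw ?O {0..N div 2} (Orb N ` cusps N)"
    using reps by (auto simp: cusp_orbit_reps_def)
  have ex: "\<exists>r \<in> {0..N div 2}. index_cusp N x \<in> ?O r" if x: "x \<in> cusp_index N" for x
  proof -
    obtain q where q: "coprime (fst q) (snd q)" "index_cusp N x = cusp N q"
      using cusp_index_lift[OF x N0(1)] by metis
    have "cusp N q \<in> cusps N" unfolding cusps_def using q(1) by (cases q) auto
    hence "Orb N (cusp N q) \<in> ?O ` {0..N div 2}" using bij_betw_imp_surj_on[OF bij] by simp
    then obtain r where r: "r \<in> {0..N div 2}" "?O r = Orb N (cusp N q)" by fastforce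
    have "cusp N q \<in> Orb N (cusp N q)"
      unfolding mem_Orb_iff[OF q(1) N0(2)] using q(1) cusp_rel_imp_orb_rel[OF cusp_rel_refl] by blast
    thus ?thesis using r q by auto
  qed
  have uniq: "r = r'" if r: "r \<in> {0..N div 2}" and r': "r' \<in> {0..N div 2}" and D: "D \<in> ?O r" and D': "D \<in> ?O r'" for r r' D
  proof -
    obtain q where q: "coprime (fst q) (snd q)" "D = cusp N q" "orb_rel N (cr r) q"
      using D mem_Orb_iff[OF cop[OF r] N0(2)] by blast
    obtain q' where q': "coprime (fst q') (snd q')" "D = cusp N q'" "orb_rel N (cr r') q'"
      using D' mem_Orb_iff[OF cop[OF r'] N0(2)] by blast
    have "cusp N q = cusp N q'" using q(2) q'(2) by simp
    hence "orb_rel N q q'" by (intro cusp_rel_imp_orb_rel iffD1[OF cusp_eq_iff[OF q(1) q'(1)]])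
    hence rel: "orb_rel N (cr r) (cr r')"
      by (rule orb_rel_trans[OF orb_rel_trans[OF q(3)] orb_rel_sym[OF q'(3)]])
    have OO: "?O r = ?O r'"
      unfolding set_eq_iff mem_Orb_iff[OF cop[OF r] N0(2)] mem_Orb_iff[OF cop[OF r'] N0(2)]
      by (simp only: orb_rel_cong[OF rel] simp_thms)
    show ?thesis by (rule inj_onD[OF bij_betw_imp_inj_on[OF bij] OO r r'])
  qed
  have val: "G (int (gcd (fst x) N)) (int (snd x)) = G (cusp_g N (cr r)) (fst (cr r))"
    if x: "x \<in> cusp_index N" and r: "r \<in> {0..N div 2}" and xr: "index_cusp N x \<in> ?O r" for x r
  proof -
    obtain q where q: "coprime (fst q) (snd q)" "index_cusp N x = cusp N q" "orb_rel N (cr r) q"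
      using xr mem_Orb_iff[OF cop[OF r] N0(2)] by blast
    have "orb_rel N (int_pair x) q"
      by (rule cusp_rel_imp_orb_rel[OF iffD1[OF index_cusp_eq_iff[OF q(1)] q(2)]])
    hence "orb_rel N (cr r) (int_pair x)" by (rule orb_rel_trans[OF q(3) orb_rel_sym])
    then obtain s where s: "s \<in> {1, -1}" "cusp_g N (cr r) dvd fst (int_pair x) - s * fst (cr r)" 
       "cusp_g N (int_pair x) = cusp_g N (cr r)" unfolding orb_rel_def by blast
    have "G (cusp_g N (cr r)) (fst (int_pair x)) = G (cusp_g N (cr r)) (fst (cr r))" by (rule G[OF s(1,2)])
    thus ?thesis using s(3) unfolding cusp_g_int_pair by (simp add: int_pair_def)
  qed
  have card: "card {x \<in> cusp_index N. index_cusp N x \<in> ?O r} = 2 * card (?O r)" if r: "r \<in> {0..N div 2}" for r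
  proof -
    have fib: "card {x \<in> cusp_index N. index_cusp N x = D} = 2" if D: "D \<in> ?O r" for D
    proof -
      obtain q where q: "coprime (fst q) (snd q)" "D = cusp N q"
        using iffD1[OF mem_Orb_iff[OF cop[OF r] N0(2)]] D by blast
      show ?thesis unfolding q(2) by (rule card_index_cusp_fibre[OF q(1) N])
    qed
    have "?O r \<subseteq> index_cusp N ` cusp_index N"
    proof
      fix D assume "D \<in> ?O r"
      hence "card {x \<in> cusp_index N. index_cusp N x = D} = 2" by (rule fib)
      hence "{x \<in> cusp_index N. index_cusp N x = D} \<noteq> {}" by (metis card.empty zero_neq_numeral)
      thus "D \<in> index_cusp N ` cusp_index N" by blast
    qed
    hence fin: "finite (?O r)" by (rule finite_subset) (intro finite_imageI finite_cusp_index)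
    have "{x \<in> cusp_index N. index_cusp N x \<in> ?O r} = (\<Union>D \<in> ?O r. {x \<in> cusp_index N. index_cusp N x = D})" by blast
    also have "card \<dots> = (\<Sum>D \<in> ?O r. card {x \<in> cusp_index N. index_cusp N x = D})"
      by (rule card_UN_disjoint) (use fin finite_cusp_index in auto)
    also have "\<dots> = 2 * card (?O r)" using fib by simp
    finally show ?thesis .
  qed
  have "cusp_index N = (\<Union>r \<in> {0..N div 2}. {x \<in> cusp_index N. index_cusp N x \<in> ?O r})" using ex by blast
  hence "(\<Sum>(c, a) \<in> cusp_index N. G (int (gcd c N)) (int a)) = 
     (\<Sum>(c, a) \<in> (\<Union>r \<in> {0..N div 2}. {x \<in> cusp_index N. index_cusp N x \<in> ?O r}). G (int (gcd c N)) (int a))"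
    by (rule arg_cong)
  also have "\<dots> = (\<Sum>r = 0..N div 2. \<Sum>(c, a) \<in> {x \<in> cusp_index N. index_cusp N x \<in> ?O r}. G (int (gcd c N)) (int a))"
    by (rule sum.UNION_disjoint) (use finite_cusp_index uniq in auto)
  also have "\<dots> = (\<Sum>r = 0..N div 2. \<Sum>x \<in> {x \<in> cusp_index N. index_cusp N x \<in> ?O r}. G (cusp_g N (cr r)) (fst (cr r)))"
  proof (intro sum.cong refl)
    fix r x assume "r \<in> {0..N div 2}" "x \<in> {x \<in> cusp_index N. index_cusp N x \<in> ?O r}"
    thus "(case x of (c, a) \<Rightarrow> G (int (gcd c N)) (int a)) = G (cusp_g N (cr r)) (fst (cr r))"
      using val[of x r] unfolding case_prod_beta by blast
  qed
  also have "\<dots> = (\<Sum>r = 0..N div 2. 2 * (of_nat (card (?O r)) * G (cusp_g N (cr r)) (fst (cr r))))"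
    by (intro sum.cong refl) (simp add: card)
  finally show ?thesis by (simp add: sum_distrib_left[symmetric])
qed

lemma orbit_of_cusp:
  assumes N: "N \<ge> 5" and reps: "cusp_orbit_reps N cr" and p: "coprime (fst p) (snd p)"
  shows "\<exists>r \<le> N div 2. orb_rel N (cr r) p"
proof -
  have N0: "N \<ge> 2" using N by simp
  have cop: "coprime (fst (cr r)) (snd (cr r))" if "r \<in> {0..N div 2}" for r
    using reps that by (auto simp: cusp_orbit_reps_def)
  have bij: "bij_betw (\<lambda>r. Orb N (cusp N (cr r))) {0..N div 2} (Orb N ` cusps N)"
    using reps by (auto simp: cusp_orbit_reps_def)
  have "cusp N p \<in> cusps N" unfolding cusps_def using p by (cases p) auto
  hence "Orb N (cusp N p) \<in> (\<lambda>r. Orb N (cusp N (cr r))) ` {0..N div 2}"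
    using bij_betw_imp_surj_on[OF bij] by simp
  then obtain r where r: "r \<in> {0..N div 2}" "Orb N (cusp N (cr r)) = Orb N (cusp N p)" by fastforce
  have "cusp N p \<in> Orb N (cusp N p)"
    unfolding mem_Orb_iff[OF p N0] using p cusp_rel_imp_orb_rel[OF cusp_rel_refl] by blast
  then obtain q where q: "coprime (fst q) (snd q)" "cusp N p = cusp N q" "orb_rel N (cr r) q"
    unfolding r(2)[symmetric] mem_Orb_iff[OF cop[OF r(1)] N0] by blast
  have "cusp_rel N q p" using cusp_eq_iff[OF q(1) p, of N] q(2) by simp
  hence "orb_rel N q p" by (rule cusp_rel_imp_orb_rel)
  hence "orb_rel N (cr r) p" by (rule orb_rel_trans[OF q(3)])
  thus ?thesis using r(1) by auto
qed

text \<open>The orbit contains the cusp itself and is finite as part of the image of the index set.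
  Positive weights permit the order at the last representative to be solved for, and they bound the
  solutions v.\<close>

lemma card_Orb_pos:
  assumes N: "N \<ge> 5" and p: "coprime (fst p) (snd p)"
  shows "card (Orb N (cusp N p)) > 0"
proof -
  have N0: "N \<ge> 2" using N by simp
  have "Orb N (cusp N p) \<subseteq> index_cusp N ` cusp_index N"
  proof
    fix D assume "D \<in> Orb N (cusp N p)"
    then obtain q where "coprime (fst q) (snd q)" "D = cusp N q" unfolding mem_Orb_iff[OF p N0] by blast
    hence "card {x \<in> cusp_index N. index_cusp N x = D} = 2" using card_index_cusp_fibre[OF _ N, of q] by simp
    hence "{x \<in> cusp_index N. index_cusp N x = D} \<noteq> {}" by (metis card.empty zero_neq_numeral)
    thus "D \<in> index_cusp N ` cusp_index N" by blast
  qed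
  hence "finite (Orb N (cusp N p))" by (rule finite_subset) (intro finite_imageI finite_cusp_index)
  moreover have "cusp N p \<in> Orb N (cusp N p)"
    unfolding mem_Orb_iff[OF p N0] using p cusp_rel_imp_orb_rel[OF cusp_rel_refl] by blast
  ultimately show ?thesis by (auto simp: card_gt_0_iff)
qed

section \<open>Sums over the cusps\<close>

lemma B2_frac_uminus: "B2 (frac (- x)) = B2 (frac x)"
  by (auto simp: frac_neg B2_def power2_eq_square algebra_simps)

text \<open>B_2(1 - x) = B_2(x) absorbs the sign and the fractional part absorbs multiples of g, so
  the entries of A_N depend only on the orbit.\<close>

lemma B2_frac_cong:
  fixes g a a' s j :: int
  assumes s: "s \<in> {1, -1}" and d: "g dvd a' - s * a"
  shows "B2 (frac (of_int (j * a') / of_int g)) = B2 (frac (of_int (j * a) / of_int g))"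
proof -
  obtain t where "a' - s * a = g * t" using d by blast
  hence a': "a' = s * a + g * t" by simp
  have "frac (of_int (j * a') / of_int g :: rat) = frac (of_int s * (of_int (j * a) / of_int g))"
  proof (cases "g = 0")
    case False
    hence "(of_int (j * a') / of_int g :: rat) = of_int s * (of_int (j * a) / of_int g) + of_int (j * t)"
      unfolding a' by (simp add: field_simps)
    thus ?thesis by (simp add: frac_def)
  qed (simp add: a')
  thus ?thesis using s B2_frac_uminus[of "of_int (j * a) / of_int g"] by auto
qed

text \<open>The denominators are grouped by g = gcd(c, N), and \<open>totient (N div g)\<close> of
  them share a given g.\<close>

lemma sum_cusp_index:
  fixes G :: "int \<Rightarrow> int \<Rightarrow> rat"
  assumes N: "N > 0"
  shows "(\<Sum>(c, a) \<in> cusp_index N. G (int (gcd c N)) (int a)) =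
     (\<Sum>g | g dvd N. of_nat (totient (N div g)) * (\<Sum>a \<in> totatives g. G (int g) (int a)))"
proof -
  have "(\<Sum>(c, a) \<in> cusp_index N. G (int (gcd c N)) (int a)) =
     (\<Sum>c \<in> {0<..N}. \<Sum>a \<in> totatives (gcd c N). G (int (gcd c N)) (int a))"
    unfolding cusp_index_def by (subst sum.Sigma) auto
  also have "\<dots> = (\<Sum>g | g dvd N. \<Sum>c \<in> {c \<in> {0<..N}. gcd c N = g}. \<Sum>a \<in> totatives (gcd c N). G (int (gcd c N)) (int a))"
    by (rule sum.group[symmetric]) (use N in auto)
  also have "\<dots> = (\<Sum>g | g dvd N. \<Sum>c \<in> {c \<in> {0<..N}. gcd c N = g}. \<Sum>a \<in> totatives g. G (int g) (int a))"
    by (intro sum.cong refl) auto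
  also have "\<dots> = (\<Sum>g | g dvd N. of_nat (totient (N div g)) * (\<Sum>a \<in> totatives g. G (int g) (int a)))"
  proof (intro sum.cong refl)
    fix g assume "g \<in> {g. g dvd N}"
    hence "card {c \<in> {0<..N}. gcd c N = g} = totient (N div g)" using N by (intro card_gcd_eq_totient) auto
    thus "(\<Sum>c \<in> {c \<in> {0<..N}. gcd c N = g}. \<Sum>a \<in> totatives g. G (int g) (int a)) =
       of_nat (totient (N div g)) * (\<Sum>a \<in> totatives g. G (int g) (int a))"
      by (simp only: sum_constant)
  qed
  finally show ?thesis .
qed

section \<open>Divisor sums of values of the Bernoulli polynomial\<close>

definition B2_sum :: "nat \<Rightarrow> nat \<Rightarrow> rat" where
  "B2_sum j n = (\<Sum>a \<in> totatives n. B2 (frac (of_nat (j * a) / of_nat n)))"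

lemma sum_B2: 
  assumes "n > 0"
  shows "(\<Sum>s < n. B2 (of_nat s / of_nat n)) = 1 / (6 * of_nat n)"
proof -
  have 1: "(\<Sum>s < n. of_nat s :: rat) = of_nat n * (of_nat n - 1) / 2" for n
    by (induction n) (simp_all add: field_simps)
  have 2: "(\<Sum>s < n. (of_nat s :: rat)\<^sup>2) = of_nat n * (of_nat n - 1) * (2 * of_nat n - 1) / 6" for n
    by (induction n) (simp_all add: field_simps power2_eq_square)
  have "(\<Sum>s < n. B2 (of_nat s / of_nat n)) = 
     (\<Sum>s < n. (of_nat s)\<^sup>2) / (of_nat n)\<^sup>2 - (\<Sum>s < n. of_nat s) / of_nat n + of_nat n * (1 / 6)"
    unfolding B2_def by (simp add: sum.distrib sum_subtractf power_divide sum_divide_distrib)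
  also have "\<dots> = 1 / (6 * of_nat n)"
    unfolding 1 2 using assms by (simp add: field_simps power2_eq_square)
  finally show ?thesis .
qed

lemma frac_of_nat_div: 
  assumes "n > 0"
  shows "frac (of_nat t / of_nat n :: rat) = of_nat (t mod n) / of_nat n"
proof -
  have "(of_nat t :: rat) = of_nat (n * (t div n) + t mod n)" by simp
  hence "(of_nat t / of_nat n :: rat) = of_int (int (t div n)) + of_nat (t mod n) / of_nat n"
    using assms by (simp only: of_nat_add of_nat_mult) (simp add: field_simps)
  moreover have "frac (of_int (int (t div n)) + of_nat (t mod n) / of_nat n :: rat) = of_nat (t mod n) / of_nat n"
    using assms by (simp add: frac_unique_iff)
  ultimately show ?thesis by simp
qed

lemma sum_mod_perm:
  fixes f :: "nat \<Rightarrow> 'a :: comm_monoid_add"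
  assumes "coprime j n" "n > 0"
  shows "(\<Sum>t < n. f ((j * t) mod n)) = (\<Sum>t < n. f t)"
proof -
  have inj: "inj_on (\<lambda>t. (j * t) mod n) {..<n}"
  proof (rule inj_onI)
    fix s t assume st: "s \<in> {..<n}" "t \<in> {..<n}" "(j * s) mod n = (j * t) mod n"
    hence "[j * s = j * t] (mod n)" by (simp add: cong_def)
    hence "[s = t] (mod n)" using assms(1) by (simp add: cong_mult_lcancel_nat)
    thus "s = t" using st by (simp add: cong_def)
  qed
  have "(\<lambda>t. (j * t) mod n) ` {..<n} = {..<n}"
    by (rule endo_inj_surj[OF _ _ inj]) (use assms in auto)
  thus ?thesis using sum.reindex[OF inj, of f] by (simp add: o_def)
qed

lemma sum_mod_blocks:
  fixes f :: "nat \<Rightarrow> rat"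
  shows "(\<Sum>t < h * n. f (t mod n)) = of_nat h * (\<Sum>t < n. f t)"
proof (induction h)
  case (Suc h)
  have eq: "{..<Suc h * n} = {..<h * n} \<union> {h * n..<h * n + n}" by auto
  have "(\<Sum>t < Suc h * n. f (t mod n)) = (\<Sum>t < h * n. f (t mod n)) + (\<Sum>t = h * n..<h * n + n. f (t mod n))"
    unfolding eq by (rule sum.union_disjoint) auto
  also have "(\<Sum>t = h * n..<h * n + n. f (t mod n)) = (\<Sum>t < n. f ((t + h * n) mod n))"
    using sum.shift_bounds_nat_ivl[of "\<lambda>t. f (t mod n)" 0 "h * n" n] by (simp add: add.commute lessThan_atLeast0)
  also have "\<dots> = (\<Sum>t < n. f t)" by (intro sum.cong refl) simp
  finally show ?case using Suc by (simp add: algebra_simps)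
qed simp

text \<open>With h = gcd(j, N) and n = N / h, the multiples of j run h times through a full set of
  residues modulo n, and each run contributes 1 / (6 n).\<close>

lemma sum_B2_multiples:
  assumes N: "N > 0"
  shows "of_nat N * (\<Sum>t < N. B2 (frac (of_nat (j * t) / of_nat N))) = of_nat ((gcd j N)\<^sup>2) / 6"
proof -
  define h where "h = gcd j N"
  have h: "h > 0" using N by (simp add: h_def)
  have "h dvd N" "h dvd j" by (simp_all add: h_def)
  from \<open>h dvd N\<close> obtain n where n: "N = h * n" ..
  from \<open>h dvd j\<close> obtain j1 where j1: "j = h * j1" ..
  have n0: "n > 0" using N unfolding n by (cases "n = 0") simp_all
  have "h * gcd j1 n = gcd j N" unfolding n j1 by (rule gcd_mult_distrib_nat)
  also have "\<dots> = h * 1" unfolding h_def by simp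
  finally have "gcd j1 n = 1" using h by (simp only: mult_cancel1) simp
  hence cop: "coprime j1 n" by (simp only: coprime_iff_gcd_eq_1)
  define f where "f = (\<lambda>s. B2 (of_nat s / of_nat n))"
  have "B2 (frac (of_nat (j * t) / of_nat N)) = f ((j1 * (t mod n)) mod n)" for t
  proof -
    have "(of_nat (j * t) / of_nat N :: rat) = of_nat (j1 * t) / of_nat n"
      unfolding n j1 using h by simp
    thus ?thesis by (simp only: frac_of_nat_div[OF n0] f_def mod_mult_right_eq)
  qed
  hence "(\<Sum>t < N. B2 (frac (of_nat (j * t) / of_nat N))) = (\<Sum>t < h * n. f ((j1 * (t mod n)) mod n))"
    unfolding n by simp
  also have "\<dots> = of_nat h * (\<Sum>t < n. f ((j1 * t) mod n))" by (rule sum_mod_blocks)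
  also have "\<dots> = of_nat h * (1 / (6 * of_nat n))"
    unfolding sum_mod_perm[OF cop n0] unfolding f_def sum_B2[OF n0] ..
  finally show ?thesis unfolding h_def[symmetric] using n0 by (simp add: n power2_eq_square)
qed

text \<open>The fractions t / N are sorted by their denominators in lowest terms.\<close>

lemma sum_B2_sum_divisors:
  assumes N: "N > 0"
  shows "(\<Sum>g | g dvd N. B2_sum j g) = (\<Sum>t < N. B2 (frac (of_nat (j * t) / of_nat N)))"
proof -
  let ?f = "\<lambda>t. B2 (frac (of_nat (j * t) / of_nat N))"
  \<comment> \<open>The term t = 0 is exchanged for the equal term t = N, because the classification
    by gcd uses the range {1, ..., N}.\<close>
  have "(\<Sum>t < N. ?f t) = (\<Sum>t \<in> {0<..N}. ?f t)"
  proof -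
    have a: "{..<N} = insert 0 {0<..<N}" "{0<..N} = insert N {0<..<N}" using N by auto
    have "frac (of_nat j :: rat) = 0" by (simp add: frac_def)
    moreover have "of_nat (j * N) / of_nat N = (of_nat j :: rat)" using N by simp
    ultimately have "?f 0 = ?f N" by (simp only: mult_0_right of_nat_0 div_0 frac_of_int[of 0, unfolded of_int_0])
    thus ?thesis unfolding a by simp
  qed
  also have "\<dots> = (\<Sum>d | d dvd N. \<Sum>t \<in> {t \<in> {0<..N}. gcd t N = d}. ?f t)"
    by (rule sum.group[symmetric]) (use N in auto)
  also have "\<dots> = (\<Sum>d | d dvd N. B2_sum j (N div d))"
  proof (intro sum.cong refl)
    fix d assume "d \<in> {d. d dvd N}"
    hence d: "d dvd N" "d > 0" using N by (auto intro: dvd_pos_nat)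
    have "(\<Sum>t \<in> {t \<in> {0<..N}. gcd t N = d}. ?f t) = (\<Sum>a \<in> totatives (N div d). ?f (a * d))"
      by (rule sum.reindex_bij_betw[OF bij_betw_totatives_gcd_eq[OF d(1) N], symmetric])
    also have "\<dots> = B2_sum j (N div d)"
      unfolding B2_sum_def
    proof (intro sum.cong refl)
      fix a
      obtain e where e: "N = d * e" using d by blast
      show "?f (a * d) = B2 (frac (of_nat (j * a) / of_nat (N div d)))"
        unfolding e using d(2) by simp
    qed
    finally show "(\<Sum>t \<in> {t \<in> {0<..N}. gcd t N = d}. ?f t) = B2_sum j (N div d)" .
  qed
  also have "\<dots> = (\<Sum>g | g dvd N. B2_sum j g)"
    by (rule sum.reindex_bij_witness[of _ "\<lambda>d. N div d" "\<lambda>d. N div d"]) (use N in auto)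
  finally show ?thesis ..
qed

text \<open>The Dirichlet convolution of the totient function with g -> g \<open>B2_sum j g\<close>;
  up to a constant it is the total order of the j-th factor over all cusps.\<close>

definition cusp_B2_sum :: "nat \<Rightarrow> nat \<Rightarrow> rat" where
  "cusp_B2_sum j N = (\<Sum>g | g dvd N. of_nat (totient (N div g)) * (of_nat g * B2_sum j g))"

text \<open>Summation over divisors convolves the totient with the constant 1, which gives the
  identity function. What is left is N times the plain sum of the \<open>B2_sum j g\<close>,
  evaluated above.\<close>

lemma sum_cusp_B2_sum_divisors:
  assumes N: "N > 0"
  shows "(\<Sum>d | d dvd N. cusp_B2_sum j d) = of_nat ((gcd j N)\<^sup>2) / 6"
proof -
  have "(\<Sum>d | d dvd N. cusp_B2_sum j d) = 
    (\<Sum>(d, g) \<in> (SIGMA d:{d. d dvd N}. {g. g dvd d}). of_nat (totient (d div g)) * (of_nat g * B2_sum j g))"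
    unfolding cusp_B2_sum_def by (rule sum.Sigma) (use N in \<open>auto dest: dvd_pos_nat\<close>)
  also have "\<dots> = (\<Sum>(g, e) \<in> (SIGMA g:{g. g dvd N}. {e. e dvd N div g}). of_nat (totient e) * (of_nat g * B2_sum j g))"
  proof (rule sum.reindex_bij_witness[of _ "\<lambda>(g, e). (g * e, g)" "\<lambda>(d, g). (g, d div g)"])
    fix x assume x: "x \<in> (SIGMA d:{d. d dvd N}. {g. g dvd d})"
    obtain d g where dg: "x = (d, g)" by (cases x)
    hence d: "d dvd N" "g dvd d" using x by auto
    show "(case case x of (d, g) \<Rightarrow> (g, d div g) of (g, e) \<Rightarrow> (g * e, g)) = x" using d dg by simp
    show "(case x of (d, g) \<Rightarrow> (g, d div g)) \<in> (SIGMA g:{g. g dvd N}. {e. e dvd N div g})"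
      using d dg by (auto intro: dvd_trans div_dvd_div[THEN iffD2])
    show "(case case x of (d, g) \<Rightarrow> (g, d div g) of (g, e) \<Rightarrow> of_nat (totient e) * (of_nat g * B2_sum j g)) =
       (case x of (d, g) \<Rightarrow> of_nat (totient (d div g)) * (of_nat g * B2_sum j g))" by (simp add: dg)
  next
    fix y assume y: "y \<in> (SIGMA g:{g. g dvd N}. {e. e dvd N div g})"
    obtain g e where ge: "y = (g, e)" by (cases y)
    have g: "g dvd N" "e dvd N div g" "g > 0" using y ge N by (auto dest: dvd_pos_nat)
    show "(case case y of (g, e) \<Rightarrow> (g * e, g) of (d, g) \<Rightarrow> (g, d div g)) = y" using g ge by simp
    have "g * e dvd g * (N div g)" using g by (intro mult_dvd_mono) auto
    hence "g * e dvd N" using g by simp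
    thus "(case y of (g, e) \<Rightarrow> (g * e, g)) \<in> (SIGMA d:{d. d dvd N}. {g. g dvd d})" by (simp add: ge)
  qed
  also have "\<dots> = (\<Sum>g | g dvd N. \<Sum>e | e dvd N div g. of_nat (totient e) * (of_nat g * B2_sum j g))"
  proof (rule sum.Sigma[symmetric])
    show "finite {g. g dvd N}" using N by simp
    show "\<forall>g \<in> {g. g dvd N}. finite {e. e dvd N div g}"
    proof
      fix g assume "g \<in> {g. g dvd N}"
      then obtain e where "N = g * e" by blast
      hence "N div g > 0" using N by auto
      thus "finite {e. e dvd N div g}" by simp
    qed
  qed
  also have "\<dots> = (\<Sum>g | g dvd N. of_nat N * B2_sum j g)"
  proof (intro sum.cong refl)
    fix g assume "g \<in> {g. g dvd N}"
    then obtain e0 where e0: "N = g * e0" by auto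
    have "(\<Sum>e | e dvd N div g. of_nat (totient e) * (of_nat g * B2_sum j g)) = 
       of_nat (\<Sum>e | e dvd N div g. totient e) * (of_nat g * B2_sum j g)"
      by (simp add: sum_distrib_right)
    also have "\<dots> = of_nat N * B2_sum j g"
      unfolding totient_divisor_sum using e0 N by simp
    finally show "(\<Sum>e | e dvd N div g. of_nat (totient e) * (of_nat g * B2_sum j g)) = of_nat N * B2_sum j g" .
  qed
  also have "\<dots> = of_nat N * (\<Sum>t < N. B2 (frac (of_nat (j * t) / of_nat N)))"
    unfolding sum_distrib_left[symmetric] sum_B2_sum_divisors[OF N] ..
  finally show ?thesis unfolding sum_B2_multiples[OF N] .
qed

text \<open>
  By the preceding lemma the sum over the divisors of \<open>N\<close> depends only on \<open>gcd j N\<close>, so the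
  divisors of \<open>N\<close> that do not divide \<open>j\<close> contribute nothing in total.
\<close>

lemma cusp_B2_sum_eq_0:
  assumes "N > 0" "\<not> N dvd j"
  shows "cusp_B2_sum j N = 0"
  using assms
proof (induction N rule: less_induct)
  case (less N)
  define h where "h = gcd j N"
  have h: "h > 0" "h dvd N" "h dvd j" using less.prems by (auto simp: h_def)
  have "gcd j h = h" using h(3) by (simp add: gcd_nat.absorb2)
  hence "(\<Sum>d | d dvd N. cusp_B2_sum j d) = (\<Sum>d | d dvd h. cusp_B2_sum j d)"
    by (simp only: sum_cusp_B2_sum_divisors[OF less.prems(1)] sum_cusp_B2_sum_divisors[OF h(1)] h_def[symmetric])
  moreover have "(\<Sum>d | d dvd N. cusp_B2_sum j d) = (\<Sum>d \<in> {d. d dvd h} \<union> {N}. cusp_B2_sum j d)"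
  proof (rule sum.mono_neutral_right)
    show "\<forall>d \<in> {d. d dvd N} - ({d. d dvd h} \<union> {N}). cusp_B2_sum j d = 0"
    proof
      fix d assume d: "d \<in> {d. d dvd N} - ({d. d dvd h} \<union> {N})"
      hence "d < N" "d > 0" using less.prems(1) by (auto intro: dvd_pos_nat simp: dvd_imp_le le_neq_implies_less)
      moreover have "\<not> d dvd j" using d by (auto simp: h_def)
      ultimately show "cusp_B2_sum j d = 0" by (rule less.IH)
    qed
  qed (use less.prems h in \<open>auto intro: dvd_trans\<close>)
  moreover have "N \<notin> {d. d dvd h}" using less.prems(2) h(3) by (auto intro: dvd_trans)
  hence "(\<Sum>d \<in> {d. d dvd h} \<union> {N}. cusp_B2_sum j d) = cusp_B2_sum j N + (\<Sum>d | d dvd h. cusp_B2_sum j d)"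
    using h(1) by simp
  ultimately show ?case by simp
qed

lemma sum_orbits_g:
  assumes "N \<ge> 5" "cusp_orbit_reps N cr"
  shows "(\<Sum>r = 0..N div 2. of_nat (card (Orb N (cusp N (cr r)))) * of_int (cusp_g N (cr r))) =
     (\<Sum>e | e dvd N. rat_of_nat (e * totient e * totient (N div e))) / 2"
proof -
  have "(\<Sum>r = 0..N div 2. of_nat (card (Orb N (cusp N (cr r)))) * of_int (cusp_g N (cr r))) =
     (\<Sum>(c, a) \<in> cusp_index N. rat_of_int (int (gcd c N))) / 2"
    by (rule sum_over_orbits[OF assms, of "\<lambda>g a. of_int g"]) simp
  also have "(\<Sum>(c, a) \<in> cusp_index N. rat_of_int (int (gcd c N))) =
     (\<Sum>g | g dvd N. of_nat (totient (N div g)) * (\<Sum>a \<in> totatives g. of_int (int g)))"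
    by (rule sum_cusp_index) (use assms in auto)
  also have "\<dots> = (\<Sum>e | e dvd N. rat_of_nat (e * totient e * totient (N div e)))"
    by (intro sum.cong refl) (simp add: totient_def)
  finally show ?thesis .
qed

text \<open>The j-th factor is a function of weight 0 without zeros in the half-plane, so its orders
  sum to 0; here this comes from the arithmetic of divisor sums.\<close>

lemma sum_orbits_B2:
  assumes "N \<ge> 5" "cusp_orbit_reps N cr" and j: "0 < j" "j < N"
  shows "(\<Sum>r = 0..N div 2. of_nat (card (Orb N (cusp N (cr r)))) *
      (of_int (cusp_g N (cr r)) / 2 * B2 (frac (of_int (int j * fst (cr r)) / of_int (cusp_g N (cr r)))))) = 0"
proof -
  have "(\<Sum>r = 0..N div 2. of_nat (card (Orb N (cusp N (cr r)))) *
      (of_int (cusp_g N (cr r)) / 2 * B2 (frac (of_int (int j * fst (cr r)) / of_int (cusp_g N (cr r)))))) =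
     (\<Sum>(c, a) \<in> cusp_index N. of_int (int (gcd c N)) / 2 * B2 (frac (of_int (int j * int a) / of_int (int (gcd c N))))) / 2"
    by (rule sum_over_orbits[OF assms(1,2), of "\<lambda>g a. of_int g / 2 * B2 (frac (of_int (int j * a) / of_int g))"])
       (simp only: B2_frac_cong)
  also have "(\<Sum>(c, a) \<in> cusp_index N. of_int (int (gcd c N)) / 2 * B2 (frac (of_int (int j * int a) / of_int (int (gcd c N))))) =
     (\<Sum>g | g dvd N. of_nat (totient (N div g)) * (\<Sum>a \<in> totatives g. of_int (int g) / 2 * B2 (frac (of_int (int j * int a) / of_int (int g)))))"
    by (rule sum_cusp_index) (use assms in auto)
  also have "\<dots> = cusp_B2_sum j N / 2"
    unfolding cusp_B2_sum_def B2_sum_def sum_divide_distrib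
    by (intro sum.cong refl) (simp add: sum_distrib_left sum_divide_distrib)
  also have "cusp_B2_sum j N = 0"
    using j by (intro cusp_B2_sum_eq_0) (auto dest: dvd_imp_le)
  finally show ?thesis by simp
qed

section \<open>Invertibility of \<open>A\<^sub>N\<close>\<close>

lemma sum_cos_roots:
  fixes t :: int
  assumes N: "N > 0"
  shows "(\<Sum>s < N. cos (2 * pi * real s * of_int t / real N)) = (if int N dvd t then real N else 0)"
proof -
  define z where "z = cis (2 * pi * of_int t / real N)"
  have "cos (2 * pi * real s * of_int t / real N) = Re (z ^ s)" for s
    unfolding z_def Complex.DeMoivre by (simp add: mult_ac)
  hence eq: "(\<Sum>s < N. cos (2 * pi * real s * of_int t / real N)) = Re (\<Sum>s < N. z ^ s)" by simp
  have z1: "z = 1 \<longleftrightarrow> int N dvd t"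
  proof -
    have "z = e2pi (of_int t / of_nat N)" by (simp add: z_def cis_conv_exp mult_ac)
    hence "z = 1 \<longleftrightarrow> (of_int t / of_nat N :: complex) \<in> \<int>" by (simp only: e2pi_eq_1_iff)
    also have "\<dots> \<longleftrightarrow> int N dvd t"
    proof
      assume "(of_int t / of_nat N :: complex) \<in> \<int>"
      then obtain k :: int where "(of_int t / of_nat N :: complex) = of_int k" by (elim Ints_cases)
      hence "complex_of_int t = of_int (int N * k)" using N by (simp add: field_simps)
      hence "t = int N * k" by (subst (asm) of_int_eq_iff)
      thus "int N dvd t" by simp
    next
      assume "int N dvd t"
      then obtain k where "t = int N * k" ..
      hence "(of_int t / of_nat N :: complex) = of_int k" using N by simp
      thus "(of_int t / of_nat N :: complex) \<in> \<int>" by simp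
    qed
    finally show ?thesis .
  qed
  have zN: "z ^ N = 1"
  proof -
    have "z ^ N = cis (2 * pi * of_int t)" unfolding z_def Complex.DeMoivre using N by simp
    thus ?thesis by (simp add: cis_multiple_2pi)
  qed
  show ?thesis
  proof (cases "int N dvd t")
    case True
    thus ?thesis unfolding eq using z1 by simp
  next
    case False
    hence "z \<noteq> 1" using z1 by simp
    hence "(\<Sum>s < N. z ^ s) = 0" using zN by (simp add: sum_gp_strict)
    thus ?thesis unfolding eq using False by simp
  qed
qed

section \<open>The finite Fourier expansion of the periodic Bernoulli polynomial\<close>

text \<open>Found by second differences: on the cosine of frequency s they act as multiplication by
  -4 sin^2(pi s / N), and on B_2(t/N) they give a function whose coefficients for s > 0 all equal -2
  / N^2. The coefficient for s = 0 is the mean value.\<close>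

definition B2_coeff :: "nat \<Rightarrow> nat \<Rightarrow> real" where
  "B2_coeff N s = (if s = 0 then 1 / (6 * real N ^ 2) else 1 / (2 * real N ^ 2 * sin (pi * real s / real N) ^ 2))"

lemma cos_second_difference:
  fixes x t :: real
  shows "cos (x * (t + 2)) - 2 * cos (x * (t + 1)) + cos (x * t) = - 4 * sin (x / 2) ^ 2 * cos (x * (t + 1))"
proof -
  have "cos (x * (t + 2)) + cos (x * t) = 2 * cos (x * (t + 1)) * cos x"
    using cos_add[of "x * (t + 1)" x] cos_diff[of "x * (t + 1)" x] by (simp add: algebra_simps)
  moreover have "cos x = 1 - 2 * sin (x / 2) ^ 2" using cos_double_sin[of "x / 2"] by simp
  ultimately show ?thesis by (simp add: algebra_simps)
qed

lemma constant_if_second_difference_zero: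
  fixes \<delta> :: "nat \<Rightarrow> real"
  assumes d2: "\<And>t. \<delta> (t + 2) - 2 * \<delta> (t + 1) + \<delta> t = 0" and per: "\<delta> N = \<delta> 0" and N: "N > 0"
  shows "\<delta> t = \<delta> 0"
proof -
  have 1: "\<delta> (t + 1) - \<delta> t = \<delta> 1 - \<delta> 0" for t
  proof (induction t)
    case (Suc t)
    thus ?case using d2[of t] by simp
  qed simp
  have 2: "\<delta> t = \<delta> 0 + real t * (\<delta> 1 - \<delta> 0)" for t
  proof (induction t)
    case (Suc t)
    thus ?case using 1[of t] by (simp add: algebra_simps)
  qed simp
  have "\<delta> 1 - \<delta> 0 = 0" using 2[of N] per N by simp
  thus ?thesis using 2[of t] by simp
qed

definition B2_per :: "nat \<Rightarrow> nat \<Rightarrow> real" where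
  "B2_per N t = real_of_rat (B2 (of_nat (t mod N) / of_nat N))"

lemma B2_per_eq: "B2_per N t = (real (t mod N) / real N)\<^sup>2 - real (t mod N) / real N + 1 / 6"
  by (simp add: B2_per_def B2_def of_rat_add of_rat_diff of_rat_divide of_rat_power)

text \<open>Quadratic growth gives 2 / N^2. At multiples of N the periodic function has a corner,
  where its slope in t jumps by -2 / N.\<close>

lemma B2_per_second_difference:
  assumes N: "N \<ge> 2"
  shows "B2_per N (t + 2) - 2 * B2_per N (t + 1) + B2_per N t = 2 / real N ^ 2 - (if N dvd t + 1 then 2 / real N else 0)"
proof -
  define r where "r = t mod N"
  have r: "r < N" using N by (simp add: r_def)
  have m1: "(t + 1) mod N = (r + 1) mod N" "(t + 2) mod N = (r + 2) mod N" by (simp_all add: r_def mod_simps)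
  have dv: "N dvd t + 1 \<longleftrightarrow> r + 1 = N"
  proof -
    have "N dvd t + 1 \<longleftrightarrow> (r + 1) mod N = 0" using m1 by (simp add: dvd_eq_mod_eq_0)
    also have "\<dots> \<longleftrightarrow> r + 1 = N" using r N by (cases "r + 1 = N") auto
    finally show ?thesis .
  qed
  consider "r + 2 < N" | "r + 2 = N" | "r + 1 = N" using r by linarith
  thus ?thesis
  proof cases
    case 1
    thus ?thesis unfolding B2_per_eq m1 dv r_def[symmetric] using N by (simp add: field_simps power2_eq_square)
  next
    case 2
    hence m2: "(r + 1) mod N = r + 1" "(r + 2) mod N = 0" and rr: "real (r + 1) = real N - 1" "real r = real N - 2" and "r + 1 \<noteq> N" by auto
    show ?thesis unfolding B2_per_eq m1 dv r_def[symmetric] m2 rr using N \<open>r + 1 \<noteq> N\<close> by (simp add: field_simps power2_eq_square)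
  next
    case 3
    hence "(r + 2) mod N = (1 + N) mod N" by (intro arg_cong[of _ _ "\<lambda>x. x mod N"]) simp
    hence m2: "(r + 2) mod N = 1" using N by (simp only: mod_add_self2) simp
    have m3: "(r + 1) mod N = 0" and rr: "real r = real N - 1" using 3 by auto
    show ?thesis unfolding B2_per_eq m1 dv r_def[symmetric] m2 m3 rr using 3 N by (simp add: field_simps power2_eq_square)
  qed
qed

text \<open>Both sides have equal second differences, so their difference is affine and, being
  periodic, constant. Summation over one period shows that the constant is 0.\<close>

lemma B2_fourier:
  assumes N: "N \<ge> 2"
  shows "B2_per N t = (\<Sum>s < N. B2_coeff N s * cos (2 * pi * real s * real t / real N))"
proof -
  define C where "C = (\<lambda>t. \<Sum>s < N. B2_coeff N s * cos (2 * pi * real s * real t / real N))"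
  define \<delta> where "\<delta> = (\<lambda>t. B2_per N t - C t)"
  have N0: "N > 0" using N by simp
  have C2: "C (t + 2) - 2 * C (t + 1) + C t = 2 / real N ^ 2 - (if N dvd t + 1 then 2 / real N else 0)" for t
  proof -
    have "C (t + 2) - 2 * C (t + 1) + C t = (\<Sum>s < N. B2_coeff N s *
       (cos (2 * pi * real s / real N * (real t + 2)) - 2 * cos (2 * pi * real s / real N * (real t + 1)) + cos (2 * pi * real s / real N * real t)))"
      unfolding C_def by (simp add: sum_distrib_left sum_subtractf[symmetric] sum.distrib[symmetric] algebra_simps)
    also have "\<dots> = (\<Sum>s < N. - (2 / real N ^ 2) * cos (2 * pi * real s * of_int (int (t + 1)) / real N) + (if s = 0 then 2 / real N ^ 2 else 0))"
    proof (intro sum.cong refl)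
      fix s assume s: "s \<in> {..<N}"
      show "B2_coeff N s *
       (cos (2 * pi * real s / real N * (real t + 2)) - 2 * cos (2 * pi * real s / real N * (real t + 1)) + cos (2 * pi * real s / real N * real t)) =
       - (2 / real N ^ 2) * cos (2 * pi * real s * of_int (int (t + 1)) / real N) + (if s = 0 then 2 / real N ^ 2 else 0)"
      proof (cases "s = 0")
        case False
        have "0 < pi * real s / real N" "pi * real s / real N < pi" using s False by (auto simp: field_simps)
        hence "sin (pi * real s / real N) > 0" by (rule sin_gt_zero)
        hence "B2_coeff N s * (- 4 * sin (pi * real s / real N) ^ 2 * c) = - (2 / real N ^ 2) * c" for c
          using False by (simp add: B2_coeff_def field_simps)
        moreover have "2 * pi * real s / real N / 2 = pi * real s / real N" by simp
        moreover have "2 * pi * real s / real N * (real t + 1) = 2 * pi * real s * of_int (int (t + 1)) / real N" by (simp add: add.commute)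
        ultimately show ?thesis unfolding cos_second_difference using False by (simp only: if_False add_0_right)
      qed simp
    qed
    also have "\<dots> = - (2 / real N ^ 2) * (\<Sum>s < N. cos (2 * pi * real s * of_int (int (t + 1)) / real N)) + 2 / real N ^ 2"
      unfolding sum.distrib sum_distrib_left[symmetric] using N0 by simp
    also have "\<dots> = - (2 / real N ^ 2) * (if N dvd t + 1 then real N else 0) + 2 / real N ^ 2"
      unfolding sum_cos_roots[OF N0] int_dvd_int_iff ..
    finally show ?thesis using N0 by (simp add: power2_eq_square)
  qed
  have per: "\<delta> N = \<delta> 0"
  proof -
    have "cos (2 * pi * real s * real N / real N) = cos (2 * pi * real s * real 0 / real N)" for s
      using N0 cos_int_2pin[of "int s"] by simp
    hence "C N = C 0" unfolding C_def by (simp only:)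
    thus ?thesis unfolding \<delta>_def B2_per_def by simp
  qed
  have "\<delta> (t + 2) - 2 * \<delta> (t + 1) + \<delta> t = 0" for t
  proof -
    have "\<delta> (t + 2) - 2 * \<delta> (t + 1) + \<delta> t =
       (B2_per N (t + 2) - 2 * B2_per N (t + 1) + B2_per N t) - (C (t + 2) - 2 * C (t + 1) + C t)"
      unfolding \<delta>_def by simp
    thus ?thesis unfolding C2 B2_per_second_difference[OF N] by simp
  qed
  hence const: "\<delta> t = \<delta> 0" for t
    by (rule constant_if_second_difference_zero[OF _ per N0])
  have "(\<Sum>t < N. \<delta> t) = (\<Sum>t < N. \<delta> 0)" by (intro sum.cong refl const)
  hence "(\<Sum>t < N. \<delta> t) = real N * \<delta> 0" by simp
  moreover have "(\<Sum>t < N. \<delta> t) = 0"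
  proof -
    have "(\<Sum>t < N. B2_per N t) = real_of_rat (\<Sum>t < N. B2 (of_nat t / of_nat N))"
      unfolding B2_per_def by (simp add: of_rat_sum)
    also have "\<dots> = 1 / (6 * real N)" unfolding sum_B2[OF N0] by (simp add: of_rat_divide of_rat_mult)
    finally have 1: "(\<Sum>t < N. B2_per N t) = 1 / (6 * real N)" .
    have "(\<Sum>t < N. C t) = (\<Sum>s < N. B2_coeff N s * (\<Sum>t < N. cos (2 * pi * real s * real t / real N)))"
      unfolding C_def sum_distrib_left by (rule sum.swap)
    also have "\<dots> = (\<Sum>s < N. if s = 0 then 1 / (6 * real N) else 0)"
    proof (intro sum.cong refl)
      fix s assume s: "s \<in> {..<N}"
      have "(\<Sum>t < N. cos (2 * pi * real s * real t / real N)) = (\<Sum>t < N. cos (2 * pi * real t * of_int (int s) / real N))"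
        by (simp add: mult_ac)
      also have "\<dots> = (if s = 0 then real N else 0)"
        unfolding sum_cos_roots[OF N0] using s by (auto dest: dvd_imp_le)
      finally show "B2_coeff N s * (\<Sum>t < N. cos (2 * pi * real s * real t / real N)) = (if s = 0 then 1 / (6 * real N) else 0)"
        using N0 by (simp add: B2_coeff_def power2_eq_square)
    qed
    also have "\<dots> = 1 / (6 * real N)" using N0 by simp
    finally show ?thesis unfolding \<delta>_def sum_subtractf 1 by simp
  qed
  ultimately have "\<delta> 0 = 0" using N0 by simp
  hence "\<delta> t = 0" using const[of t] by simp
  thus ?thesis by (simp add: \<delta>_def C_def)
qed


text \<open>The Taylor bound for the sine at pi / 6, where its value is 1/2, keeps pi / 6 below a
  rational number.\<close>

lemma pi_squared_less_12: "pi\<^sup>2 < 12"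
proof -
  have "\<bar>sin (pi / 6) - (\<Sum>i < 5. sin_coeff i * (pi / 6) ^ i)\<bar> \<le> inverse (fact 5) * \<bar>pi / 6\<bar> ^ 5"
    by (rule Maclaurin_sin_bound)
  moreover have "{..<5 :: nat} = {0, 1, 2, 3, 4}" by auto
  hence "(\<Sum>i < 5. sin_coeff i * (pi / 6) ^ i) = pi / 6 - (pi / 6) ^ 3 / 6"
    by (simp add: sin_coeff_def fact_numeral)
  moreover have "inverse (fact 5) * \<bar>pi / 6\<bar> ^ 5 = (pi / 6) ^ 5 / 120"
    by (simp add: fact_numeral)
  ultimately have "pi / 6 - (pi / 6) ^ 3 / 6 - (pi / 6) ^ 5 / 120 \<le> 1 / 2"
    using sin_30 by (simp only: abs_le_iff) linarith
  define x where "x = pi / 6"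
  have x: "0 < x" "x < 2 / 3" using pi_less_4 by (simp_all add: x_def)
  have le: "x - x ^ 3 / 6 - x ^ 5 / 120 \<le> 1 / 2" unfolding x_def by fact
  \<comment> \<open>The bound must lie below sqrt 12 / 6 = 0.57735..., and 0.577 still
    suffices.\<close>
  have "x < 577 / 1000"
  proof (rule ccontr)
    assume "\<not> x < 577 / 1000"
    hence x1: "577 / 1000 \<le> x" by simp
    have "x ^ 2 \<le> (2 / 3) ^ 2" using x by (intro power_mono) auto
    moreover have "x ^ 4 \<le> (2 / 3) ^ 4" using x by (intro power_mono) auto
    ultimately have "1 - x ^ 2 / 6 - x ^ 4 / 120 \<ge> 1 - (2 / 3) ^ 2 / 6 - (2 / 3) ^ 4 / 120" by simp
    hence "x * (1 - x ^ 2 / 6 - x ^ 4 / 120) \<ge> 577 / 1000 * (1 - (2 / 3) ^ 2 / 6 - (2 / 3) ^ 4 / 120)"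
      using x1 by (intro mult_mono) (auto simp: power_numeral_reduce)
    moreover have "x * (1 - x ^ 2 / 6 - x ^ 4 / 120) = x - x ^ 3 / 6 - x ^ 5 / 120"
      by (simp add: algebra_simps power_numeral_reduce)
    ultimately show False using le by (simp add: power_numeral_reduce)
  qed
  hence "pi < 3.4620" by (simp add: x_def)
  hence "pi\<^sup>2 < 3.4620\<^sup>2" by (intro power_strict_mono) auto
  also have "(3.4620 :: real)\<^sup>2 < 12" by (simp add: power2_eq_square)
  finally show ?thesis .
qed


lemma B2_coeff_nonneg: "B2_coeff N s \<ge> 0"
  by (simp add: B2_coeff_def)

text \<open>The inequality sin x <= x reduces the claim, uniformly in N, to pi^2 < 12.\<close>

lemma B2_coeff_1:
  assumes "N \<ge> 2"
  shows "4 * B2_coeff N 1 > 1 / 6"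
proof -
  have N: "real N > 0" using assms by simp
  have s: "0 < sin (pi / real N)" using assms by (intro sin_gt_zero) (auto simp: field_simps)
  have "sin (pi / real N) \<le> pi / real N" by (rule sin_x_le_x) simp
  hence "(real N * sin (pi / real N))\<^sup>2 \<le> pi\<^sup>2" using N s by (intro power_mono) (auto simp: field_simps)
  hence "real N ^ 2 * sin (pi / real N) ^ 2 < 12" using pi_squared_less_12 by (simp add: power_mult_distrib)
  moreover have "real N ^ 2 * sin (pi / real N) ^ 2 > 0" using N s by simp
  ultimately show ?thesis by (simp add: B2_coeff_def field_simps)
qed

text \<open>
  The Fourier coefficient of index \<open>1\<close> makes the operator \<open>b \<mapsto> (\<Sum>s. B2_coeff N s * b (s * y))\<close>
  diagonally dominant on even functions: the coefficients are nonnegative with sum \<open>B\<^sub>2(0) = 1/6\<close>.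
\<close>

lemma B2_matrix_injective:
  fixes x :: "nat \<Rightarrow> real"
  assumes N: "N \<ge> 3" and zero: "\<And>y. (\<Sum>j = 1..N div 2. x j * B2_per N (j * y)) = 0"
    and l: "l \<in> {1..N div 2}"
  shows "x l = 0"
proof -
  define m where "m = N div 2"
  have N0: "N > 0" "N \<ge> 2" using N by simp_all
  define b where "b = (\<lambda>y::nat. \<Sum>j = 1..m. x j * cos (2 * pi * real j * real y / real N))"
  have per: "cos (2 * pi * real j * real (y + N * q) / real N) = cos (2 * pi * real j * real y / real N)" for j y q
  proof -
    have "2 * pi * real j * real (y + N * q) / real N = 2 * pi * real j * real y / real N + 2 * pi * of_int (int (j * q))"
      using N0 by (simp add: field_simps)
    thus ?thesis by (simp only: cos_add cos_int_2pin sin_int_2pin)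
  qed
  have bper: "b (y mod N) = b y" for y
    using per[of _ "y mod N" "y div N"] by (simp add: b_def)
  have beven: "b ((N - 1) * y) = b y" for y
  proof -
    have "cos (2 * pi * real j * real ((N - 1) * y) / real N) = cos (2 * pi * real j * real y / real N)" for j
    proof -
      have "2 * pi * real j * real ((N - 1) * y) / real N = 2 * pi * of_int (int (j * y)) - 2 * pi * real j * real y / real N"
        using N0 by (simp add: field_simps of_nat_diff)
      thus ?thesis by (simp only: cos_diff cos_int_2pin sin_int_2pin)
    qed
    thus ?thesis by (simp add: b_def)
  qed
  \<comment> \<open>Inserting the Fourier expansion and exchanging the sums turns the hypothesis on
    x into one on its cosine transform b.\<close>
  have conv: "(\<Sum>s < N. B2_coeff N s * b (s * y)) = 0" for y
  proof -
    have "(\<Sum>s < N. B2_coeff N s * b (s * y)) = (\<Sum>s < N. \<Sum>j = 1..m. x j * (B2_coeff N s * cos (2 * pi * real s * real (j * y) / real N)))"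
      unfolding b_def sum_distrib_left by (intro sum.cong refl) (simp add: mult_ac)
    also have "\<dots> = (\<Sum>j = 1..m. \<Sum>s < N. x j * (B2_coeff N s * cos (2 * pi * real s * real (j * y) / real N)))"
      by (rule sum.swap)
    also have "\<dots> = (\<Sum>j = 1..m. x j * B2_per N (j * y))"
      unfolding B2_fourier[OF N0(2)] sum_distrib_left ..
    finally show ?thesis using zero unfolding m_def by simp
  qed
  have total: "(\<Sum>s < N. B2_coeff N s) = 1 / 6"
    using B2_fourier[OF N0(2), of 0] by (simp add: B2_per_eq)
  define B where "B = Max ((\<lambda>y. \<bar>b y\<bar>) ` {..<N})"
  have "{..<N} \<noteq> {}" using N0(1) by blast
  hence "B \<in> (\<lambda>y. \<bar>b y\<bar>) ` {..<N}" unfolding B_def by (intro Max_in) auto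
  then obtain y0 where y0: "B = \<bar>b y0\<bar>" by blast
  have le: "\<bar>b y\<bar> \<le> B" for y
  proof -
    have "\<bar>b (y mod N)\<bar> \<le> B" unfolding B_def by (rule Max_ge) (use N0 in auto)
    thus ?thesis by (simp only: bper)
  qed
  \<comment> \<open>The frequencies 1 and N - 1 have equal coefficients, and b is even, so together
    they contribute 2 \<open>B2_coeff N 1\<close> times b.\<close>
  have sym: "B2_coeff N (N - 1) = B2_coeff N 1"
  proof -
    have "pi * real (N - 1) / real N = pi - pi * real 1 / real N" using N0 by (simp add: field_simps of_nat_diff)
    thus ?thesis using N by (simp add: B2_coeff_def)
  qed
  define R where "R = {..<N} - {1, N - 1}"
  have split: "(\<Sum>s < N. f s) = f 1 + f (N - 1) + (\<Sum>s \<in> R. f s)" for f :: "nat \<Rightarrow> real"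
  proof -
    have "{..<N} = insert 1 (insert (N - 1) R)" using N by (auto simp: R_def)
    moreover have "1 \<notin> insert (N - 1) R" "N - 1 \<notin> R" "finite R" using N by (auto simp: R_def)
    ultimately show ?thesis by simp
  qed
  \<comment> \<open>At a point where |b| is maximal, the other coefficients have total weight 1/6 -
    2 \<open>B2_coeff N 1\<close>, which is less than 2 \<open>B2_coeff N 1\<close>; this forces the
    maximum to be 0.\<close>
  have "2 * B2_coeff N 1 * b y0 = - (\<Sum>s \<in> R. B2_coeff N s * b (s * y0))"
    using conv[of y0] unfolding split sym beven by (simp add: algebra_simps)
  hence "2 * B2_coeff N 1 * B = \<bar>\<Sum>s \<in> R. B2_coeff N s * b (s * y0)\<bar>"
    using B2_coeff_nonneg[of N 1] unfolding y0 by (metis abs_minus_cancel abs_mult abs_of_nonneg mult_nonneg_nonneg zero_le_numeral)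
  also have "\<dots> \<le> (\<Sum>s \<in> R. \<bar>B2_coeff N s * b (s * y0)\<bar>)" by (rule sum_abs)
  also have "\<dots> \<le> (\<Sum>s \<in> R. B2_coeff N s * B)"
    using le B2_coeff_nonneg by (intro sum_mono) (simp add: abs_mult mult_left_mono)
  also have "\<dots> = (\<Sum>s \<in> R. B2_coeff N s) * B" by (simp add: sum_distrib_right)
  also have "(\<Sum>s \<in> R. B2_coeff N s) = 1 / 6 - 2 * B2_coeff N 1" using total unfolding split sym by simp
  finally have "(4 * B2_coeff N 1 - 1 / 6) * B \<le> 0" by (simp add: algebra_simps)
  hence "B \<le> 0" using B2_coeff_1[OF N0(2)] by (simp add: mult_le_0_iff)
  hence b0: "b y = 0" for y using le[of y] by simp
  \<comment> \<open>Orthogonality of the cosines recovers x l; the frequency l = N / 2, which is its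
    own negative, has double norm.\<close>
  have "0 = (\<Sum>y < N. b y * cos (2 * pi * real l * real y / real N))" by (simp add: b0)
  also have "\<dots> = (\<Sum>j = 1..m. \<Sum>y < N. x j * (cos (2 * pi * real j * real y / real N) * cos (2 * pi * real l * real y / real N)))"
    unfolding b_def sum_distrib_right by (subst sum.swap) (simp add: mult.assoc)
  also have "\<dots> = (\<Sum>j = 1..m. if j = l then x l * (real N / 2 * (if 2 * l = N then 2 else 1)) else 0)"
  proof (intro sum.cong refl)
    fix j assume j: "j \<in> {1..m}"
    have l': "l \<in> {1..m}" using l by (simp add: m_def)
    have mN: "2 * m \<le> N" by (simp add: m_def)
    have "(\<Sum>y < N. cos (2 * pi * real j * real y / real N) * cos (2 * pi * real l * real y / real N)) =
       (\<Sum>y < N. (cos (2 * pi * real y * of_int (int j - int l) / real N) + cos (2 * pi * real y * of_int (int j + int l) / real N)) / 2)"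
    proof (intro sum.cong refl)
      fix y
      have "2 * pi * real y * of_int (int j - int l) / real N = 2 * pi * real j * real y / real N - 2 * pi * real l * real y / real N"
        "2 * pi * real y * of_int (int j + int l) / real N = 2 * pi * real j * real y / real N + 2 * pi * real l * real y / real N"
        using N0 by (simp_all add: field_simps)
      thus "cos (2 * pi * real j * real y / real N) * cos (2 * pi * real l * real y / real N) =
        (cos (2 * pi * real y * of_int (int j - int l) / real N) + cos (2 * pi * real y * of_int (int j + int l) / real N)) / 2"
        by (simp only: cos_times_cos)
    qed
    also have "\<dots> = ((if int N dvd int j - int l then real N else 0) + (if int N dvd int j + int l then real N else 0)) / 2"
      unfolding sum_divide_distrib[symmetric] sum.distrib sum_cos_roots[OF N0(1)] ..
    also have "int N dvd int j - int l \<longleftrightarrow> j = l"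
    proof
      assume d: "int N dvd int j - int l"
      have "\<bar>int j - int l\<bar> < int N" using j l' mN by auto
      hence "int j - int l = 0" using d zdvd_not_zless[of "\<bar>int j - int l\<bar>" "int N"] by (cases "int j - int l = 0") auto
      thus "j = l" by simp
    qed simp
    also have "int N dvd int j + int l \<longleftrightarrow> j = l \<and> 2 * l = N"
    proof
      assume "int N dvd int j + int l"
      hence "int N \<le> int j + int l" using j by (intro zdvd_imp_le) auto
      thus "j = l \<and> 2 * l = N" using j l' mN by auto
    next
      assume "j = l \<and> 2 * l = N"
      hence "int j + int l = int N" by auto
      thus "int N dvd int j + int l" by simp
    qed
    finally have "(\<Sum>y < N. cos (2 * pi * real j * real y / real N) * cos (2 * pi * real l * real y / real N)) =
       ((if j = l then real N else 0) + (if j = l \<and> 2 * l = N then real N else 0)) / 2" .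
    thus "(\<Sum>y < N. x j * (cos (2 * pi * real j * real y / real N) * cos (2 * pi * real l * real y / real N))) =
      (if j = l then x l * (real N / 2 * (if 2 * l = N then 2 else 1)) else 0)"
      unfolding sum_distrib_left[symmetric] by auto
  qed
  also have "\<dots> = x l * (real N / 2 * (if 2 * l = N then 2 else 1))"
    using l by (simp add: m_def)
  finally show ?thesis using N0 by (simp split: if_splits)
qed

text \<open>The part of \<open>cusp_ord\<close> that is linear in the exponents, for rational
  vectors, because the kernel of A_N is examined over the rationals.\<close>

definition vec_ord :: "nat \<Rightarrow> rat Matrix.vec \<Rightarrow> int \<times> int \<Rightarrow> rat" where
  "vec_ord N v p = (\<Sum>j = 1..N div 2. vec_index v (j - 1) *
        (of_int (cusp_g N p) / 2 * B2 (frac (of_int (int j * fst p) / of_int (cusp_g N p)))))"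

lemma cusp_ord_vec_ord:
  assumes "x \<in> carrier_vec (N div 2)"
  shows "cusp_ord N k x p = of_int (cusp_g N p) * of_nat k / 12 + vec_ord N (map_vec of_int x) p"
  unfolding cusp_ord_def vec_ord_def using assms
  by (auto intro!: arg_cong2[of _ _ _ _ "(+)"] sum.cong)

lemma A_mat_mult_vec:
  assumes v: "v \<in> carrier_vec (N div 2)" and r: "r < N div 2"
  shows "vec_index (A_mat N cr *\<^sub>v v) r = vec_ord N v (cr r)"
proof -
  have "vec_index (A_mat N cr *\<^sub>v v) r = (\<Sum>j = 0..<N div 2. A_mat N cr $$ (r, j) * vec_index v j)"
    using v r by (simp add: A_mat_def scalar_prod_def)
  also have "\<dots> = (\<Sum>j = 0..<N div 2. vec_index v j * 
     (of_int (cusp_g N (cr r)) / 2 * B2 (frac (of_int (int (Suc j) * fst (cr r)) / of_int (cusp_g N (cr r))))))"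
    using r by (intro sum.cong refl) (simp add: A_mat_def Let_def mult_ac)
  also have "\<dots> = vec_ord N v (cr r)"
    unfolding vec_ord_def
    by (rule sum.reindex_bij_witness[of _ "\<lambda>j. j - 1" Suc]) auto
  finally show ?thesis .
qed

lemma vec_ord_orb_rel:
  assumes "orb_rel N p q"
  shows "vec_ord N v q = vec_ord N v p"
proof -
  obtain s where s: "s \<in> {1, -1}" "cusp_g N p dvd fst q - s * fst p" "cusp_g N q = cusp_g N p"
    using assms unfolding orb_rel_def by blast
  show ?thesis unfolding vec_ord_def s(3) by (simp only: B2_frac_cong[OF s(1,2)])
qed

lemma sum_orbits_vec_ord:
  assumes "N \<ge> 5" "cusp_orbit_reps N cr"
  shows "(\<Sum>r = 0..N div 2. of_nat (card (Orb N (cusp N (cr r)))) * vec_ord N v (cr r)) = 0"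
proof -
  have "(\<Sum>r = 0..N div 2. of_nat (card (Orb N (cusp N (cr r)))) * vec_ord N v (cr r)) = 
     (\<Sum>r = 0..N div 2. \<Sum>j = 1..N div 2. vec_index v (j - 1) * (of_nat (card (Orb N (cusp N (cr r)))) * 
       (of_int (cusp_g N (cr r)) / 2 * B2 (frac (of_int (int j * fst (cr r)) / of_int (cusp_g N (cr r)))))))"
    unfolding vec_ord_def sum_distrib_left by (simp only: mult.left_commute)
  also have "\<dots> = (\<Sum>j = 1..N div 2. vec_index v (j - 1) * (\<Sum>r = 0..N div 2. of_nat (card (Orb N (cusp N (cr r)))) * 
       (of_int (cusp_g N (cr r)) / 2 * B2 (frac (of_int (int j * fst (cr r)) / of_int (cusp_g N (cr r)))))))"
    unfolding sum_distrib_left by (rule sum.swap)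
  also have "\<dots> = 0"
  proof (rule sum.neutral, rule ballI)
    fix j assume j: "j \<in> {1..N div 2}"
    have "0 < j" "j < N" using j assms(1) by auto
    thus "vec_index v (j - 1) * (\<Sum>r = 0..N div 2. of_nat (card (Orb N (cusp N (cr r)))) * 
       (of_int (cusp_g N (cr r)) / 2 * B2 (frac (of_int (int j * fst (cr r)) / of_int (cusp_g N (cr r)))))) = 0"
      using sum_orbits_B2[OF assms, of j] by (simp only: mult_zero_right)
  qed
  finally show ?thesis .
qed

lemma cusp_orbit_reps_coprime:
  "cusp_orbit_reps N cr \<Longrightarrow> r \<le> N div 2 \<Longrightarrow> coprime (fst (cr r)) (snd (cr r))"
  by (simp add: cusp_orbit_reps_def)

text \<open>The rows cover all orbits but the last; the weighted relation gives vanishing there as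
  well, and hence at every cusp. The cusps a / g with g | N then supply the equations for all y that
  the injectivity statement asks for.\<close>

lemma A_mat_kernel:
  assumes N: "N \<ge> 5" and reps: "cusp_orbit_reps N cr"
    and v: "v \<in> carrier_vec (N div 2)" and Av: "A_mat N cr *\<^sub>v v = 0\<^sub>v (N div 2)"
  shows "v = 0\<^sub>v (N div 2)"
proof -
  define m where "m = N div 2"
  let ?O = "\<lambda>r. of_nat (card (Orb N (cusp N (cr r)))) :: rat"
  have z: "vec_ord N v (cr r) = 0" if "r < m" for r
    using A_mat_mult_vec[OF v, of r cr] that unfolding Av by (simp add: m_def)
  have "(\<Sum>r = 0..m. ?O r * vec_ord N v (cr r)) = 0"
    using sum_orbits_vec_ord[OF N reps] by (simp add: m_def)
  moreover have "(\<Sum>r = 0..m. ?O r * vec_ord N v (cr r)) = (\<Sum>r = 0..<m. ?O r * vec_ord N v (cr r)) + ?O m * vec_ord N v (cr m)"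
    by (simp add: atLeastLessThanSuc_atLeastAtMost[symmetric])
  moreover have "(\<Sum>r = 0..<m. ?O r * vec_ord N v (cr r)) = 0" using z by simp
  ultimately have "?O m * vec_ord N v (cr m) = 0" by simp
  moreover have "card (Orb N (cusp N (cr m))) > 0"
    using card_Orb_pos[OF N cusp_orbit_reps_coprime[OF reps]] by (simp add: m_def)
  ultimately have "vec_ord N v (cr m) = 0" by simp
  hence z': "vec_ord N v (cr r) = 0" if "r \<le> m" for r using z that by (cases "r = m") auto
  have all: "vec_ord N v p = 0" if p: "coprime (fst p) (snd p)" for p
  proof -
    obtain r where r: "r \<le> N div 2" "orb_rel N (cr r) p" using orbit_of_cusp[OF N reps p] by blast
    thus ?thesis using z'[of r] vec_ord_orb_rel[OF r(2), of v] by (simp add: m_def)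
  qed
  have "(\<Sum>j = 1..N div 2. real_of_rat (vec_index v (j - 1)) * B2_per N (j * y)) = 0" for y
  proof -
    have N0: "N > 0" using N by simp
    \<comment> \<open>Writing y / N in lowest terms as a / g yields the cusp (a, g), for which
      gcd(g, N) = g.\<close>
    define h where "h = gcd y N"
    have h: "h > 0" "h dvd y" "h dvd N" using N0 by (simp_all add: h_def)
    from h(2) obtain a where a: "y = h * a" ..
    from h(3) obtain g where g: "N = h * g" ..
    have g0: "g > 0" using N0 g by (cases g) auto
    have "h * gcd a g = gcd y N" unfolding a g by (rule gcd_mult_distrib_nat)
    also have "\<dots> = h * 1" unfolding h_def by simp
    finally have "gcd a g = 1" using h by (simp only: mult_cancel1) simp
    hence cop: "coprime a g" by (simp only: coprime_iff_gcd_eq_1)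
    define p where "p = (int a, int g)"
    have "gcd g N = g" using g by (simp add: gcd_nat.absorb1)
    hence gp: "cusp_g N p = int g" by (simp add: cusp_g_def p_def)
    have "vec_ord N v p = 0" using cop by (intro all) (simp add: p_def)
    hence "(\<Sum>j = 1..N div 2. vec_index v (j - 1) * (of_nat g / 2 * B2 (frac (of_nat (j * a) / of_nat g)))) = 0"
      unfolding vec_ord_def gp by (simp add: p_def)
    moreover have "of_nat (j * a) / of_nat g = (of_nat (j * y) / of_nat N :: rat)" for j
      unfolding a g using h by simp
    ultimately have "(\<Sum>j = 1..N div 2. vec_index v (j - 1) * (of_nat g / 2 * B2 (frac (of_nat (j * y) / of_nat N)))) = 0"
      by (simp only:)
    hence "of_nat g / 2 * (\<Sum>j = 1..N div 2. vec_index v (j - 1) * B2 (frac (of_nat (j * y) / of_nat N))) = 0"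
      by (simp only: sum_distrib_left mult.left_commute)
    hence "(\<Sum>j = 1..N div 2. vec_index v (j - 1) * B2 (frac (of_nat (j * y) / of_nat N))) = 0"
      using g0 by simp
    hence "real_of_rat (\<Sum>j = 1..N div 2. vec_index v (j - 1) * B2 (frac (of_nat (j * y) / of_nat N))) = 0" by simp
    thus ?thesis unfolding of_rat_sum of_rat_mult frac_of_nat_div[OF N0] B2_per_def .
  qed
  hence x0: "real_of_rat (vec_index v (l - 1)) = 0" if "l \<in> {1..N div 2}" for l
    using B2_matrix_injective[of N "\<lambda>j. real_of_rat (vec_index v (j - 1))" l] N that by simp
  show ?thesis
  proof (rule eq_vecI)
    fix i assume "i < dim_vec (0\<^sub>v (N div 2) :: rat Matrix.vec)"
    hence i: "i < N div 2" by simp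
    hence "vec_index v i = 0" using x0[of "Suc i"] by simp
    thus "vec_index v i = vec_index (0\<^sub>v (N div 2)) i" using i by simp
  qed (use v in auto)
qed

lemma A_mat_carrier: "A_mat N cr \<in> carrier_mat (N div 2) (N div 2)"
  by (simp add: A_mat_def)

lemma A_mat_inverse:
  assumes "N \<ge> 5" "cusp_orbit_reps N cr"
  obtains Ai where "mat_inverse (A_mat N cr) = Some Ai" "A_mat N cr * Ai = 1\<^sub>m (N div 2)"
    "Ai * A_mat N cr = 1\<^sub>m (N div 2)" "Ai \<in> carrier_mat (N div 2) (N div 2)"
proof -
  note A = A_mat_carrier[of N cr]
  have "Determinant.det (A_mat N cr) \<noteq> 0"
    using A_mat_kernel[OF assms] det_0_iff_vec_prod_zero_field[OF A] by blast
  hence "A_mat N cr \<in> Units (ring_mat TYPE(rat) (N div 2) ())"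
    by (rule det_non_zero_imp_unit[OF A])
  then obtain Ai where Ai: "mat_inverse (A_mat N cr) = Some Ai"
    using mat_inverse(1)[OF A, of "()"] by (cases "mat_inverse (A_mat N cr)") auto
  thus ?thesis using that mat_inverse(2)[OF A Ai] by blast
qed

section \<open>The lattice spanned by the columns of \<open>B\<^sub>N\<close>\<close>

lemma moment_linear:
  assumes "x \<in> carrier_vec (N div 2)" "y \<in> carrier_vec (N div 2)"
  shows "moment0 N (x + y) = moment0 N x + moment0 N y" "moment2 N (x + y) = moment2 N x + moment2 N y"
    and "moment0 N (x - y) = moment0 N x - moment0 N y" "moment2 N (x - y) = moment2 N x - moment2 N y"
proof -
  have i: "j - 1 < N div 2" if "j \<in> {1..N div 2}" for j using that by auto
  show "moment0 N (x + y) = moment0 N x + moment0 N y" "moment2 N (x + y) = moment2 N x + moment2 N y"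
    unfolding moment0_def moment2_def sum.distrib[symmetric]
    by (intro sum.cong refl; use i assms in \<open>simp add: algebra_simps\<close>)+
  show "moment0 N (x - y) = moment0 N x - moment0 N y" "moment2 N (x - y) = moment2 N x - moment2 N y"
    unfolding moment0_def moment2_def sum_subtractf[symmetric]
    by (intro sum.cong refl; use i assms in \<open>simp add: algebra_simps\<close>)+
qed

lemma moment_smult:
  assumes "x \<in> carrier_vec (N div 2)"
  shows "moment0 N (c \<cdot>\<^sub>v x) = c * moment0 N x" "moment2 N (c \<cdot>\<^sub>v x) = c * moment2 N x"
proof -
  have i: "j - 1 < N div 2" if "j \<in> {1..N div 2}" for j using that by auto
  show "moment0 N (c \<cdot>\<^sub>v x) = c * moment0 N x" "moment2 N (c \<cdot>\<^sub>v x) = c * moment2 N x"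
    unfolding moment0_def moment2_def sum_distrib_left
    by (intro sum.cong refl; use i assms in \<open>simp add: algebra_simps\<close>)+
qed

lemma e_vec_carrier [simp]: "e_vec N j \<in> carrier_vec (N div 2)"
  by (simp add: e_vec_def)

lemma dim_e_vec [simp]: "dim_vec (e_vec N j) = N div 2"
  by (simp add: e_vec_def)

lemma index_e_vec: "i < N div 2 \<Longrightarrow> 1 \<le> j \<Longrightarrow> j \<le> N div 2 \<Longrightarrow> vec_index (e_vec N j) i = (if Suc i = j then 1 else 0)"
  by (auto simp: e_vec_def)

lemma moment_e_vec:
  assumes "1 \<le> j" "j \<le> N div 2"
  shows "moment0 N (e_vec N j) = 1" "moment2 N (e_vec N j) = (int j)\<^sup>2"
proof -
  have "vec_index (e_vec N j) (i - 1) = (if i = j then 1 else 0)" if "i \<in> {1..N div 2}" for i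
    using that assms by (auto simp: index_e_vec)
  hence "moment0 N (e_vec N j) = (\<Sum>i = 1..N div 2. if i = j then 1 else 0)"
    "moment2 N (e_vec N j) = (\<Sum>i = 1..N div 2. if i = j then (int j)\<^sup>2 else 0)"
    unfolding moment0_def moment2_def by (intro sum.cong refl; simp)+
  thus "moment0 N (e_vec N j) = 1" "moment2 N (e_vec N j) = (int j)\<^sup>2" using assms by simp_all
qed

lemma moment_mult_mat_vec:
  assumes B: "B \<in> carrier_mat (N div 2) n" and z: "z \<in> carrier_vec n"
  shows "moment0 N (B *\<^sub>v z) = (\<Sum>i < n. vec_index z i * moment0 N (col B i))"
    and "moment2 N (B *\<^sub>v z) = (\<Sum>i < n. vec_index z i * moment2 N (col B i))"
proof -
  have e: "vec_index (B *\<^sub>v z) (j - 1) = (\<Sum>i < n. vec_index z i * vec_index (col B i) (j - 1))" if "j \<in> {1..N div 2}" for j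
  proof -
    have j: "j - 1 < N div 2" using that by auto
    have "vec_index (B *\<^sub>v z) (j - 1) = (\<Sum>i = 0..<n. B $$ (j - 1, i) * vec_index z i)"
      using B z j by (simp add: scalar_prod_def)
    also have "\<dots> = (\<Sum>i < n. vec_index z i * vec_index (col B i) (j - 1))"
      unfolding lessThan_atLeast0 using B j by (intro sum.cong refl) simp
    finally show ?thesis .
  qed
  have "moment0 N (B *\<^sub>v z) = (\<Sum>j = 1..N div 2. \<Sum>i < n. vec_index z i * vec_index (col B i) (j - 1))"
    unfolding moment0_def using e by (intro sum.cong refl) auto
  thus "moment0 N (B *\<^sub>v z) = (\<Sum>i < n. vec_index z i * moment0 N (col B i))"
    unfolding moment0_def sum_distrib_left by (subst sum.swap) simp
  have "moment2 N (B *\<^sub>v z) = (\<Sum>j = 1..N div 2. \<Sum>i < n. vec_index z i * ((int j)\<^sup>2 * vec_index (col B i) (j - 1)))"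
    unfolding moment2_def by (intro sum.cong refl) (use e in \<open>simp add: sum_distrib_left mult.left_commute\<close>)
  thus "moment2 N (B *\<^sub>v z) = (\<Sum>i < n. vec_index z i * moment2 N (col B i))"
    unfolding moment2_def sum_distrib_left by (subst sum.swap) simp
qed

text \<open>The exponent vectors of the products of weight 0 that are invariant under Gamma_1(N);
  this is the lattice to be identified with the column span of B_N.\<close>

definition relation_vec :: "nat \<Rightarrow> int Matrix.vec \<Rightarrow> bool" where
  "relation_vec N x \<longleftrightarrow> x \<in> carrier_vec (N div 2) \<and> 12 dvd moment0 N x \<and> int (N * gcd 2 N) dvd moment2 N x"

definition mat_range :: "int Matrix.mat \<Rightarrow> int Matrix.vec set" where
  "mat_range B = {B *\<^sub>v z | z. z \<in> carrier_vec (dim_col B)}"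

lemma mat_range_lincomb:
  assumes B: "B \<in> carrier_mat m n" and x: "x \<in> mat_range B" "y \<in> mat_range B"
  shows "x + c \<cdot>\<^sub>v y \<in> mat_range B"
proof -
  obtain u where u: "x = B *\<^sub>v u" "u \<in> carrier_vec n" using x(1) B by (auto simp: mat_range_def)
  obtain v where v: "y = B *\<^sub>v v" "v \<in> carrier_vec n" using x(2) B by (auto simp: mat_range_def)
  have "x + c \<cdot>\<^sub>v y = B *\<^sub>v (u + c \<cdot>\<^sub>v v)"
  proof -
    have "B *\<^sub>v (c \<cdot>\<^sub>v v) = c \<cdot>\<^sub>v (B *\<^sub>v v)"
      by (rule eq_vecI) (use B v in auto)
    thus ?thesis using B u v by (simp add: mult_add_distrib_mat_vec)
  qed
  thus ?thesis using B u v by (auto simp: mat_range_def)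
qed

lemma mat_range_zero:
  assumes B: "B \<in> carrier_mat m n"
  shows "0\<^sub>v m \<in> mat_range B"
proof -
  have "B *\<^sub>v 0\<^sub>v n = 0\<^sub>v m" using B by auto
  thus ?thesis unfolding mat_range_def using B by (metis (mono_tags, lifting) carrier_matD(2) mem_Collect_eq zero_carrier_vec)
qed

lemma col_mat_range:
  assumes B: "B \<in> carrier_mat m n" and i: "i < n"
  shows "col B i \<in> mat_range B"
proof -
  have "B *\<^sub>v unit_vec n i = col B i"
    by (rule eq_vecI) (use B i in auto)
  thus ?thesis unfolding mat_range_def using B
    by (metis (mono_tags, lifting) carrier_matD(2) mem_Collect_eq unit_vec_carrier)
qed

lemma mat_of_cols_mat_range:
  assumes "set L \<subseteq> carrier_vec m" "x \<in> set L"
  shows "x \<in> mat_range (mat_of_cols m L)"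
proof -
  obtain i where i: "i < length L" "x = L ! i" using assms(2) by (auto simp: in_set_conv_nth)
  have "col (mat_of_cols m L) i = x" using i assms by (subst col_mat_of_cols) auto
  thus ?thesis using col_mat_range[OF mat_of_cols_carrier(1)[of m L] i(1)] by simp
qed


text \<open>To \<open>e_vec N j\<close> a combination of \<open>e_vec N 1\<close> and
  \<open>e_vec N 2\<close> is added that cancels both moments. Its coefficients are integral only
  for j prime to 3; otherwise \<open>e_vec N 3\<close> is subtracted beforehand. The 9 is j_1^2, as
  the first multiple of 3 is j_1 = 3.\<close>

definition B_col :: "nat \<Rightarrow> nat \<Rightarrow> int Matrix.vec" where
  "B_col N j = (if 3 dvd j
     then (((int j)\<^sup>2 - 9) div 3) \<cdot>\<^sub>v (e_vec N 1 - e_vec N 2) - e_vec N 3 + e_vec N j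
     else (((int j)\<^sup>2 - 4) div 3) \<cdot>\<^sub>v e_vec N 1 - (((int j)\<^sup>2 - 1) div 3) \<cdot>\<^sub>v e_vec N 2 + e_vec N j)"

text \<open>With M = N gcd(2, N), their moments (\<open>moment0\<close>, \<open>moment2\<close>) are
  (12, 0), (0, M) and (0, 0). The third coordinate r, congruent to -M modulo 3, makes the divisions
  in the second vector exact; the third vector is the column belonging to j_1 = 3.\<close>

definition B_first_cols :: "nat \<Rightarrow> int Matrix.vec list" where
  "B_first_cols N = (let M = int (N * gcd 2 N); r = (2 * M) mod 3 in
     [16 \<cdot>\<^sub>v e_vec N 1 - 4 \<cdot>\<^sub>v e_vec N 2,
      ((- M + 5 * r) div 3) \<cdot>\<^sub>v e_vec N 1 + ((M - 8 * r) div 3) \<cdot>\<^sub>v e_vec N 2 + r \<cdot>\<^sub>v e_vec N 3,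
      5 \<cdot>\<^sub>v e_vec N 1 - 8 \<cdot>\<^sub>v e_vec N 2 + 3 \<cdot>\<^sub>v e_vec N 3])"

text \<open>Only the set of columns matters for the lattice they span, so their order in
  \<open>B_mat\<close> is forgotten.\<close>

lemma B_mat_cols:
  assumes N: "N \<ge> 6"
  obtains L where "B_mat N = mat_of_cols (N div 2) L" "length L = N div 2"
    "set L = set (B_first_cols N) \<union> B_col N ` {4..N div 2}"
proof -
  define m where "m = N div 2"
  have m: "m \<ge> 3" using N by (simp add: m_def)
  have up: "[3..<Suc m] = 3 # [4..<Suc m]" using m by (simp add: upt_conv_Cons)
  define L1 where "L1 = map (\<lambda>j. (((int j)\<^sup>2 - 4) div 3) \<cdot>\<^sub>v e_vec N 1 - (((int j)\<^sup>2 - 1) div 3) \<cdot>\<^sub>v e_vec N 2 + e_vec N j) (filter (\<lambda>j. \<not> 3 dvd j) [4..<Suc m])"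
  define L2 where "L2 = map (\<lambda>j. (((int j)\<^sup>2 - 9) div 3) \<cdot>\<^sub>v (e_vec N 1 - e_vec N 2) - e_vec N 3 + e_vec N j) (filter (\<lambda>j. 3 dvd j) [4..<Suc m])"
  define F where "F = B_first_cols N"
  define L where "L = [F ! 0, F ! 1] @ L1 @ [F ! 2] @ L2"
  have "B_mat N = mat_of_cols m L"
    using N unfolding B_mat_def Let_def m_def[symmetric] up L_def L1_def L2_def F_def B_first_cols_def
    by (simp add: numeral_2_eq_2)
  moreover have "length L = m"
  proof -
    have "length L = 3 + (length (filter (\<lambda>j. 3 dvd j) [4..<Suc m]) + length (filter (\<lambda>j. \<not> 3 dvd j) [4..<Suc m]))"
      by (simp add: L_def L1_def L2_def)
    also have "\<dots> = 3 + length [4..<Suc m]" by (simp only: sum_length_filter_compl)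
    also have "\<dots> = m" using m by simp
    finally show ?thesis .
  qed
  moreover have "set L = set F \<union> B_col N ` {4..m}"
  proof -
    have "set F = {F ! 0, F ! 1, F ! 2}" by (auto simp: F_def B_first_cols_def Let_def numeral_2_eq_2)
    moreover have "set L1 = B_col N ` {j \<in> {4..m}. \<not> 3 dvd j}" unfolding L1_def set_map
      by (rule image_cong) (auto simp: B_col_def)
    moreover have "set L2 = B_col N ` {j \<in> {4..m}. 3 dvd j}" unfolding L2_def set_map
      by (rule image_cong) (auto simp: B_col_def)
    moreover have "set L = {F ! 0, F ! 1, F ! 2} \<union> (set L1 \<union> set L2)" by (auto simp: L_def)
    moreover have "B_col N ` {j \<in> {4..m}. \<not> 3 dvd j} \<union> B_col N ` {j \<in> {4..m}. 3 dvd j} = B_col N ` {4..m}"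
      by blast
    ultimately show ?thesis by simp
  qed
  ultimately show ?thesis using that unfolding F_def m_def by blast
qed

lemma square_mod_3:
  fixes j :: int
  assumes "\<not> 3 dvd j"
  shows "3 dvd j\<^sup>2 - 1"
proof -
  have "j mod 3 = 1 \<or> j mod 3 = 2" using assms by presburger
  then obtain q where "j = 3 * q + 1 \<or> j = 3 * q + 2" by (metis mult_div_mod_eq)
  thus ?thesis
  proof
    assume "j = 3 * q + 1"
    hence "j\<^sup>2 - 1 = 3 * (3 * q\<^sup>2 + 2 * q)" by (simp add: power2_eq_square algebra_simps)
    thus ?thesis by simp
  next
    assume "j = 3 * q + 2"
    hence "j\<^sup>2 - 1 = 3 * (3 * q\<^sup>2 + 4 * q + 1)" by (simp add: power2_eq_square algebra_simps)
    thus ?thesis by simp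
  qed
qed

lemma B_col_properties:
  assumes N: "N \<ge> 6" and j: "4 \<le> j" "j \<le> N div 2"
  shows "B_col N j \<in> carrier_vec (N div 2)" "moment0 N (B_col N j) = 0" "moment2 N (B_col N j) = 0"
    "\<And>i. 4 \<le> i \<Longrightarrow> i \<le> N div 2 \<Longrightarrow> vec_index (B_col N j) (i - 1) = (if i = j then 1 else 0)"
proof -
  have m: "3 \<le> N div 2" using N by simp
  note te = moment_e_vec[of 1 N] moment_e_vec[of 2 N] moment_e_vec[of 3 N] moment_e_vec[of j N]
  show c: "B_col N j \<in> carrier_vec (N div 2)" by (simp add: B_col_def)
  show "vec_index (B_col N j) (i - 1) = (if i = j then 1 else 0)" if "4 \<le> i" "i \<le> N div 2" for i
    using that j m by (auto simp: B_col_def index_e_vec)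
  show "moment0 N (B_col N j) = 0" "moment2 N (B_col N j) = 0"
  proof -
    have "moment0 N (B_col N j) = 0 \<and> moment2 N (B_col N j) = 0"
    proof (cases "3 dvd j")
      case True
      then obtain q where q: "j = 3 * q" ..
      have "(int j)\<^sup>2 - 9 = 3 * (3 * (int q)\<^sup>2 - 3)" by (simp add: q power2_eq_square)
      hence d: "((int j)\<^sup>2 - 9) div 3 = 3 * (int q)\<^sup>2 - 3" by simp
      show ?thesis unfolding B_col_def d using True m j te q
        by (simp add: moment_linear moment_smult power2_eq_square algebra_simps)
    next
      case False
      hence "3 dvd (int j)\<^sup>2 - 1" using square_mod_3[of "int j"] by presburger
      then obtain q where q: "(int j)\<^sup>2 - 1 = 3 * q" ..
      hence "(int j)\<^sup>2 - 4 = 3 * (q - 1)" by simp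
      hence d: "((int j)\<^sup>2 - 4) div 3 = q - 1" "((int j)\<^sup>2 - 1) div 3 = q" using q by simp_all
      show ?thesis unfolding B_col_def d using False m j te q
        by (simp add: moment_linear moment_smult algebra_simps)
    qed
    thus "moment0 N (B_col N j) = 0" "moment2 N (B_col N j) = 0" by simp_all
  qed
qed

lemma B_first_cols_properties:
  assumes N: "N \<ge> 6"
  defines "M \<equiv> int (N * gcd 2 N)"
  obtains C1 C2 C3 r where "B_first_cols N = [C1, C2, C3]"
    "C1 \<in> carrier_vec (N div 2)" "C2 \<in> carrier_vec (N div 2)" "C3 \<in> carrier_vec (N div 2)"
    "moment0 N C1 = 12" "moment2 N C1 = 0" "moment0 N C2 = 0" "moment2 N C2 = M" "moment0 N C3 = 0" "moment2 N C3 = 0"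
    "vec_index C1 2 = 0" "vec_index C2 2 = r" "vec_index C3 2 = 3" "3 dvd M + r"
    "\<And>C i. C \<in> {C1, C2, C3} \<Longrightarrow> 3 \<le> i \<Longrightarrow> i < N div 2 \<Longrightarrow> vec_index C i = 0"
proof -
  have m: "3 \<le> N div 2" using N by simp
  note te = moment_e_vec[of 1 N] moment_e_vec[of 2 N] moment_e_vec[of 3 N]
  define r where "r = (2 * M) mod 3"
  define C1 where "C1 = 16 \<cdot>\<^sub>v e_vec N 1 - 4 \<cdot>\<^sub>v e_vec N 2"
  define C2 where "C2 = ((- M + 5 * r) div 3) \<cdot>\<^sub>v e_vec N 1 + ((M - 8 * r) div 3) \<cdot>\<^sub>v e_vec N 2 + r \<cdot>\<^sub>v e_vec N 3"
  define C3 where "C3 = 5 \<cdot>\<^sub>v e_vec N 1 - 8 \<cdot>\<^sub>v e_vec N 2 + 3 \<cdot>\<^sub>v e_vec N 3"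
  define q where "q = (2 * M) div 3"
  have Mr: "2 * M = 3 * q + r" by (simp add: q_def r_def)
  have "3 dvd M + r"
  proof -
    have "M + r = 3 * (M - q)" using Mr by simp
    thus ?thesis by simp
  qed
  then obtain l where l: "M + r = 3 * l" ..
  have "- M + 5 * r = 3 * (2 * r - l)" using l by simp
  hence d1: "(- M + 5 * r) div 3 = 2 * r - l" by simp
  have "M - 8 * r = 3 * (l - 3 * r)" using l by simp
  hence d2: "(M - 8 * r) div 3 = l - 3 * r" by simp
  have dims: "dim_vec (e_vec N j) = N div 2" for j using e_vec_carrier by (rule carrier_vecD)
  show ?thesis
  proof (rule that[of C1 C2 C3 r])
    show "B_first_cols N = [C1, C2, C3]"
      unfolding B_first_cols_def Let_def C1_def C2_def C3_def r_def M_def ..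
    show "C1 \<in> carrier_vec (N div 2)" "C2 \<in> carrier_vec (N div 2)" "C3 \<in> carrier_vec (N div 2)"
      by (simp_all add: C1_def C2_def C3_def)
    show "moment0 N C1 = 12" "moment2 N C1 = 0" "moment0 N C3 = 0" "moment2 N C3 = 0"
      using m te by (simp_all add: C1_def C3_def moment_linear moment_smult)
    show "moment0 N C2 = 0" "moment2 N C2 = M" using m te l unfolding C2_def d1 d2
      by (simp_all add: moment_linear moment_smult)
    show "vec_index C1 2 = 0" "vec_index C2 2 = r" "vec_index C3 2 = 3"
      using m by (simp_all add: C1_def C2_def C3_def dims index_e_vec)
    show "3 dvd M + r" by fact
    show "vec_index C i = 0" if "C \<in> {C1, C2, C3}" "3 \<le> i" "i < N div 2" for C i
      using that m by (auto simp: C1_def C2_def C3_def dims index_e_vec)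
  qed
qed

text \<open>The moments determine the multiples of the first two columns and the third coordinate
  that of the third column. What remains is supported on two coordinates and has both moments 0,
  hence vanishes.\<close>

lemma relation_vec_three:
  assumes N: "N \<ge> 6" and B: "B \<in> carrier_mat (N div 2) n"
    and cols: "set (B_first_cols N) \<subseteq> mat_range B"
    and x: "relation_vec N x" "\<And>i. 3 \<le> i \<Longrightarrow> i < N div 2 \<Longrightarrow> vec_index x i = 0"
  shows "x \<in> mat_range B"
proof -
  define M where "M = int (N * gcd 2 N)"
  have m: "3 \<le> N div 2" using N by simp
  obtain C1 C2 C3 r where C: "B_first_cols N = [C1, C2, C3]"
    "C1 \<in> carrier_vec (N div 2)" "C2 \<in> carrier_vec (N div 2)" "C3 \<in> carrier_vec (N div 2)"
    "moment0 N C1 = 12" "moment2 N C1 = 0" "moment0 N C2 = 0" "moment2 N C2 = M" "moment0 N C3 = 0" "moment2 N C3 = 0"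
    "vec_index C1 2 = 0" "vec_index C2 2 = r" "vec_index C3 2 = 3" "3 dvd M + r"
    "\<And>C i. C \<in> {C1, C2, C3} \<Longrightarrow> 3 \<le> i \<Longrightarrow> i < N div 2 \<Longrightarrow> vec_index C i = 0"
    using B_first_cols_properties[OF N] unfolding M_def by blast
  have xc: "x \<in> carrier_vec (N div 2)" using x(1) by (simp add: relation_vec_def)
  obtain \<alpha> where \<alpha>: "moment0 N x = 12 * \<alpha>" using x(1) unfolding relation_vec_def by blast
  obtain \<beta> where \<beta>: "moment2 N x = M * \<beta>" using x(1) unfolding relation_vec_def M_def by blast
  have T3: "moment0 N y = vec_index y 0 + vec_index y 1 + vec_index y 2"
    "moment2 N y = vec_index y 0 + 4 * vec_index y 1 + 9 * vec_index y 2"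
    if "\<And>i. 3 \<le> i \<Longrightarrow> i < N div 2 \<Longrightarrow> vec_index y i = 0" for y
  proof -
    have "(\<Sum>j = 1..N div 2. f j * vec_index y (j - 1)) = (\<Sum>j \<in> {1, 2, 3}. f j * vec_index y (j - 1))" for f :: "nat \<Rightarrow> int"
      by (rule sum.mono_neutral_right) (use m that in auto)
    from this[of "\<lambda>j. 1"] this[of "\<lambda>j. (int j)\<^sup>2"]
    show "moment0 N y = vec_index y 0 + vec_index y 1 + vec_index y 2"
      "moment2 N y = vec_index y 0 + 4 * vec_index y 1 + 9 * vec_index y 2"
      by (simp_all add: moment0_def moment2_def eval_nat_numeral(1))
  qed
  \<comment> \<open>Subtracting the moments gives M \<beta> - 12 \<alpha> = 3 x_2 + 8 x_3 in 1-based
    coordinates, so x_3 is congruent to -M \<beta>, that is, to r \<beta> modulo 3.\<close>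
  have "3 dvd vec_index x 2 - r * \<beta>"
  proof -
    obtain l where l: "M + r = 3 * l" using C(14) by blast
    have "M * \<beta> = 12 * \<alpha> - vec_index x 2 + 3 * (vec_index x 1 + 3 * vec_index x 2)"
      using T3[OF x(2)] \<alpha> \<beta> by simp
    moreover have "M * \<beta> + r * \<beta> = 3 * (l * \<beta>)" using l by (metis distrib_right mult.assoc)
    ultimately have eq: "vec_index x 2 - r * \<beta> = 3 * (4 * \<alpha> + vec_index x 1 + 3 * vec_index x 2 - l * \<beta>)"
      by (simp add: algebra_simps)
    show ?thesis unfolding eq by (rule dvd_triv_left)
  qed
  then obtain \<gamma> where \<gamma>: "vec_index x 2 - r * \<beta> = 3 * \<gamma>" ..
  define y where "y = x - (\<alpha> \<cdot>\<^sub>v C1 + \<beta> \<cdot>\<^sub>v C2 + \<gamma> \<cdot>\<^sub>v C3)"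
  have dims: "dim_vec C1 = N div 2" "dim_vec C2 = N div 2" "dim_vec C3 = N div 2" "dim_vec x = N div 2"
    using C(2,3,4) xc by auto
  have y3: "vec_index y i = 0" if "3 \<le> i" "i < N div 2" for i
    using that x(2)[of i] C(15)[of _ i] dims by (simp add: y_def)
  have y2: "vec_index y 2 = 0" using m C(11-13) \<gamma> dims by (simp add: y_def algebra_simps)
  have "moment0 N y = 0" "moment2 N y = 0"
    using C(2-10) xc \<alpha> \<beta> by (simp_all add: y_def moment_linear moment_smult)
  hence "vec_index y 0 + vec_index y 1 = 0" "vec_index y 0 + 4 * vec_index y 1 = 0"
    using T3[OF y3] y2 by simp_all
  hence y01: "vec_index y 0 = 0" "vec_index y 1 = 0" by simp_all
  have y0: "vec_index y i = 0" if "i < N div 2" for i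
  proof -
    consider "i = 0" | "i = 1" | "i = 2" | "3 \<le> i" by linarith
    thus ?thesis using y01 y2 y3 that by cases auto
  qed
  have eq: "x = ((0\<^sub>v (N div 2) + \<alpha> \<cdot>\<^sub>v C1) + \<beta> \<cdot>\<^sub>v C2) + \<gamma> \<cdot>\<^sub>v C3"
  proof (rule eq_vecI)
    fix i assume "i < dim_vec (((0\<^sub>v (N div 2) + \<alpha> \<cdot>\<^sub>v C1) + \<beta> \<cdot>\<^sub>v C2) + \<gamma> \<cdot>\<^sub>v C3)"
    hence i: "i < N div 2" using dims by simp
    show "vec_index x i = vec_index (((0\<^sub>v (N div 2) + \<alpha> \<cdot>\<^sub>v C1) + \<beta> \<cdot>\<^sub>v C2) + \<gamma> \<cdot>\<^sub>v C3) i"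
      using y0[OF i] i dims by (simp add: y_def)
  qed (use dims in simp)
  have "C1 \<in> mat_range B" "C2 \<in> mat_range B" "C3 \<in> mat_range B" using cols C(1) by auto
  thus ?thesis unfolding eq by (intro mat_range_lincomb[OF B] mat_range_zero[OF B])
qed

lemma relation_vec_sum:
  assumes "relation_vec N x" "relation_vec N y"
  shows "relation_vec N (x + c \<cdot>\<^sub>v y)"
  using assms unfolding relation_vec_def by (auto simp: moment_linear moment_smult)

text \<open>Triangular elimination from the top coordinate downwards: \<open>B_col N j\<close> has
  entry 1 at position j, zeros at all other positions from 4 on, and vanishing moments, so
  subtracting it stays within the lattice.\<close>

lemma relation_vec_decompose:
  assumes N: "N \<ge> 6" and B: "B \<in> carrier_mat (N div 2) n"
    and cols: "set (B_first_cols N) \<subseteq> mat_range B" "B_col N ` {4..N div 2} \<subseteq> mat_range B"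
    and p: "3 \<le> p" "p \<le> N div 2"
    and x: "relation_vec N x" "\<And>i. p \<le> i \<Longrightarrow> i < N div 2 \<Longrightarrow> vec_index x i = 0"
  shows "x \<in> mat_range B"
  using p x
proof (induction p arbitrary: x rule: dec_induct)
  case base
  thus ?case using relation_vec_three[OF N B cols(1)] by blast
next
  case (step p)
  define c where "c = vec_index x p"
  have p: "4 \<le> Suc p" "Suc p \<le> N div 2" using step by auto
  note bc = B_col_properties[OF N p]
  define y where "y = x + (- c) \<cdot>\<^sub>v B_col N (Suc p)"
  have xc: "x \<in> carrier_vec (N div 2)" using step.prems by (simp add: relation_vec_def)
  have "relation_vec N (B_col N (Suc p))" unfolding relation_vec_def using bc by simp
  hence "relation_vec N y" unfolding y_def using step.prems relation_vec_sum by blast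
  moreover have "vec_index y i = 0" if i: "p \<le> i" "i < N div 2" for i
  proof -
    have "vec_index y i = vec_index x i - c * vec_index (B_col N (Suc p)) (Suc i - 1)"
      using i xc bc(1) by (simp add: y_def)
    also have "vec_index (B_col N (Suc p)) (Suc i - 1) = (if Suc i = Suc p then 1 else 0)"
      using i p by (intro bc(4)) auto
    finally show ?thesis using step.prems(3)[of i] i by (cases "i = p") (auto simp: c_def)
  qed
  ultimately have "y \<in> mat_range B" using step.IH p by auto
  moreover have "B_col N (Suc p) \<in> mat_range B" using cols(2) p by auto
  moreover have "x = y + c \<cdot>\<^sub>v B_col N (Suc p)"
    by (rule eq_vecI) (use xc bc(1) in \<open>auto simp: y_def\<close>)
  ultimately show ?case by (metis mat_range_lincomb[OF B])
qed

text \<open>For N = 5 there are two coordinates only, and the elimination based on a third one is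
  replaced by solving a 2 x 2 system.\<close>

lemma relation_vec_B_mat_5:
  fixes x :: "int Matrix.vec"
  shows "x \<in> mat_range (B_mat 5) \<longleftrightarrow> relation_vec 5 x" "B_mat 5 \<in> carrier_mat 2 2"
proof -
  show B: "B_mat 5 \<in> carrier_mat 2 2" by (rule carrier_matI) (simp_all add: B_mat_def mat_of_rows_list_def)
  have vec2: "z = vec_of_list [a, b]" if "z \<in> carrier_vec 2" "vec_index z 0 = a" "vec_index z 1 = b"
    for z :: "int Matrix.vec" and a b
  proof (rule eq_vecI)
    fix i assume "i < dim_vec (vec_of_list [a, b])"
    hence "i = 0 \<or> i = 1" by auto
    thus "vec_index z i = vec_index (vec_of_list [a, b]) i" using that by auto
  qed (use that in auto)
  have mult: "B_mat 5 *\<^sub>v vec_of_list [a, b] = vec_of_list [16 * a - 5 * b, - 4 * a + 5 * b]" for a b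
  proof (rule vec2)
    have ab: "vec_of_list [a, b] \<in> carrier_vec 2" by (rule carrier_vecI) simp
    have two: "{0..<2 :: nat} = {0, 1}" by auto
    show "B_mat 5 *\<^sub>v vec_of_list [a, b] \<in> carrier_vec 2" using B ab by (rule mult_mat_vec_carrier)
    have row: "vec_index (B_mat 5 *\<^sub>v vec_of_list [a, b]) i = B_mat 5 $$ (i, 0) * a + B_mat 5 $$ (i, 1) * b" if "i < 2" for i
      using B that two by (simp add: scalar_prod_def)
    have entries: "B_mat 5 $$ (0, 0) = 16" "B_mat 5 $$ (0, 1) = - 5" "B_mat 5 $$ (1, 0) = - 4" "B_mat 5 $$ (1, 1) = 5"
      by (simp_all add: B_mat_def mat_of_rows_list_def)
    show "vec_index (B_mat 5 *\<^sub>v vec_of_list [a, b]) 0 = 16 * a - 5 * b"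
      "vec_index (B_mat 5 *\<^sub>v vec_of_list [a, b]) 1 = - 4 * a + 5 * b"
      using row[of 0] row[of 1] unfolding entries by simp_all
  qed
  have "{1..5 div 2} = {1, 2 :: nat}" by auto
  hence T: "moment0 5 x = vec_index x 0 + vec_index x 1" "moment2 5 x = vec_index x 0 + 4 * vec_index x 1"
    by (simp_all add: moment0_def moment2_def)
  show "x \<in> mat_range (B_mat 5) \<longleftrightarrow> relation_vec 5 x"
  proof
    assume "x \<in> mat_range (B_mat 5)"
    then obtain z where z: "x = B_mat 5 *\<^sub>v z" "z \<in> carrier_vec 2" using B by (auto simp: mat_range_def)
    define a b where "a = vec_index z 0" and "b = vec_index z 1"
    have x: "x = vec_of_list [16 * a - 5 * b, - 4 * a + 5 * b]"
      unfolding z(1) mult[symmetric] using vec2[OF z(2) refl refl] by (simp only: a_def b_def)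
    have "moment0 5 x = 12 * a" "moment2 5 x = 5 * (3 * b)" unfolding T unfolding x by (simp_all add: vec_of_list_index)
    moreover have "x \<in> carrier_vec 2" unfolding x by (rule carrier_vecI) simp
    ultimately show "relation_vec 5 x" unfolding relation_vec_def by simp
  next
    assume "relation_vec 5 x"
    hence xc: "x \<in> carrier_vec 2" and d: "12 dvd moment0 5 x" "5 dvd moment2 5 x" by (simp_all add: relation_vec_def)
    obtain a where a: "vec_index x 0 + vec_index x 1 = 12 * a" using d(1) T by auto
    obtain b' where b': "vec_index x 0 + 4 * vec_index x 1 = 5 * b'" using d(2) T by auto
    \<comment> \<open>Subtracting the two moment equations gives 3 x_2 = 5 b' - 12 a.\<close>
    have "3 dvd b'" using a b' by presburger
    then obtain b where b: "b' = 3 * b" ..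
    have x01: "vec_index x 0 = 16 * a - 5 * b" "vec_index x 1 = - 4 * a + 5 * b"
      using a b' unfolding b by linarith+
    have "x = vec_of_list [16 * a - 5 * b, - 4 * a + 5 * b]"
      by (rule vec2[OF xc x01])
    hence "x = B_mat 5 *\<^sub>v vec_of_list [a, b]" by (simp only: mult)
    moreover have "vec_of_list [a, b] \<in> carrier_vec (dim_col (B_mat 5))" using B by (intro carrier_vecI) simp
    ultimately show "x \<in> mat_range (B_mat 5)" unfolding mat_range_def by blast
  qed
qed

lemma B_mat_range:
  assumes N: "N \<ge> 5"
  shows "B_mat N \<in> carrier_mat (N div 2) (N div 2)"
    and "(\<exists>z \<in> carrier_vec (N div 2). x = B_mat N *\<^sub>v z) \<longleftrightarrow> relation_vec N x"
proof -
  have "B_mat N \<in> carrier_mat (N div 2) (N div 2) \<and> (x \<in> mat_range (B_mat N) \<longleftrightarrow> relation_vec N x)"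
  proof (cases "N = 5")
    case True
    thus ?thesis using relation_vec_B_mat_5 by simp
  next
    case False
    hence N6: "N \<ge> 6" using N by simp
    define m where "m = N div 2"
    obtain L where L: "B_mat N = mat_of_cols m L" "length L = m"
      "set L = set (B_first_cols N) \<union> B_col N ` {4..m}" unfolding m_def by (rule B_mat_cols[OF N6])
    have B: "B_mat N \<in> carrier_mat m m" unfolding L(1) using mat_of_cols_carrier(1)[of m L] L(2) by simp
    obtain C1 C2 C3 r where C: "B_first_cols N = [C1, C2, C3]"
      "C1 \<in> carrier_vec (N div 2)" "C2 \<in> carrier_vec (N div 2)" "C3 \<in> carrier_vec (N div 2)"
      "moment0 N C1 = 12" "moment2 N C1 = 0" "moment0 N C2 = 0" "moment2 N C2 = int (N * gcd 2 N)" "moment0 N C3 = 0" "moment2 N C3 = 0"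
      by (rule B_first_cols_properties[OF N6])
    have rel: "relation_vec N c" if c: "c \<in> set L" for c
      using c B_col_properties[OF N6] C unfolding L(3) relation_vec_def by (auto simp: m_def)
    hence Lc: "set L \<subseteq> carrier_vec m" by (auto simp: relation_vec_def m_def)
    have "x \<in> mat_range (B_mat N) \<longleftrightarrow> relation_vec N x"
    proof
      assume "x \<in> mat_range (B_mat N)"
      then obtain z where z: "x = B_mat N *\<^sub>v z" "z \<in> carrier_vec m" using B by (auto simp: mat_range_def)
      have cr: "relation_vec N (col (B_mat N) i)" if "i < m" for i
      proof -
        have "L ! i \<in> set L" using that L(2) by simp
        moreover have "col (B_mat N) i = L ! i" unfolding L(1) using that L(2) Lc by (intro col_mat_of_cols) auto
        ultimately show ?thesis using rel by simp
      qed
      have xc: "x \<in> carrier_vec m" using z B by auto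
      have "12 dvd moment0 N x" "int (N * gcd 2 N) dvd moment2 N x"
        unfolding z(1) moment_mult_mat_vec[OF B[unfolded m_def] z(2)[unfolded m_def]]
        by (intro dvd_sum dvd_mult; use cr in \<open>auto simp: relation_vec_def m_def\<close>)+
      thus "relation_vec N x" using xc by (simp add: relation_vec_def m_def)
    next
      assume r: "relation_vec N x"
      have "set L \<subseteq> mat_range (B_mat N)" unfolding L(1) using mat_of_cols_mat_range[OF Lc] by blast
      hence "set (B_first_cols N) \<subseteq> mat_range (B_mat N)" "B_col N ` {4..N div 2} \<subseteq> mat_range (B_mat N)"
        unfolding L(3) m_def by auto
      thus "x \<in> mat_range (B_mat N)"
        using N6 r by (intro relation_vec_decompose[OF N6 B[unfolded m_def], of "N div 2"]) auto
    qed
    thus ?thesis using B by (simp add: m_def)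
  qed
  thus "B_mat N \<in> carrier_mat (N div 2) (N div 2)"
    "(\<exists>z \<in> carrier_vec (N div 2). x = B_mat N *\<^sub>v z) \<longleftrightarrow> relation_vec N x"
    unfolding mat_range_def by auto
qed

section \<open>The sets \<open>L\<^sub>N(k)\<close>\<close>

lemma invertible_mat_inverse:
  fixes P :: "int Matrix.mat"
  assumes "P \<in> carrier_mat m m" "invertible_mat P"
  obtains P' where "P' \<in> carrier_mat m m" "P * P' = 1\<^sub>m m" "P' * P = 1\<^sub>m m"
proof -
  obtain P' where P': "P * P' = 1\<^sub>m (dim_row P)" "P' * P = 1\<^sub>m (dim_row P')"
    using assms(2) unfolding invertible_mat_def inverts_mat_def by blast
  have "dim_col P' = m" using arg_cong[OF P'(1), of dim_col] assms(1) by simp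
  moreover have "dim_row P' = m" using arg_cong[OF P'(2), of dim_col] assms(1) by simp
  ultimately have "P' \<in> carrier_mat m m" by (intro carrier_matI)
  thus ?thesis using that[of P'] P' assms(1) by simp
qed

lemma map_vec_of_int_mult:
  fixes A :: "int Matrix.mat"
  assumes "A \<in> carrier_mat n k" "v \<in> carrier_vec k"
  shows "(map_vec of_int (A *\<^sub>v v) :: rat Matrix.vec) = map_mat of_int A *\<^sub>v map_vec of_int v"
  by (rule of_int_hom.mult_mat_vec_hom[OF assms])

lemma mat_diag_mult_vec:
  assumes "v \<in> carrier_vec n" "r < n"
  shows "vec_index (mat_diag n f *\<^sub>v v) r = (f r :: rat) * vec_index v r"
proof -
  have "vec_index (mat_diag n f *\<^sub>v v) r = (\<Sum>j = 0..<n. (if r = j then f j else 0) * vec_index v j)"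
    using assms by (simp add: mat_diag_def scalar_prod_def)
  also have "\<dots> = (\<Sum>j = 0..<n. if r = j then f j * vec_index v j else 0)"
    by (intro sum.cong refl) simp
  finally show ?thesis using assms by simp
qed

text \<open>As P A B Q = D, the condition P A y = D t means A y = A B (Q t) because P is invertible,
  and then y = B (Q t) because A is. Since Q is invertible over the integers, Q t runs through all
  integral vectors. Here y may be rational; its integrality is part of the conclusion.\<close>

lemma smith_congruence_iff:
  fixes A :: "rat Matrix.mat" and B :: "int Matrix.mat"
  assumes A: "A \<in> carrier_mat m m" and B: "B \<in> carrier_mat m m"
    and Ai: "Ai \<in> carrier_mat m m" "Ai * A = 1\<^sub>m m"
    and snf: "smith_normal_form m P (A * map_mat of_int B) Q d"
    and y: "y \<in> carrier_vec m"
  shows "(\<forall>r < m. \<exists>t :: int. vec_index (map_mat of_int P *\<^sub>v (A *\<^sub>v y)) r = of_int (d r * t)) \<longleftrightarrow>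
     (\<exists>z \<in> carrier_vec m. y = map_vec of_int (B *\<^sub>v z))"
proof -
  let ?h = "map_mat rat_of_int" and ?v = "map_vec rat_of_int"
  let ?D = "mat_diag m (\<lambda>i. rat_of_int (d i))"
  have P: "P \<in> carrier_mat m m" "invertible_mat P" and Q: "Q \<in> carrier_mat m m" "invertible_mat Q"
    and D: "?h P * (A * ?h B) * ?h Q = ?D"
    using snf unfolding smith_normal_form_def by blast+
  obtain P' where P': "P' \<in> carrier_mat m m" "P * P' = 1\<^sub>m m" "P' * P = 1\<^sub>m m"
    by (rule invertible_mat_inverse[OF P])
  obtain Q' where Q': "Q' \<in> carrier_mat m m" "Q * Q' = 1\<^sub>m m" "Q' * Q = 1\<^sub>m m"
    by (rule invertible_mat_inverse[OF Q])
  have hP: "?h P \<in> carrier_mat m m" "?h P' \<in> carrier_mat m m" "?h B \<in> carrier_mat m m" "?h Q \<in> carrier_mat m m"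
    using P Q P' B by simp_all
  have PP: "?h P' * ?h P = 1\<^sub>m m"
    unfolding of_int_hom.mat_hom_mult[OF P'(1) P(1), symmetric] P'(3) by (rule of_int_hom.mat_hom_one)
  have prod: "?D *\<^sub>v ?v t = ?h P *\<^sub>v (A *\<^sub>v ?v (B *\<^sub>v (Q *\<^sub>v t)))" if t: "t \<in> carrier_vec m" for t
  proof -
    have Qt: "Q *\<^sub>v t \<in> carrier_vec m" using Q(1) t by (rule mult_mat_vec_carrier)
    have vt: "?v t \<in> carrier_vec m" using t by simp
    have hQt: "?h Q *\<^sub>v ?v t \<in> carrier_vec m" using hP(4) vt by (rule mult_mat_vec_carrier)
    have AB: "A * ?h B \<in> carrier_mat m m" using A hP(3) by simp
    have "?D *\<^sub>v ?v t = (?h P * (A * ?h B)) *\<^sub>v (?h Q *\<^sub>v ?v t)"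
      unfolding D[symmetric] by (rule assoc_mult_mat_vec[OF mult_carrier_mat[OF hP(1) AB] hP(4) vt])
    also have "\<dots> = ?h P *\<^sub>v ((A * ?h B) *\<^sub>v (?h Q *\<^sub>v ?v t))"
      by (rule assoc_mult_mat_vec[OF hP(1) AB hQt])
    also have "(A * ?h B) *\<^sub>v (?h Q *\<^sub>v ?v t) = A *\<^sub>v (?h B *\<^sub>v (?h Q *\<^sub>v ?v t))"
      by (rule assoc_mult_mat_vec[OF A hP(3) hQt])
    also have "?h B *\<^sub>v (?h Q *\<^sub>v ?v t) = ?v (B *\<^sub>v (Q *\<^sub>v t))"
      unfolding map_vec_of_int_mult[OF B Qt] map_vec_of_int_mult[OF Q(1) t] ..
    finally show ?thesis .
  qed
  have Dt: "vec_index (?D *\<^sub>v ?v t) r = of_int (d r * vec_index t r)" if "t \<in> carrier_vec m" "r < m" for t r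
    using that mat_diag_mult_vec[of "?v t" m r "\<lambda>i. rat_of_int (d i)"] by simp
  show ?thesis
  proof
    assume "\<forall>r < m. \<exists>t :: int. vec_index (?h P *\<^sub>v (A *\<^sub>v y)) r = of_int (d r * t)"
    then obtain f where f: "\<And>r. r < m \<Longrightarrow> vec_index (?h P *\<^sub>v (A *\<^sub>v y)) r = of_int (d r * f r)" by metis
    define t where "t = Matrix.vec m f"
    have t: "t \<in> carrier_vec m" by (simp add: t_def)
    have "B *\<^sub>v (Q *\<^sub>v t) \<in> carrier_vec m" using B Q(1) t by simp
    hence vBz: "?v (B *\<^sub>v (Q *\<^sub>v t)) \<in> carrier_vec m" by simp
    have Ay: "A *\<^sub>v y \<in> carrier_vec m" using A y by simp
    have "?h P *\<^sub>v (A *\<^sub>v y) = ?D *\<^sub>v ?v t"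
    proof (rule eq_vecI)
      fix r assume "r < dim_vec (?D *\<^sub>v ?v t)"
      hence r: "r < m" by (simp add: mat_diag_def)
      show "vec_index (?h P *\<^sub>v (A *\<^sub>v y)) r = vec_index (?D *\<^sub>v ?v t) r"
        unfolding f[OF r] Dt[OF t r] using r by (simp add: t_def)
    qed (use P in \<open>simp add: mat_diag_def\<close>)
    hence "?h P *\<^sub>v (A *\<^sub>v y) = ?h P *\<^sub>v (A *\<^sub>v ?v (B *\<^sub>v (Q *\<^sub>v t)))" unfolding prod[OF t] .
    hence "?h P' *\<^sub>v (?h P *\<^sub>v (A *\<^sub>v y)) = ?h P' *\<^sub>v (?h P *\<^sub>v (A *\<^sub>v ?v (B *\<^sub>v (Q *\<^sub>v t))))" by simp
    hence "(?h P' * ?h P) *\<^sub>v (A *\<^sub>v y) = (?h P' * ?h P) *\<^sub>v (A *\<^sub>v ?v (B *\<^sub>v (Q *\<^sub>v t)))"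
      using assoc_mult_mat_vec[OF hP(2) hP(1)] Ay mult_mat_vec_carrier[OF A vBz] by simp
    hence "A *\<^sub>v y = A *\<^sub>v ?v (B *\<^sub>v (Q *\<^sub>v t))" unfolding PP using Ay mult_mat_vec_carrier[OF A vBz] by simp
    hence "Ai *\<^sub>v (A *\<^sub>v y) = Ai *\<^sub>v (A *\<^sub>v ?v (B *\<^sub>v (Q *\<^sub>v t)))" by simp
    hence "(Ai * A) *\<^sub>v y = (Ai * A) *\<^sub>v ?v (B *\<^sub>v (Q *\<^sub>v t))"
      using assoc_mult_mat_vec[OF Ai(1) A] y vBz by simp
    hence "y = ?v (B *\<^sub>v (Q *\<^sub>v t))" unfolding Ai(2) using y vBz by simp
    thus "\<exists>z \<in> carrier_vec m. y = ?v (B *\<^sub>v z)" using mult_mat_vec_carrier[OF Q(1) t] by blast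
  next
    assume "\<exists>z \<in> carrier_vec m. y = ?v (B *\<^sub>v z)"
    then obtain z where z: "z \<in> carrier_vec m" "y = ?v (B *\<^sub>v z)" by blast
    define t where "t = Q' *\<^sub>v z"
    have t: "t \<in> carrier_vec m" unfolding t_def using Q'(1) z(1) by (rule mult_mat_vec_carrier)
    have "Q *\<^sub>v t = (Q * Q') *\<^sub>v z" unfolding t_def using assoc_mult_mat_vec[OF Q(1) Q'(1) z(1)] by simp
    hence "Q *\<^sub>v t = z" using Q'(2) z(1) by simp
    hence "?h P *\<^sub>v (A *\<^sub>v y) = ?D *\<^sub>v ?v t" using prod[OF t] z(2) by simp
    thus "\<forall>r < m. \<exists>t :: int. vec_index (?h P *\<^sub>v (A *\<^sub>v y)) r = of_int (d r * t)"
      using Dt[OF t] by auto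
  qed
qed

text \<open>This vector is a particular solution of the two congruences in weight k, so all
  solutions form its coset modulo the lattice of weight 0.\<close>

lemma a_vec_moments:
  assumes "N \<ge> 5"
  shows "a_vec N k \<in> carrier_vec (N div 2)" "moment0 N (a_vec N k) = - int k"
    "int (N * gcd 2 N) dvd moment2 N (a_vec N k)"
proof -
  have "a_vec N k \<in> carrier_vec (N div 2) \<and> moment0 N (a_vec N k) = - int k \<and> int (N * gcd 2 N) dvd moment2 N (a_vec N k)"
  proof (cases "N = 5")
    case True
    have i: "{1..5 div 2} = {1, 2 :: nat}" by auto
    have "moment0 5 (a_vec 5 k) = - int k" "moment2 5 (a_vec 5 k) = 5 * int k"
      unfolding moment0_def moment2_def i by (simp_all add: a_vec_def)
    moreover have "a_vec 5 k \<in> carrier_vec 2" by (rule carrier_vecI) (simp add: a_vec_def)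
    ultimately show ?thesis using True by simp
  next
    case False
    hence "3 \<le> N div 2" using assms by simp
    moreover have "a_vec N k = (-3 * int k) \<cdot>\<^sub>v e_vec N 1 + (3 * int k) \<cdot>\<^sub>v e_vec N 2 - int k \<cdot>\<^sub>v e_vec N 3"
      using False by (simp add: a_vec_def)
    ultimately show ?thesis using moment_e_vec[of 1 N] moment_e_vec[of 2 N] moment_e_vec[of 3 N]
      by (simp add: moment_linear moment_smult)
  qed
  thus "a_vec N k \<in> carrier_vec (N div 2)" "moment0 N (a_vec N k) = - int k"
    "int (N * gcd 2 N) dvd moment2 N (a_vec N k)" by blast+
qed

lemma relation_vec_diff_a_vec:
  assumes "N \<ge> 5" "x \<in> carrier_vec (N div 2)"
  shows "relation_vec N (x - a_vec N k) \<longleftrightarrow> 12 dvd int k + moment0 N x \<and> int (N * gcd 2 N) dvd moment2 N x"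
proof -
  note a = a_vec_moments[OF assms(1), of k]
  have "int (N * gcd 2 N) dvd moment2 N x - moment2 N (a_vec N k) \<longleftrightarrow> int (N * gcd 2 N) dvd moment2 N x"
    using a(3) dvd_add[of _ "moment2 N x - moment2 N (a_vec N k)" "moment2 N (a_vec N k)"] dvd_diff[of _ "moment2 N x" "moment2 N (a_vec N k)"]
    by auto
  thus ?thesis unfolding relation_vec_def using a assms by (simp add: moment_linear add.commute)
qed

lemma cusp_ord_orb_rel:
  assumes "x \<in> carrier_vec (N div 2)" "orb_rel N p q"
  shows "cusp_ord N k x q = cusp_ord N k x p"
proof -
  have "cusp_g N q = cusp_g N p" using assms(2) by (simp add: orb_rel_def)
  thus ?thesis unfolding cusp_ord_vec_ord[OF assms(1)] vec_ord_orb_rel[OF assms(2)] by simp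
qed

text \<open>The valence formula for these products, valid for every integral x: only the power of
  eta contributes to the sum of the orders.\<close>

lemma sum_orbits_cusp_ord:
  assumes "N \<ge> 5" "cusp_orbit_reps N cr" "x \<in> carrier_vec (N div 2)"
  shows "(\<Sum>r = 0..N div 2. rat_of_nat (card (Orb N (cusp N (cr r)))) * cusp_ord N k x (cr r)) =
    rat_of_nat k / 24 * (\<Sum>e | e dvd N. rat_of_nat (e * totient e * totient (N div e)))"
proof -
  have "(\<Sum>r = 0..N div 2. rat_of_nat (card (Orb N (cusp N (cr r)))) * cusp_ord N k x (cr r)) =
    of_nat k / 12 * (\<Sum>r = 0..N div 2. of_nat (card (Orb N (cusp N (cr r)))) * of_int (cusp_g N (cr r))) +
    (\<Sum>r = 0..N div 2. of_nat (card (Orb N (cusp N (cr r)))) * vec_ord N (map_vec of_int x) (cr r))"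
    unfolding cusp_ord_vec_ord[OF assms(3)] sum_distrib_left sum.distrib[symmetric]
    by (intro sum.cong refl) (simp add: algebra_simps)
  thus ?thesis unfolding sum_orbits_g[OF assms(1,2)] sum_orbits_vec_ord[OF assms(1,2)] by simp
qed

text \<open>The shift by k g / 12 in \<open>w_vec\<close> removes the contribution of eta, so v
  records the true orders at all representatives except the last.\<close>

lemma A_mat_mult_eq_w_vec_iff:
  assumes x: "x \<in> carrier_vec (N div 2)"
  shows "A_mat N cr *\<^sub>v map_vec of_int x = w_vec N k cr v \<longleftrightarrow>
     (\<forall>r < N div 2. cusp_ord N k x (cr r) = of_nat (v r))"
proof -
  have vx: "map_vec rat_of_int x \<in> carrier_vec (N div 2)" using x by simp
  have A: "vec_index (A_mat N cr *\<^sub>v map_vec of_int x) r = cusp_ord N k x (cr r) - of_nat k / 12 * of_int (cusp_g N (cr r))"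
    if "r < N div 2" for r
    unfolding A_mat_mult_vec[OF vx that] cusp_ord_vec_ord[OF x] by (simp add: mult.commute)
  have w: "vec_index (w_vec N k cr v) r = of_nat (v r) - of_nat k / 12 * of_int (cusp_g N (cr r))"
    if "r < N div 2" for r
    using that by (simp add: w_vec_def g_vec_def)
  have dims: "dim_vec (A_mat N cr *\<^sub>v map_vec of_int x) = N div 2" "dim_vec (w_vec N k cr v) = N div 2"
    by (simp_all add: A_mat_def w_vec_def g_vec_def)
  have "vec_index (A_mat N cr *\<^sub>v map_vec of_int x) r = vec_index (w_vec N k cr v) r \<longleftrightarrow> cusp_ord N k x (cr r) = of_nat (v r)"
    if "r < N div 2" for r
    unfolding A[OF that] w[OF that] by simp
  thus ?thesis unfolding Matrix.vec_eq_iff dims by blast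
qed

lemma w_vec_carrier: "w_vec N k cr v \<in> carrier_vec (N div 2)"
  by (rule carrier_vecI) (simp add: w_vec_def g_vec_def)

theorem theorem3p1:
  fixes N k m :: nat
    and cr :: "nat \<Rightarrow> int \<times> int"
    and P Q :: "int Matrix.mat"
    and d :: "nat \<Rightarrow> int"
  assumes "N \<ge> 5"
    and "m = N div 2"
    and "cusp_orbit_reps N cr"
    and "smith_normal_form m P (V_mat N cr) Q d"
  shows "finite (L_set N k) \<and>
    map_vec rat_of_int ` L_set N k =
      {the (mat_inverse (A_mat N cr)) *\<^sub>v w_vec N k cr v | v :: nat \<Rightarrow> nat.
         (\<Sum>r = 0..m. rat_of_nat (card (Orb N (cusp N (cr r)))) * rat_of_nat (v r)) =
           rat_of_nat k / 24 *
             (\<Sum>e | e dvd N. rat_of_nat (e * totient e * totient (N div e))) \<and>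
         (\<forall>r < m. \<exists>t :: int.
            vec_index (map_mat rat_of_int P *\<^sub>v
              (w_vec N k cr v - A_mat N cr *\<^sub>v map_vec rat_of_int (a_vec N k))) r =
            rat_of_int (d r * t))}"
proof -
  note N = assms(1) and m = assms(2) and reps = assms(3)
  have N0: "N > 0" using N by simp
  let ?A = "A_mat N cr" and ?v = "map_vec rat_of_int"
  let ?O = "\<lambda>r. rat_of_nat (card (Orb N (cusp N (cr r))))"
  let ?total = "rat_of_nat k / 24 * (\<Sum>e | e dvd N. rat_of_nat (e * totient e * totient (N div e)))"
  let ?cong = "\<lambda>v. \<forall>r < m. \<exists>t :: int.
            vec_index (map_mat rat_of_int P *\<^sub>v (w_vec N k cr v - ?A *\<^sub>v ?v (a_vec N k))) r =
            rat_of_int (d r * t)"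
  obtain Ai where Ai: "mat_inverse ?A = Some Ai" "?A * Ai = 1\<^sub>m m" "Ai * ?A = 1\<^sub>m m" "Ai \<in> carrier_mat m m"
    unfolding m by (rule A_mat_inverse[OF N reps])
  have A: "?A \<in> carrier_mat m m" unfolding m by (rule A_mat_carrier)
  have B: "B_mat N \<in> carrier_mat m m" unfolding m by (rule B_mat_range(1)[OF N])
  have w: "w_vec N k cr v \<in> carrier_vec m" for v unfolding m by (rule w_vec_carrier)
  have a: "a_vec N k \<in> carrier_vec m" unfolding m by (rule a_vec_moments(1)[OF N])
  have snf: "smith_normal_form m P (?A * map_mat of_int (B_mat N)) Q d"
    using assms(4) by (simp only: V_mat_def)
  have Opos: "?O r > 0" if "r \<le> m" for r
    using card_Orb_pos[OF N cusp_orbit_reps_coprime[OF reps]] that by (simp add: m)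
  have cong_iff: "?cong v \<longleftrightarrow> (\<exists>z \<in> carrier_vec m. u - ?v (a_vec N k) = ?v (B_mat N *\<^sub>v z))"
    if u: "u \<in> carrier_vec m" "?A *\<^sub>v u = w_vec N k cr v" for u v
  proof -
    have va: "?v (a_vec N k) \<in> carrier_vec m" using a by simp
    have "w_vec N k cr v - ?A *\<^sub>v ?v (a_vec N k) = ?A *\<^sub>v (u - ?v (a_vec N k))"
      unfolding u(2)[symmetric] by (rule mult_minus_distrib_mat_vec[OF A u(1) va, symmetric])
    moreover have "u - ?v (a_vec N k) \<in> carrier_vec m" using u(1) va by simp
    ultimately show ?thesis by (simp only: smith_congruence_iff[OF A B Ai(4,3) snf])
  qed
  have inv: "Ai *\<^sub>v (?A *\<^sub>v u) = u" if "u \<in> carrier_vec m" for u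
    using assoc_mult_mat_vec[OF Ai(4) A that] Ai(3) that by simp
  have inv': "?A *\<^sub>v (Ai *\<^sub>v u) = u" if "u \<in> carrier_vec m" for u
    using assoc_mult_mat_vec[OF A Ai(4) that] Ai(2) that by simp
  let ?S = "{Ai *\<^sub>v w_vec N k cr v | v. (\<Sum>r = 0..m. ?O r * rat_of_nat (v r)) = ?total \<and> ?cong v}"
  have "?v ` L_set N k \<subseteq> ?S"
  proof
    fix u assume "u \<in> ?v ` L_set N k"
    then obtain x where x: "x \<in> L_set N k" "u = ?v x" by blast
    have xc: "x \<in> carrier_vec m" and xr: "12 dvd int k + moment0 N x" "int (N * gcd 2 N) dvd moment2 N x"
      and xo: "\<And>p. coprime (fst p) (snd p) \<Longrightarrow> cusp_ord N k x p \<ge> 0"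
      using x(1) unfolding L_set_iff[OF N0] m by blast+
    \<comment> \<open>The orders are nonnegative integers, so taking the floor loses nothing; v also
      records the order at the last representative.\<close>
    define v where "v = (\<lambda>r. nat \<lfloor>cusp_ord N k x (cr r)\<rfloor>)"
    have v: "of_nat (v r) = cusp_ord N k x (cr r)" if "r \<le> m" for r
    proof -
      have "cusp_ord N k x (cr r) \<ge> 0" using xo cusp_orbit_reps_coprime[OF reps] that by (simp add: m)
      moreover obtain l where "cusp_ord N k x (cr r) = of_int l"
        using cusp_ord_Ints[OF N0 xr, of "cr r"] by (elim Ints_cases)
      ultimately show ?thesis by (simp add: v_def)
    qed
    have Ax: "?A *\<^sub>v ?v x = w_vec N k cr v"
      using A_mat_mult_eq_w_vec_iff[of x N cr k v] xc v by (simp add: m)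
    have "(\<Sum>r = 0..m. ?O r * rat_of_nat (v r)) = (\<Sum>r = 0..m. ?O r * cusp_ord N k x (cr r))"
      using v by (intro sum.cong refl) simp
    also have "\<dots> = ?total" using sum_orbits_cusp_ord[OF N reps] xc unfolding m by blast
    finally have "(\<Sum>r = 0..m. ?O r * rat_of_nat (v r)) = ?total" .
    moreover have "?cong v"
    proof -
      have "relation_vec N (x - a_vec N k)" using relation_vec_diff_a_vec[OF N] xc xr m by blast
      then obtain z where z: "z \<in> carrier_vec m" "x - a_vec N k = B_mat N *\<^sub>v z"
        using B_mat_range(2)[OF N] m by blast
      have "?v x - ?v (a_vec N k) = ?v (x - a_vec N k)" using xc a by auto
      hence "?v x - ?v (a_vec N k) = ?v (B_mat N *\<^sub>v z)" unfolding z(2) .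
      moreover have "?v x \<in> carrier_vec m" using xc by simp
      ultimately show ?thesis using cong_iff[OF _ Ax] z(1) by blast
    qed
    moreover have "u = Ai *\<^sub>v w_vec N k cr v" unfolding x(2) Ax[symmetric] using xc by (simp add: inv)
    ultimately show "u \<in> ?S" by blast
  qed
  moreover have "?S \<subseteq> ?v ` L_set N k"
  proof
    fix u assume "u \<in> ?S"
    then obtain v where v: "u = Ai *\<^sub>v w_vec N k cr v" "(\<Sum>r = 0..m. ?O r * rat_of_nat (v r)) = ?total" "?cong v"
      by blast
    have uc: "u \<in> carrier_vec m" unfolding v(1) using Ai(4) w by (rule mult_mat_vec_carrier)
    have Au: "?A *\<^sub>v u = w_vec N k cr v" unfolding v(1) by (rule inv'[OF w])
    obtain z where z: "z \<in> carrier_vec m" "u - ?v (a_vec N k) = ?v (B_mat N *\<^sub>v z)"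
      using cong_iff[OF uc Au] v(3) by blast
    define y where "y = B_mat N *\<^sub>v z"
    \<comment> \<open>The congruences modulo the d_r place u in the coset of
      \<open>a_vec N k\<close>, so u comes from an integral vector.\<close>
    define x where "x = a_vec N k + y"
    have y: "y \<in> carrier_vec m" unfolding y_def using B z(1) by (rule mult_mat_vec_carrier)
    have xc: "x \<in> carrier_vec m" unfolding x_def using a y by simp
    have ux: "u = ?v x"
    proof (rule eq_vecI)
      fix i assume "i < dim_vec (?v x)"
      hence i: "i < m" using xc by simp
      have "vec_index (u - ?v (a_vec N k)) i = vec_index (?v y) i" unfolding z(2) y_def ..
      thus "vec_index u i = vec_index (?v x) i" using i a y uc by (simp add: x_def algebra_simps)
    qed (use uc xc in auto)
    have "x - a_vec N k = y"
      by (rule eq_vecI) (use a y in \<open>auto simp: x_def\<close>)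
    hence "x - a_vec N k = B_mat N *\<^sub>v z" by (simp only: y_def)
    hence "relation_vec N (x - a_vec N k)" using B_mat_range(2)[OF N] z(1) m by blast
    hence xr: "12 dvd int k + moment0 N x" "int (N * gcd 2 N) dvd moment2 N x"
      using relation_vec_diff_a_vec[OF N] xc m by blast+
    have o: "cusp_ord N k x (cr r) = of_nat (v r)" if "r < m" for r
      using A_mat_mult_eq_w_vec_iff[of x N cr k v] xc Au that unfolding ux m by blast
    \<comment> \<open>The weighted sums of the orders and of v agree, and so do all terms but the
      last; the positive size of the last orbit can be cancelled.\<close>
    have om: "cusp_ord N k x (cr m) = of_nat (v m)"
    proof -
      have "(\<Sum>r = 0..m. ?O r * cusp_ord N k x (cr r)) = (\<Sum>r = 0..m. ?O r * rat_of_nat (v r))"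
        using sum_orbits_cusp_ord[OF N reps, of x k] xc unfolding v(2) unfolding m by blast
      moreover have "(\<Sum>r = 0..m. f r) = (\<Sum>r = 0..<m. f r) + f m" for f :: "nat \<Rightarrow> rat"
        by (simp add: atLeastLessThanSuc_atLeastAtMost[symmetric])
      moreover have "(\<Sum>r = 0..<m. ?O r * cusp_ord N k x (cr r)) = (\<Sum>r = 0..<m. ?O r * rat_of_nat (v r))"
        using o by (intro sum.cong refl) simp
      ultimately have "?O m * cusp_ord N k x (cr m) = ?O m * rat_of_nat (v m)" by simp
      thus ?thesis using Opos[of m] by simp
    qed
    \<comment> \<open>Every cusp lies in the orbit of some representative, and the order is constant
      on orbits.\<close>
    have "cusp_ord N k x p \<ge> 0" if p: "coprime (fst p) (snd p)" for p
    proof -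
      obtain r where r: "r \<le> m" "orb_rel N (cr r) p" using orbit_of_cusp[OF N reps p] m by blast
      have "cusp_ord N k x p = cusp_ord N k x (cr r)" using cusp_ord_orb_rel[OF _ r(2)] xc m by blast
      also have "\<dots> = of_nat (v r)" using o om r(1) by (cases "r = m") auto
      finally show ?thesis by simp
    qed
    hence "x \<in> L_set N k" unfolding L_set_iff[OF N0] using xc xr m by blast
    thus "u \<in> ?v ` L_set N k" using ux by blast
  qed
  ultimately have eq: "?v ` L_set N k = ?S" by (rule subset_antisym)
  have "finite ?S"
  proof -
    \<comment> \<open>All orbit sizes are at least 1 and all v r are nonnegative, so each v r is
      bounded by the total.\<close>
    obtain b where b: "?total \<le> of_nat b" using real_arch_simple by blast
    have "?S \<subseteq> (\<lambda>f. Ai *\<^sub>v w_vec N k cr f) ` (PiE {..<m} (\<lambda>_. {..b}))"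
    proof
      fix u assume "u \<in> ?S"
      then obtain v where v: "u = Ai *\<^sub>v w_vec N k cr v" "(\<Sum>r = 0..m. ?O r * rat_of_nat (v r)) = ?total"
        by blast
      have le: "v r \<le> b" if "r < m" for r
      proof -
        have "1 \<le> card (Orb N (cusp N (cr r)))" using Opos[of r] that by simp
        hence "rat_of_nat 1 \<le> ?O r" by (simp only: of_nat_le_iff)
        hence "1 * rat_of_nat (v r) \<le> ?O r * rat_of_nat (v r)" by (intro mult_right_mono) auto
        also have "\<dots> \<le> (\<Sum>r = 0..m. ?O r * rat_of_nat (v r))"
          by (rule member_le_sum[of r "{0..m}" "\<lambda>r. ?O r * rat_of_nat (v r)"]) (use that in auto)
        also have "\<dots> \<le> of_nat b" unfolding v(2) by (rule b)
        finally show ?thesis by simp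
      qed
      \<comment> \<open>The vector ignores v at m and beyond, so finitely many restricted functions
        account for all elements.\<close>
      have "w_vec N k cr v = w_vec N k cr (restrict v {..<m})"
        unfolding w_vec_def m by (intro arg_cong2[of _ _ _ _ "(-)"] refl) auto
      thus "u \<in> (\<lambda>f. Ai *\<^sub>v w_vec N k cr f) ` (PiE {..<m} (\<lambda>_. {..b}))"
        unfolding v(1) using le by (intro image_eqI[of _ _ "restrict v {..<m}"]) auto
    qed
    moreover have "finite (PiE {..<m} (\<lambda>_. {..b}) :: (nat \<Rightarrow> nat) set)" by (intro finite_PiE) auto
    ultimately show ?thesis by (meson finite_imageI finite_subset)
  qed
  hence "finite (?v ` L_set N k)" unfolding eq .
  moreover have "inj_on ?v (L_set N k)" by (rule inj_onI) (rule of_int_hom.vec_hom_inj)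
  ultimately have "finite (L_set N k)" by (rule finite_imageD)
  thus ?thesis using eq unfolding Ai(1) option.sel by (rule conjI)
qed

end
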